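(* Let $Y$ be an observation from the degree corrected two-star ERGM $\mathbb{P}_{n,\theta,\bm\beta}$ on $\{-1,1\}^{\binom n2}$. Assume $\theta>1/2$ and $\beta_0=0$ (with $\theta$ fixed and known). Consider testing $\mathcal{H}_0:\bm\beta=\beta_0\mathbf 1=\mathbf 0$ against $\mathcal{H}_1:\bm\beta\in\Xi(s,A)$ with $s=n^b$, $A=n^t$ for fixed $b\in(0,1)$ and $t<0$. (a) If $b\ge\frac12$ and $b+t<0$, all (sequences of) tests are asymptotically not powerful. (b) If $b\ge\frac12$ and $b+t>0$, then for any sequence $L_n$ with $n\ll L_n\ll nsA$ the conditionally centered sum test $$T_n(Y)=\mathbf 1\Big\{\sum_{e\in\mathcal{E}}\big[Y_e-\mathbb{E}_{n,\theta,\mathbf 0}(Y_e\,|\,Y_f:f\ne e)\big]>L_n\Big\}$$ is asymptotically powerful. (c) If $b<\frac12$ and $t+\frac12\le0$, all (sequences of) tests are asymptotically not powerful. (d) If $b<\frac12$ and $t+\frac12>0$, then there is a constant $C>0$ such that the conditionally centered max test $$T_n(Y)=\mathbf 1\Big\{\max_{i\in[n]}\sum_{e\ni i}\big[Y_e-\mathbb{E}_{n,\theta,\mathbf 0}(Y_e\,|\,Y_f:f\ne e)\big]>C\sqrt{n\log n}\Big\}$$ is asymptotically powerful.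
   Context: $\mathcal{E}=\{(i,j):1\le i<j\le n\}$; $Y$ is a symmetric $n\times n$ matrix with $Y_{ij}\in\{-1,1\}$ for $i\ne j$ and $Y_{ii}=0$; for $e=(i,j)\in\mathcal{E}$, $Y_e=Y_{ij}$, and $e\ni i$ means $i$ is an endpoint of $e$. Set $k_i=\sum_{j=1}^nY_{ij}$. The degree corrected two-star ERGM is $$\mathbb{P}_{n,\theta,\bm\beta}(Y)=\frac1{Z_n(\bm\beta,\theta)}\exp\Big\{\frac{\theta}{n-1}\Big(\frac12\sum_{i=1}^nk_i^2-\frac{n(n-1)}2\Big)+\frac12\sum_{i=1}^n\beta_ik_i\Big\},\quad\bm\beta\in\mathbb{R}^n,$$ with $Z_n$ the normalizing constant and $\mathbb{E}_{n,\theta,\bm\beta}$ the expectation. With $\beta_0=0$ the alternative is $$\Xi(s,A)=\{\bm\beta=\bm\mu\in\mathbb{R}^n:\ |\mathrm{supp}(\bm\mu)|\ge s,\ \min_{i\in\mathrm{supp}(\bm\mu)}\mu_i\ge A\}.$$ A (non-randomized) test is a function $T_n$ of $Y$ with values in $\{0,1\}$; its risk is $$R(T_n)=\mathbb{P}_{n,\theta,\mathbf 0}(T_n=1)+\sup_{\bm\beta\in\Xi(s,A)}\mathbb{P}_{n,\theta,\bm\beta}(T_n=0).$$ A sequence $\{T_n\}$ is asymptotically powerful if $\lim_nR(T_n)=0$, and asymptotically not powerful if $\liminf_nR(T_n)>0$. $a_n\ll b_n$ means $a_n/b_n\to0$.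
   Formalization: In (b) the thresholds L_n are required to be eventually positive, as n ≪ L_n intends; with ≪ read only as a ratio tending to 0, L_n = -n^{1+δ} with 0<δ<b+t would be allowed and the claim would fail. *)

theory Defs
  imports "HOL-Probability.Probability"
begin

text \<open>The dimension \<open>n\<close> tends to infinity, so it is a parameter rather than a type.
  Vectors in \<open>\<real>\<^sup>n\<close> are functions on \<open>nat\<close> vanishing outside \<open>{1..n}\<close>, and
  \<open>n \<times> n\<close> matrices are functions \<open>nat \<Rightarrow> nat \<Rightarrow> real\<close> vanishing outside
  \<open>{1..n} \<times> {1..n}\<close>.\<close>

definition edges :: "nat \<Rightarrow> (nat \<times> nat) set" where
  "edges n = {(i, j). 1 \<le> i \<and> i < j \<and> j \<le> n}"

definition edges_at :: "nat \<Rightarrow> nat \<Rightarrow> (nat \<times> nat) set" where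
  "edges_at n i = {e \<in> edges n. fst e = i \<or> snd e = i}"

type_synonym config = "nat \<Rightarrow> nat \<Rightarrow> real"

definition configs :: "nat \<Rightarrow> config set" where
  "configs n = {Y. (\<forall>i j. Y i j = Y j i) \<and>
     (\<forall>i\<in>{1..n}. \<forall>j\<in>{1..n}. i \<noteq> j \<longrightarrow> Y i j \<in> {-1, 1}) \<and>
     (\<forall>i. Y i i = 0) \<and>
     (\<forall>i j. i \<notin> {1..n} \<or> j \<notin> {1..n} \<longrightarrow> Y i j = 0)}"

definition at_edge :: "config \<Rightarrow> nat \<times> nat \<Rightarrow> real" where
  "at_edge Y e = Y (fst e) (snd e)"

definition degree :: "nat \<Rightarrow> config \<Rightarrow> nat \<Rightarrow> real" where
  "degree n Y i = (\<Sum>j=1..n. Y i j)"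

definition log_weight :: "nat \<Rightarrow> real \<Rightarrow> (nat \<Rightarrow> real) \<Rightarrow> config \<Rightarrow> real" where
  "log_weight n \<theta> \<beta> Y =
     \<theta> / (real n - 1) * (1/2 * (\<Sum>i=1..n. (degree n Y i)\<^sup>2) - real n * (real n - 1) / 2)
     + 1/2 * (\<Sum>i=1..n. \<beta> i * degree n Y i)"

definition normalizer :: "nat \<Rightarrow> real \<Rightarrow> (nat \<Rightarrow> real) \<Rightarrow> real" where
  "normalizer n \<theta> \<beta> = (\<Sum>Y\<in>configs n. exp (log_weight n \<theta> \<beta> Y))"

definition ergm :: "nat \<Rightarrow> real \<Rightarrow> (nat \<Rightarrow> real) \<Rightarrow> config pmf" where
  "ergm n \<theta> \<beta> =
     embed_pmf (\<lambda>Y. if Y \<in> configs n then exp (log_weight n \<theta> \<beta> Y) / normalizer n \<theta> \<beta> else 0)"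

lemma finite_configs: "finite (configs n)"
proof -
  let ?\<phi> = "\<lambda>Y::config. {(i, j). i \<in> {1..n} \<and> j \<in> {1..n} \<and> Y i j = 1}"
  have "inj_on ?\<phi> (configs n)"
  proof (rule inj_onI, intro ext)
    fix X Y i j assume X: "X \<in> configs n" and Y: "Y \<in> configs n" and eq: "?\<phi> X = ?\<phi> Y"
    show "X i j = Y i j"
    proof (cases "i \<in> {1..n} \<and> j \<in> {1..n} \<and> i \<noteq> j")
      case True
      then have "X i j = 1 \<longleftrightarrow> Y i j = 1" using eq by (auto simp: set_eq_iff)
      moreover have "X i j \<in> {-1, 1}" "Y i j \<in> {-1, 1}"
        using X Y True by (auto simp: configs_def)
      ultimately show ?thesis by auto
    next
      case False
      then show ?thesis using X Y by (cases "i = j") (auto simp: configs_def)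
    qed
  qed
  moreover have "?\<phi> ` configs n \<subseteq> Pow ({1..n} \<times> {1..n})" by auto
  ultimately show ?thesis by (rule inj_on_finite) simp
qed

lemma configs_nonempty: "configs n \<noteq> {}"
proof -
  have "(\<lambda>i j. if i \<in> {1..n} \<and> j \<in> {1..n} \<and> i \<noteq> j then 1 else 0) \<in> configs n"
    by (auto simp: configs_def)
  then show ?thesis by blast
qed

lemma normalizer_pos: "normalizer n \<theta> \<beta> > 0"
  unfolding normalizer_def by (intro sum_pos finite_configs configs_nonempty) simp

lemma pmf_ergm:
  "pmf (ergm n \<theta> \<beta>) Y =
     (if Y \<in> configs n then exp (log_weight n \<theta> \<beta> Y) / normalizer n \<theta> \<beta> else 0)"
  unfolding ergm_def
proof (rule pmf_embed_pmf)
  let ?f = "\<lambda>Y. if Y \<in> configs n then exp (log_weight n \<theta> \<beta> Y) / normalizer n \<theta> \<beta> else 0"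
  show nn: "0 \<le> ?f Y" for Y using normalizer_pos[of n \<theta> \<beta>] by simp
  have "(\<integral>\<^sup>+Y. ennreal (?f Y) \<partial>count_space UNIV) = (\<Sum>Y\<in>configs n. ennreal (?f Y))"
    by (rule nn_integral_count_space'[OF finite_configs]) auto
  also have "\<dots> = ennreal (\<Sum>Y\<in>configs n. ?f Y)"
    by (rule sum_ennreal) (rule nn)
  also have "(\<Sum>Y\<in>configs n. ?f Y) = 1"
    using normalizer_pos[of n \<theta> \<beta>]
    by (simp add: normalizer_def flip: sum_divide_distrib)
  finally show "(\<integral>\<^sup>+Y. ennreal (?f Y) \<partial>count_space UNIV) = 1" by simp
qed

lemma set_pmf_ergm: "set_pmf (ergm n \<theta> \<beta>) = configs n"
  using normalizer_pos[of n \<theta> \<beta>] by (auto simp: set_pmf_eq pmf_ergm)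

definition agree_off :: "nat \<Rightarrow> nat \<times> nat \<Rightarrow> config \<Rightarrow> config set" where
  "agree_off n e Y = {Y'. \<forall>f\<in>edges n - {e}. at_edge Y' f = at_edge Y f}"

lemma ergm_agree_off_nonempty:
  "Y \<in> configs n \<Longrightarrow> set_pmf (ergm n \<theta> \<beta>) \<inter> agree_off n e Y \<noteq> {}"
  by (auto simp: set_pmf_ergm agree_off_def)

text \<open>\<open>\<bbbE>(Y\<^sub>e | Y\<^sub>f : f \<noteq> e)\<close> as a function of the realisation \<open>Y\<close>. The conditioning event
  has positive probability for every \<open>Y \<in> configs n\<close>, so \<^const>\<open>cond_pmf\<close> is meaningful.\<close>

definition cond_mean_edge ::
    "nat \<Rightarrow> real \<Rightarrow> (nat \<Rightarrow> real) \<Rightarrow> nat \<times> nat \<Rightarrow> config \<Rightarrow> real" where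
  "cond_mean_edge n \<theta> \<beta> e Y =
     measure_pmf.expectation (cond_pmf (ergm n \<theta> \<beta>) (agree_off n e Y)) (\<lambda>Y'. at_edge Y' e)"

definition supp :: "nat \<Rightarrow> (nat \<Rightarrow> real) \<Rightarrow> nat set" where
  "supp n \<mu> = {i \<in> {1..n}. \<mu> i \<noteq> 0}"

definition alternative :: "nat \<Rightarrow> real \<Rightarrow> real \<Rightarrow> (nat \<Rightarrow> real) set" where
  "alternative n s A = {\<mu>. (\<forall>i. i \<notin> {1..n} \<longrightarrow> \<mu> i = 0) \<and>
     real (card (supp n \<mu>)) \<ge> s \<and> (\<forall>i\<in>supp n \<mu>. \<mu> i \<ge> A)}"

definition is_test :: "nat \<Rightarrow> (config \<Rightarrow> nat) \<Rightarrow> bool" where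
  "is_test n T \<longleftrightarrow> (\<forall>Y\<in>configs n. T Y \<in> {0, 1})"

definition risk :: "nat \<Rightarrow> real \<Rightarrow> real \<Rightarrow> real \<Rightarrow> (config \<Rightarrow> nat) \<Rightarrow> real" where
  "risk n \<theta> s A T =
     measure_pmf.prob (ergm n \<theta> (\<lambda>_. 0)) {Y. T Y = 1} +
     (SUP \<beta>\<in>alternative n s A. measure_pmf.prob (ergm n \<theta> \<beta>) {Y. T Y = 0})"

definition asymp_powerful ::
    "real \<Rightarrow> (nat \<Rightarrow> real) \<Rightarrow> (nat \<Rightarrow> real) \<Rightarrow> (nat \<Rightarrow> config \<Rightarrow> nat) \<Rightarrow> bool" where
  "asymp_powerful \<theta> s A T \<longleftrightarrow> (\<lambda>n. risk n \<theta> (s n) (A n) (T n)) \<longlonglongrightarrow> 0"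

definition asymp_not_powerful ::
    "real \<Rightarrow> (nat \<Rightarrow> real) \<Rightarrow> (nat \<Rightarrow> real) \<Rightarrow> (nat \<Rightarrow> config \<Rightarrow> nat) \<Rightarrow> bool" where
  "asymp_not_powerful \<theta> s A T \<longleftrightarrow> liminf (\<lambda>n. ereal (risk n \<theta> (s n) (A n) (T n))) > 0"

definition cc_sum_test :: "real \<Rightarrow> (nat \<Rightarrow> real) \<Rightarrow> nat \<Rightarrow> config \<Rightarrow> nat" where
  "cc_sum_test \<theta> L n Y =
     of_bool ((\<Sum>e\<in>edges n. at_edge Y e - cond_mean_edge n \<theta> (\<lambda>_. 0) e Y) > L n)"

definition cc_max_test :: "real \<Rightarrow> real \<Rightarrow> nat \<Rightarrow> config \<Rightarrow> nat" where
  "cc_max_test \<theta> C n Y =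
     of_bool (Max ((\<lambda>i. \<Sum>e\<in>edges_at n i. at_edge Y e - cond_mean_edge n \<theta> (\<lambda>_. 0) e Y) ` {1..n})
       > C * sqrt (real n * ln (real n)))"

definition much_less :: "(nat \<Rightarrow> real) \<Rightarrow> (nat \<Rightarrow> real) \<Rightarrow> bool" where
  "much_less a b \<longleftrightarrow> (\<lambda>n. a n / b n) \<longlonglongrightarrow> 0"

end

theory Submission
  imports Defs "HOL-Real_Asymp.Real_Asymp"
begin

text \<open>For the tests, the exchangeable-pair argument shows that the sum of the conditionally centred edges
  in a set \<open>Q\<close> is sub-Gaussian with variance proxy of order \<open>|Q|\<close>, in every phase. Under an alternative,
  centring with the null conditional means shifts this sum by the total gap between the conditional means,
  which is at least of order \<open>n A\<close> per vertex of the support.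

  For the lower bounds, plant the value \<open>A\<close> on a random set. The likelihood ratio mixture is controlled in
  the plus phase only: on the event that all degrees are near \<open>n r\<close> with \<open>r = tanh (2 \<theta> r)\<close>, the null measure
  is proportional to a surrogate whose energy is truncated to be a contraction, so that Dobrushin's
  comparison theorem gives the second moment of the likelihood ratio under the surrogate. The null measure
  puts nearly all its mass on this event and its image under sign change, because the energy is a sum over
  pairs of vertices of a double well in the rescaled degrees and there are at most \<open>(2n)\<^sup>n\<close> degree
  sequences.\<close>

section \<open>Edges and configurations\<close>

text \<open>The obstacle to the lower bounds is the bimodality of the null for \<theta> > 1/2: the
  influences on one edge add up to as much as 2 \<theta> > 1, so Dobrushin's condition fails for the
  model itself. Only a positive lower limit of the risk is claimed, so constant factors are free,
  and passing to the plus window costs only such a factor. Because the planted effects are positive,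
  the tilt favours the plus phase: the minus phase contributes at most 1 to the normalizer of a
  planted model, and outside both phases the null has mass at most exp (-c n), which absorbs a tilt
  of at most exp (c n) once A m is small, m being the number of planted vertices.

  For planted sets S and S' of size m the second moment has an exponent of order A^2 (n |S \<inter>
  S'| + m^2). The first part is a direct effect of common vertices, the second is mean-field
  feedback. After averaging over the prior both stay bounded when n A^2 and A m do, and these two
  conditions correspond to the two thresholds. Parts (a) and (c) are therefore two instances of one
  statement with b + t < 0 and t \<le> -1/2. At t = -1/2 the second moment is bounded but need not
  tend to 1, hence the bounds with explicit constants.\<close>

lemma edges_Sigma: "edges n \<subseteq> {1..n} \<times> {1..n}"
  by (auto simp: edges_def)

lemma finite_edges [simp]: "finite (edges n)"
  by (rule finite_subset[OF edges_Sigma]) simp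

lemma edges_at_subset: "edges_at n i \<subseteq> edges n"
  by (auto simp: edges_at_def)

lemma finite_edges_at [simp]: "finite (edges_at n i)"
  by (rule finite_subset[OF edges_at_subset]) simp

lemma edgesD:
  assumes "e \<in> edges n"
  shows "fst e \<in> {1..n}" "snd e \<in> {1..n}" "fst e < snd e"
  using assms by (auto simp: edges_def)

text \<open>An edge at \<open>i\<close> is determined by its other endpoint, recovered as
  \<open>fst e + snd e - i\<close>; symmetry of \<open>g\<close> hides the orientation forced by
  \<open>fst e < snd e\<close>.\<close>

lemma sum_edges_at:
  fixes g :: "nat \<Rightarrow> nat \<Rightarrow> real"
  assumes i: "i \<in> {1..n}" and sym: "\<And>j. g i j = g j i"
  shows "(\<Sum>e\<in>edges_at n i. g (fst e) (snd e)) = (\<Sum>j\<in>{1..n}-{i}. g i j)"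
proof (rule sum.reindex_bij_witness[where i = "\<lambda>j. (min i j, max i j)" and j = "\<lambda>e. fst e + snd e - i"])
  fix e assume "e \<in> edges_at n i"
  then have e: "1 \<le> fst e" "fst e < snd e" "snd e \<le> n" "fst e = i \<or> snd e = i"
    by (auto simp: edges_at_def edges_def)
  show "(min i (fst e + snd e - i), max i (fst e + snd e - i)) = e"
    using e by (cases e) auto
  show "fst e + snd e - i \<in> {1..n} - {i}" using e by auto
  show "g i (fst e + snd e - i) = g (fst e) (snd e)" using e sym by auto
next
  fix j assume "j \<in> {1..n} - {i}"
  then show "fst (min i j, max i j) + snd (min i j, max i j) - i = j"
    and "(min i j, max i j) \<in> edges_at n i"
    using i by (auto simp: edges_at_def edges_def min_def max_def)
qed

text \<open>Double counting. The summand may depend on the endpoint from which the edge is seen, so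
  that vertex weights and indicators of vertex sets can be carried along.\<close>

lemma sum_vertices_edges:
  fixes g :: "nat \<Rightarrow> nat \<times> nat \<Rightarrow> real"
  shows "(\<Sum>i=1..n. \<Sum>e\<in>edges_at n i. g i e) = (\<Sum>e\<in>edges n. g (fst e) e + g (snd e) e)"
proof -
  have "(\<Sum>i=1..n. \<Sum>e\<in>edges_at n i. g i e) =
      (\<Sum>i=1..n. \<Sum>e\<in>edges n. if fst e = i \<or> snd e = i then g i e else 0)"
    by (simp add: edges_at_def sum.inter_filter)
  also have "\<dots> = (\<Sum>e\<in>edges n. \<Sum>i=1..n. if fst e = i \<or> snd e = i then g i e else 0)"
    by (rule sum.swap)
  also have "\<dots> = (\<Sum>e\<in>edges n. g (fst e) e + g (snd e) e)"
  proof (rule sum.cong[OF refl])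
    fix e assume e: "e \<in> edges n"
    note D = edgesD[OF e]
    have "(\<Sum>i=1..n. if fst e = i \<or> snd e = i then g i e else 0)
        = (\<Sum>i=1..n. (if fst e = i then g i e else 0) + (if snd e = i then g i e else 0))"
      using D by (intro sum.cong refl) auto
    also have "\<dots> = g (fst e) e + g (snd e) e"
      using D by (simp add: sum.distrib)
    finally show "(\<Sum>i=1..n. if fst e = i \<or> snd e = i then g i e else 0)
        = g (fst e) e + g (snd e) e" .
  qed
  finally show ?thesis .
qed

lemma card_edges_at:
  assumes "i \<in> {1..n}" shows "real (card (edges_at n i)) = real n - 1"
  using sum_edges_at[OF assms, of "\<lambda>_ _. 1"] assms by (auto simp: of_nat_diff)

lemma card_edges: "real (card (edges n)) = real n * (real n - 1) / 2"
proof -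
  have "(\<Sum>i=1..n. \<Sum>e\<in>edges_at n i. 1) = (\<Sum>i=1..n. real n - 1)"
    by (intro sum.cong refl) (simp add: card_edges_at)
  then show ?thesis using sum_vertices_edges[of "\<lambda>_ _. 1" n] by simp
qed

lemma configs_sym: "Y \<in> configs n \<Longrightarrow> Y i j = Y j i"
  unfolding configs_def by blast

lemma configs_diag: "Y \<in> configs n \<Longrightarrow> Y i i = 0"
  unfolding configs_def by blast

lemma configs_outside: "Y \<in> configs n \<Longrightarrow> \<not> (i \<in> {1..n} \<and> j \<in> {1..n}) \<Longrightarrow> Y i j = 0"
  unfolding configs_def by blast

lemma at_edge_cases:
  assumes "Y \<in> configs n" "e \<in> edges n"
  shows "at_edge Y e = 1 \<or> at_edge Y e = -1"
proof -
  have "Y (fst e) (snd e) \<in> {-1, 1}"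
    using assms(1) edgesD[OF assms(2)] by (simp add: configs_def)
  then show ?thesis by (auto simp: at_edge_def)
qed

lemma abs_at_edge: "Y \<in> configs n \<Longrightarrow> e \<in> edges n \<Longrightarrow> \<bar>at_edge Y e\<bar> = 1"
  using at_edge_cases[of Y n e] by auto

lemma degree_edges:
  assumes Y: "Y \<in> configs n" and i: "i \<in> {1..n}"
  shows "degree n Y i = (\<Sum>e\<in>edges_at n i. at_edge Y e)"
proof -
  have s: "Y i j = Y j i" "Y i i = 0" for j using configs_sym[OF Y] configs_diag[OF Y] by blast+
  have "(\<Sum>e\<in>edges_at n i. at_edge Y e) = (\<Sum>j\<in>{1..n}-{i}. Y i j)"
    unfolding at_edge_def by (rule sum_edges_at[OF i]) (rule s)
  also have "\<dots> = degree n Y i"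
    unfolding degree_def using i s(2) by (subst sum.remove[of "{1..n}" i]) auto
  finally show ?thesis ..
qed

lemma sum_weighted_degrees:
  assumes Y: "Y \<in> configs n"
  shows "(\<Sum>i=1..n. w i * degree n Y i) = (\<Sum>e\<in>edges n. (w (fst e) + w (snd e)) * at_edge Y e)"
proof -
  have "(\<Sum>i=1..n. w i * degree n Y i) = (\<Sum>i=1..n. \<Sum>e\<in>edges_at n i. w i * at_edge Y e)"
    by (intro sum.cong refl) (simp add: degree_edges[OF Y] sum_distrib_left)
  also have "\<dots> = (\<Sum>e\<in>edges n. (w (fst e) + w (snd e)) * at_edge Y e)"
    by (subst sum_vertices_edges) (simp add: algebra_simps)
  finally show ?thesis .
qed

lemma abs_degree_le:
  assumes Y: "Y \<in> configs n" and i: "i \<in> {1..n}"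
  shows "\<bar>degree n Y i\<bar> \<le> real n - 1"
proof -
  have "\<bar>degree n Y i\<bar> \<le> (\<Sum>e\<in>edges_at n i. \<bar>at_edge Y e\<bar>)"
    unfolding degree_edges[OF assms] by (rule sum_abs)
  also have "\<dots> = (\<Sum>e\<in>edges_at n i. 1)"
    using abs_at_edge[OF Y] edges_at_subset by (intro sum.cong refl) blast
  finally show ?thesis using card_edges_at[OF i] by simp
qed

text \<open>Both orientations are overwritten, so that symmetry of the matrix survives. This is the
  elementary move of single-edge dynamics.\<close>

definition set_edge :: "nat \<times> nat \<Rightarrow> real \<Rightarrow> config \<Rightarrow> config" where
  "set_edge e v Y = (\<lambda>i j. if i = fst e \<and> j = snd e \<or> i = snd e \<and> j = fst e then v else Y i j)"

lemma set_edge_in_configs [intro]: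
  assumes "Y \<in> configs n" "e \<in> edges n" "v = 1 \<or> v = -1"
  shows "set_edge e v Y \<in> configs n"
  using assms by (auto simp: configs_def set_edge_def edges_def)

lemma at_edge_set_edge:
  assumes "e \<in> edges n" "f \<in> edges n"
  shows "at_edge (set_edge e v Y) f = (if f = e then v else at_edge Y f)"
  using assms by (auto simp: at_edge_def set_edge_def edges_def)

lemma set_edge_set_edge [simp]: "set_edge e v (set_edge e w Y) = set_edge e v Y"
  by (auto simp: set_edge_def fun_eq_iff)

lemma set_edge_commute:
  assumes "e \<in> edges n" "f \<in> edges n" "e \<noteq> f"
  shows "set_edge e v (set_edge f w Y) = set_edge f w (set_edge e v Y)"
  using assms by (cases e; cases f) (auto simp: set_edge_def edges_def fun_eq_iff)

lemma set_edge_self: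
  assumes "Y \<in> configs n" shows "set_edge e (at_edge Y e) Y = Y"
  using configs_sym[OF assms] by (auto simp: set_edge_def at_edge_def fun_eq_iff)

lemma config_eqI:
  assumes X: "X \<in> configs n" and Y: "Y \<in> configs n"
    and eq: "\<And>e. e \<in> edges n \<Longrightarrow> at_edge X e = at_edge Y e"
  shows "X = Y"
proof (intro ext)
  have lt: "X i j = Y i j" if "i \<in> {1..n}" "j \<in> {1..n}" "i < j" for i j
    using eq[of "(i, j)"] that by (auto simp: edges_def at_edge_def)
  fix i j
  show "X i j = Y i j"
  proof (cases "i \<in> {1..n} \<and> j \<in> {1..n}")
    case True
    moreover have "X i j = X j i" "Y i j = Y j i" "X i i = 0" "Y i i = 0"
      using configs_sym[of _ n] configs_diag[of _ n] X Y by blast+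
    ultimately show ?thesis using lt[of i j] lt[of j i] by (cases i j rule: linorder_cases) auto
  next
    case False
    then show ?thesis using configs_outside[OF X] configs_outside[OF Y] by metis
  qed
qed

lemma degree_set_edge:
  assumes Y: "Y \<in> configs n" and e: "e \<in> edges n" and v: "v = 1 \<or> v = -1" and i: "i \<in> {1..n}"
  shows "degree n (set_edge e v Y) i =
    degree n Y i + (if fst e = i \<or> snd e = i then v - at_edge Y e else 0)"
proof -
  have "degree n (set_edge e v Y) i = (\<Sum>f\<in>edges_at n i. at_edge Y f + (if f = e then v - at_edge Y e else 0))"
    unfolding degree_edges[OF set_edge_in_configs[OF Y e v] i]
  proof (intro sum.cong refl)
    fix f assume "f \<in> edges_at n i"
    then have "f \<in> edges n" by (simp add: edges_at_def)
    then show "at_edge (set_edge e v Y) f = at_edge Y f + (if f = e then v - at_edge Y e else 0)"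
      by (simp add: at_edge_set_edge[OF e])
  qed
  also have "\<dots> = degree n Y i + (if e \<in> edges_at n i then v - at_edge Y e else 0)"
    by (simp add: sum.distrib degree_edges[OF Y i])
  finally show ?thesis using e by (simp add: edges_at_def)
qed

lemma uminus_in_configs:
  assumes "Y \<in> configs n" shows "(\<lambda>i j. - Y i j) \<in> configs n"
proof -
  have "- Y i j \<in> {-1, 1}" if "Y i j \<in> {-1, 1}" for i j using that by auto
  then show ?thesis using assms unfolding configs_def by simp
qed

lemma degree_uminus: "degree n (\<lambda>i j. - Y i j) i = - degree n Y i"
  by (simp add: degree_def sum_negf)

section \<open>Gibbs measures and resampling of an edge\<close>

text \<open>Finite weighted sums replace the pmf because the energy \<open>H\<close> also ranges
  over tilted and truncated energies that are not of the form \<open>log_weight\<close>.\<close>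

definition gibbs_sum :: "nat \<Rightarrow> (config \<Rightarrow> real) \<Rightarrow> (config \<Rightarrow> real) \<Rightarrow> real" where
  "gibbs_sum n H F = (\<Sum>Y\<in>configs n. exp (H Y) * F Y)"

definition gibbs_mean :: "nat \<Rightarrow> (config \<Rightarrow> real) \<Rightarrow> (config \<Rightarrow> real) \<Rightarrow> real" where
  "gibbs_mean n H F = gibbs_sum n H F / gibbs_sum n H (\<lambda>_. 1)"

text \<open>For a spin with values 1 and -1 whose two energies differ by d, the conditional mean
  given everything else is tanh (d / 2).\<close>

definition local_mean :: "(config \<Rightarrow> real) \<Rightarrow> nat \<times> nat \<Rightarrow> config \<Rightarrow> real" where
  "local_mean H e Y = tanh ((H (set_edge e 1 Y) - H (set_edge e (-1) Y)) / 2)"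

text \<open>The heat-bath (Glauber) kernel at the edge \<open>e\<close>, acting on functions: the
  conditional expectation of \<open>F\<close> given all other edges.\<close>

definition resample ::
    "(config \<Rightarrow> real) \<Rightarrow> nat \<times> nat \<Rightarrow> (config \<Rightarrow> real) \<Rightarrow> config \<Rightarrow> real" where
  "resample H e F Y = ((1 + local_mean H e Y) * F (set_edge e 1 Y)
     + (1 - local_mean H e Y) * F (set_edge e (-1) Y)) / 2"

lemma gibbs_sum_one_pos: "gibbs_sum n H (\<lambda>_. 1) > 0"
  unfolding gibbs_sum_def by (intro sum_pos finite_configs configs_nonempty) simp

lemma gibbs_sum_mono:
  "(\<And>Y. Y \<in> configs n \<Longrightarrow> F Y \<le> G Y) \<Longrightarrow> gibbs_sum n H F \<le> gibbs_sum n H G"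
  unfolding gibbs_sum_def by (intro sum_mono mult_left_mono) auto

lemma gibbs_mean_mono:
  "(\<And>Y. Y \<in> configs n \<Longrightarrow> F Y \<le> G Y) \<Longrightarrow> gibbs_mean n H F \<le> gibbs_mean n H G"
  unfolding gibbs_mean_def using gibbs_sum_one_pos[of n H]
  by (intro divide_right_mono gibbs_sum_mono) auto

lemma gibbs_mean_cong:
  "(\<And>Y. Y \<in> configs n \<Longrightarrow> F Y = G Y) \<Longrightarrow> gibbs_mean n H F = gibbs_mean n H G"
  unfolding gibbs_mean_def gibbs_sum_def by simp

lemma gibbs_mean_const [simp]: "gibbs_mean n H (\<lambda>_. c) = c"
proof -
  have "gibbs_sum n H (\<lambda>_. c) = c * gibbs_sum n H (\<lambda>_. 1)"
    by (simp add: gibbs_sum_def sum_distrib_left mult_ac)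
  then show ?thesis using gibbs_sum_one_pos[of n H] by (simp add: gibbs_mean_def)
qed

lemma gibbs_mean_add:
  "gibbs_mean n H (\<lambda>Y. F Y + G Y) = gibbs_mean n H F + gibbs_mean n H G"
  by (simp add: gibbs_mean_def gibbs_sum_def algebra_simps sum.distrib add_divide_distrib)

lemma gibbs_mean_diff:
  "gibbs_mean n H (\<lambda>Y. F Y - G Y) = gibbs_mean n H F - gibbs_mean n H G"
  by (simp add: gibbs_mean_def gibbs_sum_def algebra_simps sum_subtractf diff_divide_distrib)

lemma gibbs_mean_cmult: "gibbs_mean n H (\<lambda>Y. c * F Y) = c * gibbs_mean n H F"
  by (simp add: gibbs_mean_def gibbs_sum_def sum_distrib_left mult_ac)

lemma gibbs_mean_sum: "gibbs_mean n H (\<lambda>Y. \<Sum>i\<in>I. F i Y) = (\<Sum>i\<in>I. gibbs_mean n H (F i))"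
  by (simp add: gibbs_mean_def gibbs_sum_def sum_distrib_left sum_divide_distrib)
     (rule sum.swap)

lemma gibbs_mean_nonneg:
  "(\<And>Y. Y \<in> configs n \<Longrightarrow> F Y \<ge> 0) \<Longrightarrow> gibbs_mean n H F \<ge> 0"
  using gibbs_mean_mono[of n "\<lambda>_. 0" F H] by simp

lemma gibbs_mean_abs_le:
  assumes "\<And>Y. Y \<in> configs n \<Longrightarrow> \<bar>F Y\<bar> \<le> G Y"
  shows "\<bar>gibbs_mean n H F\<bar> \<le> gibbs_mean n H G"
proof -
  have "gibbs_mean n H F \<le> gibbs_mean n H G" "gibbs_mean n H (\<lambda>Y. - F Y) \<le> gibbs_mean n H G"
    using assms by (intro gibbs_mean_mono, force simp: abs_le_iff)+
  then show ?thesis using gibbs_mean_cmult[of n H "-1" F] by simp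
qed

lemma gibbs_mean_pos:
  assumes "\<And>Y. Y \<in> configs n \<Longrightarrow> F Y > 0" shows "gibbs_mean n H F > 0"
  unfolding gibbs_mean_def gibbs_sum_def using assms
  by (intro divide_pos_pos sum_pos finite_configs configs_nonempty) auto

lemma gibbs_prob_union:
  assumes "finite I"
  shows "gibbs_mean n H (\<lambda>Y. of_bool (\<exists>i\<in>I. P i Y)) \<le> (\<Sum>i\<in>I. gibbs_mean n H (\<lambda>Y. of_bool (P i Y)))"
proof -
  have "gibbs_mean n H (\<lambda>Y. of_bool (\<exists>i\<in>I. P i Y)) \<le> gibbs_mean n H (\<lambda>Y. \<Sum>i\<in>I. of_bool (P i Y))"
  proof (rule gibbs_mean_mono)
    fix Y
    show "(of_bool (\<exists>i\<in>I. P i Y) :: real) \<le> (\<Sum>i\<in>I. of_bool (P i Y))"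
    proof (cases "\<exists>i\<in>I. P i Y")
      case True
      then obtain i where "i \<in> I" "P i Y" by blast
      then have "(of_bool (P i Y) :: real) \<le> (\<Sum>i\<in>I. of_bool (P i Y))"
        using assms by (intro member_le_sum) auto
      then show ?thesis using True \<open>P i Y\<close> by simp
    qed (simp add: sum_nonneg)
  qed
  then show ?thesis by (simp add: gibbs_mean_sum)
qed

section \<open>Heat-bath updates and the conditional means of the model\<close>

lemma prob_ergm:
  "measure_pmf.prob (ergm n \<theta> \<beta>) {Y. P Y} = gibbs_mean n (log_weight n \<theta> \<beta>) (\<lambda>Y. of_bool (P Y))"
proof -
  have "measure_pmf.prob (ergm n \<theta> \<beta>) {Y. P Y} = measure_pmf.prob (ergm n \<theta> \<beta>) ({Y. P Y} \<inter> configs n)"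
    using measure_Int_set_pmf[of "ergm n \<theta> \<beta>"] by (simp add: set_pmf_ergm)
  also have "\<dots> = (\<Sum>Y\<in>{Y. P Y} \<inter> configs n. exp (log_weight n \<theta> \<beta> Y) / normalizer n \<theta> \<beta>)"
    by (subst measure_measure_pmf_finite) (auto simp: finite_configs pmf_ergm intro!: sum.cong)
  also have "\<dots> = (\<Sum>Y\<in>configs n. exp (log_weight n \<theta> \<beta> Y) * of_bool (P Y) / normalizer n \<theta> \<beta>)"
    by (rule sum.mono_neutral_cong_left) (auto simp: finite_configs)
  finally show ?thesis
    by (simp add: gibbs_mean_def gibbs_sum_def normalizer_def sum_divide_distrib)
qed

lemma one_plus_tanh_half_diff:
  fixes p q :: real
  shows "(1 + tanh ((p - q) / 2)) / 2 = exp p / (exp p + exp q)"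
    and "(1 - tanh ((p - q) / 2)) / 2 = exp q / (exp p + exp q)"
proof -
  have "tanh ((p - q) / 2) = (1 - exp q / exp p) / (1 + exp q / exp p)"
  proof -
    have x: "- 2 * ((p - q) / 2) = q - p" by simp
    show ?thesis unfolding tanh_real_altdef x exp_diff by simp
  qed
  also have "\<dots> = (exp p - exp q) / (exp p + exp q)"
    using exp_gt_zero[of p] exp_gt_zero[of q] by (simp add: divide_simps)
  finally have t: "tanh ((p - q) / 2) = (exp p - exp q) / (exp p + exp q)" .
  have "exp p + exp q > 0" by (simp add: add_pos_pos)
  then show "(1 + tanh ((p - q) / 2)) / 2 = exp p / (exp p + exp q)"
    and "(1 - tanh ((p - q) / 2)) / 2 = exp q / (exp p + exp q)"
    unfolding t by (simp_all add: divide_simps)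
qed

text \<open>Flipping \<open>e\<close> is an involution of the configurations, and each pair
  exchanged by it consists of the two configurations with \<open>e\<close> set to 1 and to
  -1.\<close>

lemma sum_set_edge:
  fixes \<phi> :: "config \<Rightarrow> real"
  assumes e: "e \<in> edges n"
  shows "(\<Sum>Y\<in>configs n. \<phi> Y) = (\<Sum>Y\<in>configs n. (\<phi> (set_edge e 1 Y) + \<phi> (set_edge e (-1) Y)) / 2)"
proof -
  define flip where "flip Y = set_edge e (- at_edge Y e) Y" for Y
  have in_c: "flip Y \<in> configs n" and inv: "flip (flip Y) = Y" if "Y \<in> configs n" for Y
  proof -
    show "flip Y \<in> configs n"
      using at_edge_cases[OF that e] that e by (auto simp: flip_def)
    show "flip (flip Y) = Y"
      using set_edge_self[OF that, of e] by (simp add: flip_def at_edge_set_edge[OF e e])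
  qed
  have "(\<Sum>Y\<in>configs n. \<phi> Y) = (\<Sum>Y\<in>configs n. \<phi> (flip Y))"
    by (rule sum.reindex_bij_witness[of _ flip flip]) (auto simp: in_c inv)
  then have "(\<Sum>Y\<in>configs n. \<phi> Y) = (\<Sum>Y\<in>configs n. (\<phi> Y + \<phi> (flip Y)) / 2)"
    by (simp add: sum.distrib flip: sum_divide_distrib)
  also have "\<dots> = (\<Sum>Y\<in>configs n. (\<phi> (set_edge e 1 Y) + \<phi> (set_edge e (-1) Y)) / 2)"
  proof (rule sum.cong[OF refl])
    fix Y assume Y: "Y \<in> configs n"
    show "(\<phi> Y + \<phi> (flip Y)) / 2 = (\<phi> (set_edge e 1 Y) + \<phi> (set_edge e (-1) Y)) / 2"
      using at_edge_cases[OF Y e] set_edge_self[OF Y, of e] by (auto simp: flip_def)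
  qed
  finally show ?thesis .
qed

lemma local_mean_set_edge [simp]: "local_mean H e (set_edge e v Y) = local_mean H e Y"
  by (simp add: local_mean_def)

lemma local_mean_bounds: "- 1 < local_mean H e Y" "local_mean H e Y < 1"
  using tanh_real_bounds by (auto simp: local_mean_def)

text \<open>Stationarity of the heat bath: on each pair of configurations differing at
  \<open>e\<close> the total weight exp p + exp q is redistributed in its own proportions.\<close>

lemma gibbs_mean_resample:
  assumes e: "e \<in> edges n"
  shows "gibbs_mean n H (resample H e F) = gibbs_mean n H F"
proof -
  have "(\<Sum>Y\<in>configs n. exp (H Y) * resample H e F Y) = (\<Sum>Y\<in>configs n. exp (H Y) * F Y)"
  proof (subst (1 2) sum_set_edge[OF e], rule sum.cong[OF refl])
    fix Y
    define p where "p = H (set_edge e 1 Y)"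
    define q where "q = H (set_edge e (-1) Y)"
    have R: "resample H e F (set_edge e v Y) =
        exp p / (exp p + exp q) * F (set_edge e 1 Y) + exp q / (exp p + exp q) * F (set_edge e (-1) Y)" for v
      unfolding one_plus_tanh_half_diff[symmetric]
      by (simp add: resample_def p_def q_def local_mean_def[of H e Y] field_simps)
    have "exp p + exp q > 0" by (simp add: add_pos_pos)
    then have w: "(exp p + exp q) * (exp p / (exp p + exp q) * a + exp q / (exp p + exp q) * b) = exp p * a + exp q * b" for a b
      unfolding distrib_left[of "exp p + exp q"] by simp
    show "(exp (H (set_edge e 1 Y)) * resample H e F (set_edge e 1 Y) +
          exp (H (set_edge e (-1) Y)) * resample H e F (set_edge e (-1) Y)) / 2 =
        (exp (H (set_edge e 1 Y)) * F (set_edge e 1 Y) + exp (H (set_edge e (-1) Y)) * F (set_edge e (-1) Y)) / 2"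
      unfolding R p_def[symmetric] q_def[symmetric] by (simp only: w flip: distrib_right)
  qed
  then show ?thesis by (simp add: gibbs_mean_def gibbs_sum_def)
qed

text \<open>The conditioning event meets the support in exactly two configurations, which differ at
  \<open>e\<close>. The conditional law is a two-point law from which the normalizer
  cancels.\<close>

lemma cond_mean_edge_eq:
  assumes Y: "Y \<in> configs n" and e: "e \<in> edges n"
  shows "cond_mean_edge n \<theta> \<beta> e Y = local_mean (log_weight n \<theta> \<beta>) e Y"
proof -
  let ?H = "log_weight n \<theta> \<beta>" and ?Z = "normalizer n \<theta> \<beta>"
  define P where "P = set_edge e 1 Y"
  define M where "M = set_edge e (-1) Y"
  have in_c: "P \<in> configs n" "M \<in> configs n" unfolding P_def M_def using Y e by auto
  have val: "at_edge P e = 1" "at_edge M e = -1" unfolding P_def M_def by (simp_all add: at_edge_set_edge[OF e e])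
  then have ne: "P \<noteq> M" by auto
  have supp: "configs n \<inter> agree_off n e Y = {P, M}"
  proof (intro set_eqI iffI)
    fix X assume "X \<in> configs n \<inter> agree_off n e Y"
    then have X: "X \<in> configs n" "\<And>f. f \<in> edges n \<Longrightarrow> f \<noteq> e \<Longrightarrow> at_edge X f = at_edge Y f"
      by (auto simp: agree_off_def)
    consider "at_edge X e = 1" | "at_edge X e = -1" using at_edge_cases[OF X(1) e] by blast
    then show "X \<in> {P, M}"
    proof cases
      case 1
      then have "X = P" by (intro config_eqI[OF X(1) in_c(1)]) (auto simp: P_def at_edge_set_edge[OF e] X(2))
      then show ?thesis by simp
    next
      case 2
      then have "X = M" by (intro config_eqI[OF X(1) in_c(2)]) (auto simp: M_def at_edge_set_edge[OF e] X(2))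
      then show ?thesis by simp
    qed
  next
    fix X assume "X \<in> {P, M}"
    then show "X \<in> configs n \<inter> agree_off n e Y"
      using in_c by (auto simp: agree_off_def P_def M_def at_edge_set_edge[OF e] split: if_splits)
  qed
  note nonempty = ergm_agree_off_nonempty[OF Y, of \<theta> \<beta> e]
  have mem: "P \<in> agree_off n e Y" "M \<in> agree_off n e Y" using supp by auto
  have "measure_pmf.prob (ergm n \<theta> \<beta>) (agree_off n e Y) =
      measure_pmf.prob (ergm n \<theta> \<beta>) {P, M}"
    using measure_Int_set_pmf[of "ergm n \<theta> \<beta>" "agree_off n e Y"] supp
    by (simp add: set_pmf_ergm Int_commute)
  also have "\<dots> = (exp (?H P) + exp (?H M)) / ?Z"
    by (subst measure_measure_pmf_finite) (auto simp: pmf_ergm in_c ne add_divide_distrib)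
  finally have mass: "measure_pmf.prob (ergm n \<theta> \<beta>) (agree_off n e Y) = (exp (?H P) + exp (?H M)) / ?Z" .
  have "cond_mean_edge n \<theta> \<beta> e Y =
      (\<Sum>X\<in>{P, M}. at_edge X e * pmf (cond_pmf (ergm n \<theta> \<beta>) (agree_off n e Y)) X)"
    unfolding cond_mean_edge_def
    by (rule integral_measure_pmf_real) (auto simp: set_cond_pmf[OF nonempty] set_pmf_ergm supp)
  also have "\<dots> = exp (?H P) / (exp (?H P) + exp (?H M)) - exp (?H M) / (exp (?H P) + exp (?H M))"
    using ne normalizer_pos[of n \<theta> \<beta>] by (simp add: pmf_cond[OF nonempty] mem mass val pmf_ergm in_c)
  also have "\<dots> = tanh ((?H P - ?H M) / 2)"
    unfolding one_plus_tanh_half_diff[symmetric] by (simp add: field_simps)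
  finally show ?thesis by (simp add: local_mean_def P_def M_def)
qed

section \<open>Concentration of conditionally centred sums\<close>

lemma abs_exp_diff_le:
  fixes x y :: real shows "\<bar>exp x - exp y\<bar> \<le> \<bar>x - y\<bar> * (exp x + exp y)"
proof -
  have *: "exp x - exp y \<le> (x - y) * (exp x + exp y)" "exp y \<le> exp x" if "y \<le> x" for x y :: real
  proof -
    have "1 + (y - x) \<le> exp (y - x)" by (rule exp_ge_add_one_self)
    then have "(1 + (y - x)) * exp x \<le> exp (y - x) * exp x" by (intro mult_right_mono) auto
    also have "\<dots> = exp y" by (simp flip: exp_add)
    finally have "exp x - exp y \<le> (x - y) * exp x" by (simp add: algebra_simps)
    also have "\<dots> \<le> (x - y) * (exp x + exp y)" using that by (intro mult_left_mono) auto
    finally show "exp x - exp y \<le> (x - y) * (exp x + exp y)" .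
    show "exp y \<le> exp x" using that by simp
  qed
  show ?thesis
    using *[of x y] *[of y x] by (cases "y \<le> x") (auto simp: add.commute)
qed

text \<open>A Gronwall argument: the bound makes F x * exp (- c x^2) nonincreasing on the positive
  axis, and negative arguments follow by reflection.\<close>

lemma subgaussian_from_derivative:
  fixes F F' :: "real \<Rightarrow> real"
  assumes deriv: "\<And>x. (F has_real_derivative F' x) (at x)"
    and bound: "\<And>x. \<bar>F' x\<bar> \<le> 2 * c * \<bar>x\<bar> * F x" and F0: "F 0 = 1"
  shows "F x \<le> exp (c * x\<^sup>2)"
proof -
  have pos: "G x \<le> exp (c * x\<^sup>2)"
    if G: "\<And>x. (G has_real_derivative G' x) (at x)"
      and b: "\<And>x. \<bar>G' x\<bar> \<le> 2 * c * \<bar>x\<bar> * G x" and G0: "G 0 = 1" and x: "0 \<le> x"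
    for G G' :: "real \<Rightarrow> real" and x
  proof -
    have "G x * exp (- c * x\<^sup>2) \<le> G 0 * exp (- c * 0\<^sup>2)"
    proof (rule DERIV_nonpos_imp_nonincreasing[OF x])
      fix y :: real assume y: "0 \<le> y" "y \<le> x"
      have "((\<lambda>y. G y * exp (- c * y\<^sup>2)) has_real_derivative
          (G' y - 2 * c * y * G y) * exp (- c * y\<^sup>2)) (at y)"
        by (auto intro!: derivative_eq_intros G simp: algebra_simps)
      moreover have "(G' y - 2 * c * y * G y) * exp (- c * y\<^sup>2) \<le> 0"
        using b[of y] y(1) by (intro mult_nonpos_nonneg) auto
      ultimately show "\<exists>d. ((\<lambda>y. G y * exp (- c * y\<^sup>2)) has_real_derivative d) (at y) \<and> d \<le> 0"
        by blast
    qed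
    then have "G x \<le> 1 / exp (- c * x\<^sup>2)" by (simp add: G0 pos_le_divide_eq)
    then show ?thesis by (simp add: exp_minus inverse_eq_divide)
  qed
  show ?thesis
  proof (cases "0 \<le> x")
    case True
    show ?thesis by (rule pos[OF deriv bound F0 True])
  next
    case False
    have "((\<lambda>y. F (- y)) has_real_derivative - F' (- y)) (at y)" for y
      using DERIV_mirror[of F "F' (- y)" y] deriv[of "- y"] by simp
    then have "F (- (- x)) \<le> exp (c * (- x)\<^sup>2)"
      by (rule pos) (use bound[of "- _"] F0 False in auto)
    then show ?thesis by simp
  qed
qed

definition centred_sum ::
    "(config \<Rightarrow> real) \<Rightarrow> (nat \<times> nat) set \<Rightarrow> config \<Rightarrow> real" where
  "centred_sum H Q Y = (\<Sum>e\<in>Q. at_edge Y e - local_mean H e Y)"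

text \<open>Chatterjee's exchangeable-pair argument, with the derivative of the moment
  generating function written through the resampling identity.\<close>

lemma mgf_centred_sum:
  assumes Q: "Q \<subseteq> edges n" and B: "B \<ge> 0"
    and osc: "\<And>e Y. e \<in> Q \<Longrightarrow> Y \<in> configs n \<Longrightarrow>
      \<bar>centred_sum H Q (set_edge e 1 Y) - centred_sum H Q (set_edge e (-1) Y)\<bar> \<le> B"
  shows "gibbs_mean n H (\<lambda>Y. exp (l * centred_sum H Q Y)) \<le> exp (B * real (card Q) * l\<^sup>2)"
proof -
  let ?S = "centred_sum H Q"
  define F where "F l = gibbs_mean n H (\<lambda>Y. exp (l * ?S Y))" for l
  define F' where "F' l = gibbs_mean n H (\<lambda>Y. ?S Y * exp (l * ?S Y))" for l
  have "(\<Sum>Y\<in>configs n. exp (H Y)) \<noteq> 0"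
    using gibbs_sum_one_pos[of n H] by (simp add: gibbs_sum_def)
  then have "(F has_real_derivative F' l) (at l)" for l
    unfolding F_def F'_def gibbs_mean_def gibbs_sum_def
    by (auto intro!: derivative_eq_intros sum.cong simp: mult_ac)
  moreover have "\<bar>F' l\<bar> \<le> 2 * (B * real (card Q)) * \<bar>l\<bar> * F l" for l
  proof -
    have "F' l = (\<Sum>e\<in>Q. gibbs_mean n H (\<lambda>Y. (at_edge Y e - local_mean H e Y) * exp (l * ?S Y)))"
      unfolding F'_def by (simp add: centred_sum_def sum_distrib_right flip: gibbs_mean_sum)
    moreover have "\<bar>gibbs_mean n H (\<lambda>Y. (at_edge Y e - local_mean H e Y) * exp (l * ?S Y))\<bar>
        \<le> 2 * B * \<bar>l\<bar> * F l" if e: "e \<in> Q" for e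
    proof -
      have eE: "e \<in> edges n" using e Q by blast
      have "\<bar>gibbs_mean n H (\<lambda>Y. (at_edge Y e - local_mean H e Y) * exp (l * ?S Y))\<bar>
          = \<bar>gibbs_mean n H (resample H e (\<lambda>Y. (at_edge Y e - local_mean H e Y) * exp (l * ?S Y)))\<bar>"
        by (simp only: gibbs_mean_resample[OF eE])
      also have "\<dots> \<le> gibbs_mean n H (\<lambda>Y. 2 * B * \<bar>l\<bar> * resample H e (\<lambda>Y. exp (l * ?S Y)) Y)"
      proof (rule gibbs_mean_abs_le)
        fix Y assume Y: "Y \<in> configs n"
        define m where "m = local_mean H e Y"
        define p where "p = l * ?S (set_edge e 1 Y)"
        define q where "q = l * ?S (set_edge e (-1) Y)"
        have m: "- 1 < m" "m < 1" using local_mean_bounds[of H e Y] by (auto simp: m_def)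
        have "\<bar>p - q\<bar> \<le> \<bar>l\<bar> * B"
          using osc[OF e Y] unfolding p_def q_def
          by (simp add: abs_mult mult_left_mono flip: right_diff_distrib)
        then have d: "\<bar>exp p - exp q\<bar> \<le> \<bar>l\<bar> * B * (exp p + exp q)"
          by (intro order_trans[OF abs_exp_diff_le] mult_right_mono) (auto intro: add_nonneg_nonneg)
        \<comment> \<open>The centred spin is 1 - m with probability (1 + m)/2 and -(1 + m) with
          probability (1 - m)/2. Both products equal (1 + m)(1 - m)/2 up to sign, so only a
          difference of the two exponentials survives.\<close>
        have "resample H e (\<lambda>Y. (at_edge Y e - local_mean H e Y) * exp (l * ?S Y)) Y
            = (1 + m) * (1 - m) / 2 * (exp p - exp q)"
          by (simp add: resample_def at_edge_set_edge[OF eE eE] p_def q_def m_def[symmetric] field_simps)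
        also have "\<bar>\<dots>\<bar> = (1 + m) * (1 - m) / 2 * \<bar>exp p - exp q\<bar>"
          using m by (simp add: abs_mult)
        also have "\<dots> \<le> (1 + m) * (1 - m) / 2 * (\<bar>l\<bar> * B * (exp p + exp q))"
          using m by (intro mult_left_mono d) auto
        also have "\<dots> = \<bar>l\<bar> * B * ((1 + m) * (1 - m) / 2 * exp p + (1 + m) * (1 - m) / 2 * exp q)"
          by (simp add: algebra_simps)
        \<comment> \<open>Bounding (1 + m)(1 - m)/2 by 1 + m and by 1 - m restores the heat-bath
          average of the exponential, whose Gibbs mean is \<open>F l\<close> again; this closes the
          differential inequality.\<close>
        also have "\<dots> \<le> \<bar>l\<bar> * B * ((1 + m) * exp p + (1 - m) * exp q)"
        proof -
          have "(1 + m) * (1 - m) / 2 \<le> 1 + m" "(1 + m) * (1 - m) / 2 \<le> 1 - m"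
            using m mult_left_mono[of "1 - m" 2 "1 + m"] mult_right_mono[of "1 + m" 2 "1 - m"] by auto
          then show ?thesis using B by (intro mult_left_mono add_mono mult_right_mono) auto
        qed
        also have "\<dots> = 2 * B * \<bar>l\<bar> * resample H e (\<lambda>Y. exp (l * ?S Y)) Y"
          by (simp add: resample_def p_def q_def m_def field_simps)
        finally show "\<bar>resample H e (\<lambda>Y. (at_edge Y e - local_mean H e Y) * exp (l * ?S Y)) Y\<bar>
            \<le> 2 * B * \<bar>l\<bar> * resample H e (\<lambda>Y. exp (l * ?S Y)) Y" .
      qed
      also have "\<dots> = 2 * B * \<bar>l\<bar> * F l"
        unfolding F_def
        using gibbs_mean_cmult[of n H "2 * B * \<bar>l\<bar>" "resample H e (\<lambda>Y. exp (l * ?S Y))"]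
        by (simp only: gibbs_mean_resample[OF eE])
      finally show ?thesis .
    qed
    ultimately have "\<bar>F' l\<bar> \<le> (\<Sum>e\<in>Q. 2 * B * \<bar>l\<bar> * F l)"
      by (simp only:) (rule order_trans[OF sum_abs], rule sum_mono)
    then show ?thesis by (simp add: mult_ac)
  qed
  moreover have "F 0 = 1" by (simp add: F_def)
  ultimately show ?thesis
    using subgaussian_from_derivative[of F F' "B * real (card Q)" l] by (simp add: F_def)
qed

lemma tail_centred_sum:
  assumes Q: "Q \<subseteq> edges n" and B: "B \<ge> 0"
    and osc: "\<And>e Y. e \<in> Q \<Longrightarrow> Y \<in> configs n \<Longrightarrow>
      \<bar>centred_sum H Q (set_edge e 1 Y) - centred_sum H Q (set_edge e (-1) Y)\<bar> \<le> B"
    and c: "B * real (card Q) \<le> c" "0 < c" and x: "0 \<le> x"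
  shows "gibbs_mean n H (\<lambda>Y. of_bool (x \<le> centred_sum H Q Y)) \<le> exp (- x\<^sup>2 / (4 * c))"
    and "gibbs_mean n H (\<lambda>Y. of_bool (centred_sum H Q Y \<le> - x)) \<le> exp (- x\<^sup>2 / (4 * c))"
proof -
  let ?S = "centred_sum H Q"
  have chernoff: "gibbs_mean n H (\<lambda>Y. of_bool (x \<le> \<sigma> * ?S Y)) \<le> exp (- x\<^sup>2 / (4 * c))"
    if \<sigma>: "\<sigma>\<^sup>2 = 1" for \<sigma> :: real
  proof -
    \<comment> \<open>The minimiser of c l^2 - l x. The sign \<sigma> covers both tails at
      once.\<close>
    define l where "l = x / (2 * c)"
    have l: "0 \<le> l" using x c by (simp add: l_def)
    have "gibbs_mean n H (\<lambda>Y. of_bool (x \<le> \<sigma> * ?S Y))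
        \<le> gibbs_mean n H (\<lambda>Y. exp (- l * x) * exp ((l * \<sigma>) * ?S Y))"
    proof (rule gibbs_mean_mono)
      fix Y
      have "1 \<le> exp (- l * x + l * (\<sigma> * ?S Y))" if "x \<le> \<sigma> * ?S Y"
        using mult_left_mono[OF that l] by simp
      then show "of_bool (x \<le> \<sigma> * ?S Y) \<le> exp (- l * x) * exp ((l * \<sigma>) * ?S Y)"
        by (simp add: mult_ac flip: exp_add)
    qed
    also have "\<dots> \<le> exp (- l * x) * exp (B * real (card Q) * (l * \<sigma>)\<^sup>2)"
      unfolding gibbs_mean_cmult by (intro mult_left_mono mgf_centred_sum[OF Q B osc]) auto
    also have "\<dots> \<le> exp (- l * x) * exp (c * l\<^sup>2)"
      using c \<sigma> by (intro mult_left_mono) (auto simp: power_mult_distrib intro: mult_right_mono)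
    also have "\<dots> = exp (- x\<^sup>2 / (4 * c))"
      using c by (simp add: l_def power2_eq_square field_simps flip: exp_add)
    finally show ?thesis .
  qed
  show "gibbs_mean n H (\<lambda>Y. of_bool (x \<le> ?S Y)) \<le> exp (- x\<^sup>2 / (4 * c))"
    using chernoff[of 1] by simp
  have "(x \<le> - ?S Y) = (?S Y \<le> - x)" for Y by linarith
  then show "gibbs_mean n H (\<lambda>Y. of_bool (?S Y \<le> - x)) \<le> exp (- x\<^sup>2 / (4 * c))"
    using chernoff[of "-1"] by simp
qed

section \<open>Energies that are functions of the degrees\<close>

text \<open>The form shared by the model, the surrogate and their tilts by degree sums; the vertex
  index of \<open>U\<close> carries the external field.\<close>

definition degree_energy :: "nat \<Rightarrow> (nat \<Rightarrow> real \<Rightarrow> real) \<Rightarrow> config \<Rightarrow> real" where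
  "degree_energy n U Y = (\<Sum>i=1..n. U i (degree n Y i))"

text \<open>The contribution of an endpoint to the field on an edge. Here \<open>x\<close> is the
  degree without that edge, so the two values of the edge give degrees x + 1 and x - 1.\<close>

definition drive :: "(nat \<Rightarrow> real \<Rightarrow> real) \<Rightarrow> nat \<Rightarrow> real \<Rightarrow> real" where
  "drive U i x = (U i (x + 1) - U i (x - 1)) / 2"

lemma local_mean_degree_energy:
  assumes Y: "Y \<in> configs n" and e: "e \<in> edges n"
  shows "local_mean (degree_energy n U) e Y =
    tanh (drive U (fst e) (degree n Y (fst e) - at_edge Y e) + drive U (snd e) (degree n Y (snd e) - at_edge Y e))"
proof -
  note D = edgesD[OF e]
  define k where "k i = degree n Y i - at_edge Y e" for i
  have "degree_energy n U (set_edge e 1 Y) - degree_energy n U (set_edge e (-1) Y)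
      = (\<Sum>i=1..n. (if fst e = i then U i (k i + 1) - U i (k i - 1) else 0)
          + (if snd e = i then U i (k i + 1) - U i (k i - 1) else 0))"
    unfolding degree_energy_def sum_subtractf[symmetric]
    using D by (intro sum.cong refl) (auto simp: degree_set_edge[OF Y e] k_def algebra_simps)
  also have "\<dots> = 2 * (drive U (fst e) (k (fst e)) + drive U (snd e) (k (snd e)))"
    using D by (simp add: sum.distrib drive_def field_simps)
  finally show ?thesis by (simp add: local_mean_def k_def)
qed

text \<open>The constant \<gamma> bounds the influence of one edge on the conditional mean of an
  adjacent one. It is of order 1/n in all uses. For the model, 2 \<gamma> (n - 1) is 2 \<theta>,
  which suffices for concentration; for the surrogate it is below 1, as Dobrushin's condition
  asks.\<close>

definition tanh_lipschitz :: "nat \<Rightarrow> (nat \<Rightarrow> real \<Rightarrow> real) \<Rightarrow> real \<Rightarrow> bool" where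
  "tanh_lipschitz n U \<gamma> \<longleftrightarrow> (\<forall>i\<in>{1..n}. \<forall>j\<in>{1..n}. \<forall>x y x' y'.
     \<bar>tanh (drive U i x + drive U j y) - tanh (drive U i x' + drive U j y')\<bar> \<le> \<gamma> * (\<bar>x - x'\<bar> + \<bar>y - y'\<bar>))"

text \<open>The number of common endpoints of two edges. The diagonal value 2 is kept because it
  makes \<open>sum_share\<close> an exact sum of two stars.\<close>

definition share :: "nat \<times> nat \<Rightarrow> nat \<times> nat \<Rightarrow> real" where
  "share e f = of_bool (fst e = fst f) + of_bool (fst e = snd f)
     + of_bool (snd e = fst f) + of_bool (snd e = snd f)"

lemma share_nonneg [simp]: "share e f \<ge> 0"
  by (simp add: share_def)

lemma share_commute: "share e f = share f e"
  by (auto simp: share_def)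

lemma sum_share:
  assumes e: "e \<in> edges n"
  shows "(\<Sum>f\<in>edges n. share e f * r f) = (\<Sum>f\<in>edges_at n (fst e). r f) + (\<Sum>f\<in>edges_at n (snd e). r f)"
proof -
  have *: "(\<Sum>f\<in>edges_at n i. r f) = (\<Sum>f\<in>edges n. (of_bool (i = fst f) + of_bool (i = snd f)) * r f)" for i
  proof -
    have "(\<Sum>f\<in>edges_at n i. r f) = (\<Sum>f\<in>edges n. if fst f = i \<or> snd f = i then r f else 0)"
      by (simp add: edges_at_def sum.inter_filter)
    also have "\<dots> = (\<Sum>f\<in>edges n. (of_bool (i = fst f) + of_bool (i = snd f)) * r f)"
    proof (intro sum.cong refl)
      fix f assume "f \<in> edges n"
      from edgesD(3)[OF this]
      show "(if fst f = i \<or> snd f = i then r f else 0) = (of_bool (i = fst f) + of_bool (i = snd f)) * r f"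
        by auto
    qed
    finally show ?thesis .
  qed
  show ?thesis unfolding * sum.distrib[symmetric]
    by (intro sum.cong refl) (simp add: share_def algebra_simps)
qed

text \<open>The flip of \<open>e\<close> moves the degrees of its two endpoints by 2 and leaves the
  value of the edge \<open>f\<close> alone, so each common endpoint costs 2 \<gamma>.\<close>

lemma local_mean_flip_le:
  assumes lip: "tanh_lipschitz n U \<gamma>" and Y: "Y \<in> configs n"
    and e: "e \<in> edges n" and f: "f \<in> edges n" and ne: "f \<noteq> e"
  shows "\<bar>local_mean (degree_energy n U) f (set_edge e 1 Y) -
      local_mean (degree_energy n U) f (set_edge e (-1) Y)\<bar> \<le> 2 * \<gamma> * share f e"
proof -
  note D = edgesD[OF f] and De = edgesD[OF e]
  have k: "\<bar>(degree n (set_edge e 1 Y) i - at_edge (set_edge e 1 Y) f) -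
      (degree n (set_edge e (-1) Y) i - at_edge (set_edge e (-1) Y) f)\<bar>
      = 2 * (of_bool (i = fst e) + of_bool (i = snd e))" if "i \<in> {1..n}" for i
    using ne De that by (auto simp: degree_set_edge[OF Y e] at_edge_set_edge[OF e f])
  have "\<bar>local_mean (degree_energy n U) f (set_edge e 1 Y) -
      local_mean (degree_energy n U) f (set_edge e (-1) Y)\<bar>
      \<le> \<gamma> * (2 * (of_bool (fst f = fst e) + of_bool (fst f = snd e)) + 2 * (of_bool (snd f = fst e) + of_bool (snd f = snd e)))"
    unfolding local_mean_degree_energy[OF set_edge_in_configs[OF Y e] f, of 1, simplified]
      local_mean_degree_energy[OF set_edge_in_configs[OF Y e] f, of "-1", simplified]
      k[OF D(1), symmetric] k[OF D(2), symmetric]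
    using lip D(1,2) unfolding tanh_lipschitz_def by blast
  also have "\<dots> = 2 * \<gamma> * share f e" by (simp add: share_def algebra_simps)
  finally show ?thesis .
qed

text \<open>The flipped edge changes its own value by 2 and its own conditional mean not at all; the
  other conditional means move by 2 \<gamma> per shared endpoint, and the sharing totals 2 (n - 1).
  The bound does not grow with \<open>Q\<close>.\<close>

lemma centred_sum_osc:
  assumes lip: "tanh_lipschitz n U \<gamma>" and \<gamma>: "\<gamma> \<ge> 0" and Q: "Q \<subseteq> edges n"
    and e: "e \<in> edges n" and Y: "Y \<in> configs n"
  shows "\<bar>centred_sum (degree_energy n U) Q (set_edge e 1 Y) - centred_sum (degree_energy n U) Q (set_edge e (-1) Y)\<bar>
    \<le> 2 + 4 * \<gamma> * (real n - 1)"
proof -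
  let ?m = "local_mean (degree_energy n U)"
  have fin: "finite Q" by (rule finite_subset[OF Q]) simp
  have "\<bar>centred_sum (degree_energy n U) Q (set_edge e 1 Y) - centred_sum (degree_energy n U) Q (set_edge e (-1) Y)\<bar>
      \<le> (\<Sum>f\<in>Q. \<bar>(at_edge (set_edge e 1 Y) f - ?m f (set_edge e 1 Y)) - (at_edge (set_edge e (-1) Y) f - ?m f (set_edge e (-1) Y))\<bar>)"
    unfolding centred_sum_def sum_subtractf[symmetric] by (rule sum_abs)
  also have "\<dots> \<le> (\<Sum>f\<in>Q. (if f = e then 2 else 0) + 2 * \<gamma> * (share e f * 1))"
  proof (rule sum_mono)
    fix f assume "f \<in> Q"
    then have f: "f \<in> edges n" using Q by blast
    show "\<bar>(at_edge (set_edge e 1 Y) f - ?m f (set_edge e 1 Y)) - (at_edge (set_edge e (-1) Y) f - ?m f (set_edge e (-1) Y))\<bar>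
        \<le> (if f = e then 2 else 0) + 2 * \<gamma> * (share e f * 1)"
    proof (cases "f = e")
      case True
      then show ?thesis using \<gamma> by (simp add: at_edge_set_edge[OF e e])
    next
      case False
      then show ?thesis using local_mean_flip_le[OF lip Y e f False]
        by (simp add: at_edge_set_edge[OF e f] share_commute[of f e] abs_minus_commute)
    qed
  qed
  also have "\<dots> \<le> 2 + (\<Sum>f\<in>edges n. 2 * \<gamma> * (share e f * 1))"
    unfolding sum.distrib using fin Q \<gamma> by (intro add_mono sum_mono2) auto
  also have "\<dots> = 2 + 4 * \<gamma> * (real n - 1)"
    unfolding sum_distrib_left[symmetric] sum_share[OF e] using edgesD[OF e]
    by (simp add: card_edges_at algebra_simps)
  finally show ?thesis .
qed

lemma tail_degree_energy:
  assumes lip: "tanh_lipschitz n U \<gamma>" and \<gamma>: "\<gamma> \<ge> 0" "\<gamma> * (real n - 1) \<le> \<theta>"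
    and Q: "Q \<subseteq> edges n" "real (card Q) \<le> k" and \<theta>: "0 \<le> \<theta>" and k: "0 < k" and x: "0 \<le> x"
  shows "gibbs_mean n (degree_energy n U) (\<lambda>Y. of_bool (x \<le> centred_sum (degree_energy n U) Q Y))
      \<le> exp (- x\<^sup>2 / (8 * (1 + 2 * \<theta>) * k))"
    and "gibbs_mean n (degree_energy n U) (\<lambda>Y. of_bool (centred_sum (degree_energy n U) Q Y \<le> - x))
      \<le> exp (- x\<^sup>2 / (8 * (1 + 2 * \<theta>) * k))"
proof -
  \<comment> \<open>The oscillation bound 2 + 4 \<gamma> (n - 1) with \<gamma> (n - 1) replaced by
    \<theta>; the Chernoff denominator 4 B k is the stated 8 (1 + 2 \<theta>) k.\<close>
  define B where "B = 2 + 4 * \<theta>"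
  have B: "0 \<le> B" and c0: "0 < B * k" using \<theta> k by (auto simp: B_def)
  have c: "B * real (card Q) \<le> B * k" using Q(2) B by (rule mult_left_mono)
  have osc: "\<bar>centred_sum (degree_energy n U) Q (set_edge e 1 Y) - centred_sum (degree_energy n U) Q (set_edge e (-1) Y)\<bar> \<le> B"
    if "e \<in> Q" "Y \<in> configs n" for e Y
    using centred_sum_osc[OF lip \<gamma>(1) Q(1) subsetD[OF Q(1) that(1)] that(2)] \<gamma>(2) unfolding B_def by linarith
  have 8: "8 * (1 + 2 * \<theta>) * k = 4 * (B * k)" by (simp add: B_def algebra_simps)
  show "gibbs_mean n (degree_energy n U) (\<lambda>Y. of_bool (x \<le> centred_sum (degree_energy n U) Q Y))
      \<le> exp (- x\<^sup>2 / (8 * (1 + 2 * \<theta>) * k))"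
    and "gibbs_mean n (degree_energy n U) (\<lambda>Y. of_bool (centred_sum (degree_energy n U) Q Y \<le> - x))
      \<le> exp (- x\<^sup>2 / (8 * (1 + 2 * \<theta>) * k))"
    unfolding 8 by (rule tail_centred_sum[OF Q(1) B osc c c0 x]; assumption)+
qed

lemma card_edges_le: "real (card (edges n)) \<le> (real n)\<^sup>2"
  unfolding card_edges by (simp add: power2_eq_square field_simps)

lemma some_vertex_sum_large:
  assumes lip: "tanh_lipschitz n U \<gamma>" and \<gamma>: "\<gamma> \<ge> 0" "\<gamma> * (real n - 1) \<le> \<theta>"
    and \<theta>: "0 \<le> \<theta>" and n: "n \<ge> 1" and x: "0 \<le> x"
  shows "gibbs_mean n (degree_energy n U)
      (\<lambda>Y. of_bool (\<exists>i\<in>{1..n}. x < \<bar>centred_sum (degree_energy n U) (edges_at n i) Y\<bar>))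
    \<le> 2 * real n * exp (- x\<^sup>2 / (8 * (1 + 2 * \<theta>) * real n))"
proof -
  let ?E = "gibbs_mean n (degree_energy n U)" and ?S = "\<lambda>i. centred_sum (degree_energy n U) (edges_at n i)"
  let ?q = "exp (- x\<^sup>2 / (8 * (1 + 2 * \<theta>) * real n))"
  have "?E (\<lambda>Y. of_bool (\<exists>i\<in>{1..n}. x < \<bar>?S i Y\<bar>)) \<le> (\<Sum>i=1..n. ?E (\<lambda>Y. of_bool (x < \<bar>?S i Y\<bar>)))"
    by (rule gibbs_prob_union) simp
  also have "\<dots> \<le> (\<Sum>i=1..n. ?q + ?q)"
  proof (rule sum_mono)
    fix i assume i: "i \<in> {1..n}"
    have k: "real (card (edges_at n i)) \<le> real n" "0 < real n" using card_edges_at[OF i] n by auto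
    have "?E (\<lambda>Y. of_bool (x < \<bar>?S i Y\<bar>)) \<le> ?E (\<lambda>Y. of_bool (x \<le> ?S i Y) + of_bool (?S i Y \<le> - x))"
      by (intro gibbs_mean_mono) (auto simp: abs_if)
    also have "\<dots> \<le> ?q + ?q"
      unfolding gibbs_mean_add by (intro add_mono tail_degree_energy[OF lip \<gamma> edges_at_subset k(1) \<theta> k(2) x])
    finally show "?E (\<lambda>Y. of_bool (x < \<bar>?S i Y\<bar>)) \<le> ?q + ?q" .
  qed
  finally show ?thesis by simp
qed

lemma tanh_lipschitz_1: "\<bar>tanh x - tanh y\<bar> \<le> \<bar>x - y\<bar>" for x y :: real
proof -
  have "tanh b - tanh a \<le> b - a" if "a \<le> b" for a b :: real
  proof -
    have "tanh b - b \<le> tanh a - a"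
    proof (rule DERIV_nonpos_imp_nonincreasing[OF that])
      fix x :: real
      have "((\<lambda>x. tanh x - x) has_real_derivative (1 - (tanh x)\<^sup>2) * 1 - 1) (at x)"
        by (intro derivative_intros) (use cosh_real_pos[of x] in auto)
      then show "\<exists>d. ((\<lambda>x. tanh x - x) has_real_derivative d) (at x) \<and> d \<le> 0"
        by (intro exI[of _ "(1 - (tanh x)\<^sup>2) * 1 - 1"]) auto
    qed
    then show ?thesis by simp
  qed
  moreover have "tanh a \<le> tanh b" if "a \<le> b" for a b :: real using that by simp
  ultimately show ?thesis by (smt (verit))
qed

definition two_star :: "nat \<Rightarrow> real \<Rightarrow> (nat \<Rightarrow> real) \<Rightarrow> nat \<Rightarrow> real \<Rightarrow> real" where
  "two_star n \<theta> \<beta> i x = \<theta> / (real n - 1) * (x\<^sup>2 / 2 - (real n - 1) / 2) + \<beta> i / 2 * x"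

lemma log_weight_degree_energy: "log_weight n \<theta> \<beta> = degree_energy n (two_star n \<theta> \<beta>)"
proof
  fix Y
  have "degree_energy n (two_star n \<theta> \<beta>) Y =
      \<theta> / (real n - 1) * (\<Sum>i=1..n. (degree n Y i)\<^sup>2 / 2 - (real n - 1) / 2) + (\<Sum>i=1..n. \<beta> i / 2 * degree n Y i)"
    by (simp add: degree_energy_def two_star_def sum.distrib sum_distrib_left)
  also have "(\<Sum>i=1..n. (degree n Y i)\<^sup>2 / 2 - (real n - 1) / 2)
      = 1/2 * (\<Sum>i=1..n. (degree n Y i)\<^sup>2) - real n * (real n - 1) / 2"
    by (simp add: sum_subtractf sum_distrib_left)
  also have "(\<Sum>i=1..n. \<beta> i / 2 * degree n Y i) = 1/2 * (\<Sum>i=1..n. \<beta> i * degree n Y i)"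
    by (simp add: sum_distrib_left)
  finally show "log_weight n \<theta> \<beta> Y = degree_energy n (two_star n \<theta> \<beta>) Y"
    by (simp add: log_weight_def)
qed

lemma drive_two_star: "drive (two_star n \<theta> \<beta>) i x = \<theta> / (real n - 1) * x + \<beta> i / 2"
proof -
  define a where "a = \<theta> / (real n - 1)"
  show ?thesis unfolding drive_def two_star_def a_def[symmetric]
    by (simp add: power2_eq_square algebra_simps add_divide_distrib diff_divide_distrib)
qed

lemma tanh_lipschitz_two_star:
  assumes "\<theta> \<ge> 0" "n \<ge> 1"
  shows "tanh_lipschitz n (two_star n \<theta> \<beta>) (\<theta> / (real n - 1))"
  unfolding tanh_lipschitz_def drive_two_star
proof (intro ballI allI order_trans[OF tanh_lipschitz_1])
  fix i j and x y x' y' :: real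
  define a where "a = \<theta> / (real n - 1)"
  have a: "a \<ge> 0" using assms by (simp add: a_def)
  have "\<bar>a * x + \<beta> i / 2 + (a * y + \<beta> j / 2) - (a * x' + \<beta> i / 2 + (a * y' + \<beta> j / 2))\<bar> = \<bar>a * (x - x') + a * (y - y')\<bar>"
    by (simp add: algebra_simps)
  also have "\<dots> \<le> a * (\<bar>x - x'\<bar> + \<bar>y - y'\<bar>)"
    using a by (intro order_trans[OF abs_triangle_ineq]) (simp add: abs_mult distrib_left)
  finally show "\<bar>\<theta> / (real n - 1) * x + \<beta> i / 2 + (\<theta> / (real n - 1) * y + \<beta> j / 2) -
      (\<theta> / (real n - 1) * x' + \<beta> i / 2 + (\<theta> / (real n - 1) * y' + \<beta> j / 2))\<bar>
      \<le> \<theta> / (real n - 1) * (\<bar>x - x'\<bar> + \<bar>y - y'\<bar>)" by (simp add: a_def)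
qed

lemma local_mean_two_star:
  assumes Y: "Y \<in> configs n" and e: "e \<in> edges n"
  shows "local_mean (log_weight n \<theta> \<beta>) e Y =
    tanh (\<theta> / (real n - 1) * (degree n Y (fst e) + degree n Y (snd e) - 2 * at_edge Y e)
      + (\<beta> (fst e) + \<beta> (snd e)) / 2)"
  unfolding log_weight_degree_energy local_mean_degree_energy[OF assms] drive_two_star
  by (intro arg_cong[of _ _ tanh]) (simp add: algebra_simps add_divide_distrib diff_divide_distrib)

section \<open>The two tests\<close>

abbreviation null_weight :: "nat \<Rightarrow> real \<Rightarrow> config \<Rightarrow> real" where
  "null_weight n \<theta> \<equiv> log_weight n \<theta> (\<lambda>_. 0)"

lemma tanh_sq_mono: "\<bar>x\<bar> \<le> y \<Longrightarrow> (tanh x)\<^sup>2 \<le> (tanh y)\<^sup>2" for x y :: real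
  by (metis abs_ge_zero order_trans abs_of_nonneg abs_le_square_iff tanh_real_abs tanh_real_le_iff)

lemma has_real_derivative_tanh [derivative_intros]:
  "(tanh has_real_derivative 1 - (tanh x)\<^sup>2) (at (x::real))"
  using has_field_derivative_tanh[of "\<lambda>x. x" x 1 UNIV] cosh_real_pos[of x] by simp

text \<open>The alternative puts no upper bound on the effects, so \<delta> may be huge and tanh
  saturated. Only the first a/2 of the increment is used: there the argument stays within M + 1/2 in
  absolute value, and the rest is monotonicity.\<close>

lemma tanh_increment_ge:
  fixes h :: real
  assumes h: "\<bar>h\<bar> \<le> M" and a: "0 \<le> a" "a \<le> 1" and \<delta>: "a / 2 \<le> \<delta>"
  shows "(1 - (tanh (M + 1/2))\<^sup>2) / 2 * a \<le> tanh (h + \<delta>) - tanh h"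
proof -
  define c where "c = 1 - (tanh (M + 1/2))\<^sup>2"
  have "tanh h - c * h \<le> tanh (h + a / 2) - c * (h + a / 2)"
  proof (rule DERIV_nonneg_imp_nondecreasing[where f = "\<lambda>x. tanh x - c * x" and a = h and b = "h + a / 2"])
    show "h \<le> h + a / 2" using a by simp
  next
    fix x assume x: "h \<le> x" "x \<le> h + a / 2"
    then have "\<bar>x\<bar> \<le> M + 1/2" using h a by linarith
    then have "(tanh x)\<^sup>2 \<le> (tanh (M + 1/2))\<^sup>2" by (rule tanh_sq_mono)
    moreover have "((\<lambda>x. tanh x - c * x) has_real_derivative (1 - (tanh x)\<^sup>2) - c * 1) (at x)"
      by (auto intro!: derivative_eq_intros)
    ultimately show "\<exists>d. ((\<lambda>x. tanh x - c * x) has_real_derivative d) (at x) \<and> 0 \<le> d"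
      by (intro exI[of _ "(1 - (tanh x)\<^sup>2) - c * 1"]) (simp add: c_def)
  qed
  moreover have "tanh (h + a / 2) \<le> tanh (h + \<delta>)" using \<delta> by simp
  moreover have "(1 - (tanh (M + 1/2))\<^sup>2) / 2 * a = c * (h + a / 2) - c * h"
    by (simp add: c_def algebra_simps diff_divide_distrib)
  ultimately show ?thesis by linarith
qed

lemma tanh_sq_less_1: "(tanh (x::real))\<^sup>2 < 1"
  using tanh_real_bounds[of x] by (simp add: abs_square_less_1 abs_less_iff)

definition field_gap :: "nat \<Rightarrow> real \<Rightarrow> (nat \<Rightarrow> real) \<Rightarrow> nat \<times> nat \<Rightarrow> config \<Rightarrow> real" where
  "field_gap n \<theta> \<beta> e Y =
     local_mean (log_weight n \<theta> \<beta>) e Y - local_mean (null_weight n \<theta>) e Y"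

text \<open>The null field on an edge is at most 4 \<theta> in absolute value: two degrees and the
  correction 2 add up to at most 4 (n - 1). The 1/2 is room for the increment, and the factor 1/2
  reflects that an effect enters the field halved.\<close>

definition gap_rate :: "real \<Rightarrow> real" where
  "gap_rate \<theta> = (1 - (tanh (4 * \<theta> + 1/2))\<^sup>2) / 2"

lemma gap_rate_pos: "gap_rate \<theta> > 0"
  using tanh_sq_less_1 by (simp add: gap_rate_def)

lemma field_gap_nonneg:
  assumes "Y \<in> configs n" "e \<in> edges n" "\<And>i. \<beta> i \<ge> 0"
  shows "field_gap n \<theta> \<beta> e Y \<ge> 0"
  using assms(3)[of "fst e"] assms(3)[of "snd e"]
  by (simp add: field_gap_def local_mean_two_star[OF assms(1,2)])

lemma field_gap_ge:
  assumes Y: "Y \<in> configs n" and e: "e \<in> edges n" and \<beta>: "\<And>i. \<beta> i \<ge> 0" and \<theta>: "\<theta> \<ge> 0"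
    and i: "i = fst e \<or> i = snd e" and a: "0 \<le> a" "a \<le> 1" "a \<le> \<beta> i"
  shows "gap_rate \<theta> * a \<le> field_gap n \<theta> \<beta> e Y"
proof -
  note D = edgesD[OF e]
  define h where "h = \<theta> / (real n - 1) * (degree n Y (fst e) + degree n Y (snd e) - 2 * at_edge Y e)"
  have n: "real n \<ge> 2" using D by auto
  have "\<bar>degree n Y (fst e) + degree n Y (snd e) - 2 * at_edge Y e\<bar> \<le> 4 * (real n - 1)"
    using abs_degree_le[OF Y D(1)] abs_degree_le[OF Y D(2)] at_edge_cases[OF Y e] n
    by (auto simp: abs_le_iff)
  then have "\<bar>h\<bar> \<le> \<theta> / (real n - 1) * (4 * (real n - 1))"
    unfolding h_def abs_mult using \<theta> n by (intro mult_mono) auto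
  then have h: "\<bar>h\<bar> \<le> 4 * \<theta>" using n by (simp del: right_diff_distrib_numeral)
  have "a / 2 \<le> (\<beta> (fst e) + \<beta> (snd e)) / 2"
    using i a \<beta>[of "fst e"] \<beta>[of "snd e"] by auto
  from tanh_increment_ge[OF h a(1,2) this] show ?thesis
    by (simp add: field_gap_def local_mean_two_star[OF Y e] gap_rate_def h_def)
qed

text \<open>Signal plus noise: under \<beta> the first summand is centred at its own conditional
  means, hence sub-Gaussian, and the second is a deterministic function bounded below for every
  configuration.\<close>

lemma centred_sum_null:
  "centred_sum (null_weight n \<theta>) Q Y =
     centred_sum (log_weight n \<theta> \<beta>) Q Y + (\<Sum>e\<in>Q. field_gap n \<theta> \<beta> e Y)"
  by (simp add: centred_sum_def field_gap_def flip: sum.distrib)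

lemma vertex_gap_ge:
  assumes Y: "Y \<in> configs n" and i: "i \<in> {1..n}" and \<beta>: "\<And>i. \<beta> i \<ge> 0" and \<theta>: "\<theta> \<ge> 0"
    and a: "0 \<le> a" "a \<le> 1" "a \<le> \<beta> i"
  shows "gap_rate \<theta> * a * (real n - 1) \<le> (\<Sum>e\<in>edges_at n i. field_gap n \<theta> \<beta> e Y)"
proof -
  have "(\<Sum>e\<in>edges_at n i. gap_rate \<theta> * a) \<le> (\<Sum>e\<in>edges_at n i. field_gap n \<theta> \<beta> e Y)"
    by (intro sum_mono field_gap_ge[where \<beta> = \<beta> and i = i, OF Y _ \<beta> \<theta> _ a]) (auto simp: edges_at_def)
  then show ?thesis by (simp add: card_edges_at[OF i] mult_ac)
qed

text \<open>Summing the stars over \<open>W\<close> counts an edge at most twice, and the gaps are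
  nonnegative; this is the origin of the factor 1/2.\<close>

lemma total_gap_ge:
  assumes Y: "Y \<in> configs n" and W: "W \<subseteq> {1..n}" and \<beta>: "\<And>i. \<beta> i \<ge> 0" and \<theta>: "\<theta> \<ge> 0"
    and a: "0 \<le> a" "a \<le> 1" "\<And>i. i \<in> W \<Longrightarrow> a \<le> \<beta> i"
  shows "gap_rate \<theta> * a * (real n - 1) * real (card W) / 2 \<le> (\<Sum>e\<in>edges n. field_gap n \<theta> \<beta> e Y)"
proof -
  have "(\<Sum>i\<in>W. gap_rate \<theta> * a * (real n - 1)) \<le> (\<Sum>i\<in>W. \<Sum>e\<in>edges_at n i. field_gap n \<theta> \<beta> e Y)"
    using W by (intro sum_mono vertex_gap_ge[where \<beta> = \<beta>, OF Y _ \<beta> \<theta> a(1,2)] a(3)) auto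
  also have "\<dots> \<le> (\<Sum>i=1..n. \<Sum>e\<in>edges_at n i. field_gap n \<theta> \<beta> e Y)"
    using W by (intro sum_mono2 sum_nonneg field_gap_nonneg[OF Y _ \<beta>]) (auto simp: edges_at_def)
  also have "\<dots> = 2 * (\<Sum>e\<in>edges n. field_gap n \<theta> \<beta> e Y)"
    unfolding sum_vertices_edges by (simp add: sum_distrib_left)
  finally show ?thesis by (simp add: mult_ac)
qed

lemma alternative_nonneg: "\<beta> \<in> alternative n s A \<Longrightarrow> A \<ge> 0 \<Longrightarrow> \<beta> i \<ge> 0"
  by (cases "i \<in> supp n \<beta>") (auto simp: alternative_def supp_def)

lemma risk_bounds:
  assumes "s \<le> real n" "A > 0"
    and "measure_pmf.prob (ergm n \<theta> (\<lambda>_. 0)) {Y. T Y = 1} \<le> u"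
    and v: "\<And>\<beta>. \<beta> \<in> alternative n s A \<Longrightarrow> measure_pmf.prob (ergm n \<theta> \<beta>) {Y. T Y = 0} \<le> v"
  shows "0 \<le> risk n \<theta> s A T" "risk n \<theta> s A T \<le> u + v"
proof -
  \<comment> \<open>The constant vector lies in the alternative since s \<le> n. It keeps the
    supremum from ranging over the empty set, where it would carry no information.\<close>
  define \<beta> where "\<beta> i = (if i \<in> {1..n} then A else 0)" for i :: nat
  have "supp n \<beta> = {1..n}" using assms(2) by (auto simp: supp_def \<beta>_def)
  then have \<beta>: "\<beta> \<in> alternative n s A" using assms(1) by (auto simp: alternative_def \<beta>_def)
  have "(SUP \<beta>\<in>alternative n s A. measure_pmf.prob (ergm n \<theta> \<beta>) {Y. T Y = 0}) \<le> v"
    using \<beta> v by (intro cSUP_least) auto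
  then show "risk n \<theta> s A T \<le> u + v" unfolding risk_def using assms(3) by linarith
  have "measure_pmf.prob (ergm n \<theta> \<beta>) {Y. T Y = 0}
      \<le> (SUP \<beta>\<in>alternative n s A. measure_pmf.prob (ergm n \<theta> \<beta>) {Y. T Y = 0})"
    using \<beta> by (intro cSUP_upper bdd_aboveI2[of _ _ 1]) auto
  then show "0 \<le> risk n \<theta> s A T"
    unfolding risk_def by (meson add_nonneg_nonneg measure_nonneg order_trans)
qed

lemma centred_sum_cond_mean:
  assumes "Y \<in> configs n" "Q \<subseteq> edges n"
  shows "(\<Sum>e\<in>Q. at_edge Y e - cond_mean_edge n \<theta> \<beta> e Y) = centred_sum (log_weight n \<theta> \<beta>) Q Y"
  unfolding centred_sum_def using assms by (intro sum.cong refl) (auto simp: cond_mean_edge_eq)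

lemma two_star_lipschitz_facts:
  assumes "\<theta> \<ge> 0" "n \<ge> 2"
  shows "tanh_lipschitz n (two_star n \<theta> \<beta>) (\<theta> / (real n - 1))"
    and "\<theta> / (real n - 1) \<ge> 0" and "\<theta> / (real n - 1) * (real n - 1) \<le> \<theta>"
  using assms by (auto intro: tanh_lipschitz_two_star)

lemma risk_sum_test:
  assumes \<theta>: "\<theta> \<ge> 0" and n: "n \<ge> 2" and s: "s \<le> real n" and A: "0 < A" "A \<le> 1" and L: "0 \<le> L n"
    and x: "0 \<le> x" "x \<le> gap_rate \<theta> * A * (real n - 1) * s / 2 - L n"
  shows "0 \<le> risk n \<theta> s A (cc_sum_test \<theta> L n)"
    and "risk n \<theta> s A (cc_sum_test \<theta> L n) \<le> exp (- (L n)\<^sup>2 / (8 * (1 + 2 * \<theta>) * (real n)\<^sup>2))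
      + exp (- x\<^sup>2 / (8 * (1 + 2 * \<theta>) * (real n)\<^sup>2))"
proof -
  let ?S = "\<lambda>\<beta>. centred_sum (log_weight n \<theta> \<beta>) (edges n)"
  have test: "cc_sum_test \<theta> L n Y = of_bool (?S (\<lambda>_. 0) Y > L n)" if "Y \<in> configs n" for Y
    by (simp add: cc_sum_test_def centred_sum_cond_mean[OF that])
  have k: "0 < (real n)\<^sup>2" using n by simp
  note lip = two_star_lipschitz_facts[OF \<theta> n]
  have u: "measure_pmf.prob (ergm n \<theta> (\<lambda>_. 0)) {Y. cc_sum_test \<theta> L n Y = 1}
      \<le> exp (- (L n)\<^sup>2 / (8 * (1 + 2 * \<theta>) * (real n)\<^sup>2))"
  proof -
    have "gibbs_mean n (null_weight n \<theta>) (\<lambda>Y. of_bool (cc_sum_test \<theta> L n Y = 1))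
        \<le> gibbs_mean n (null_weight n \<theta>) (\<lambda>Y. of_bool (L n \<le> ?S (\<lambda>_. 0) Y))"
      by (intro gibbs_mean_mono) (auto simp: test)
    then show ?thesis
      unfolding prob_ergm log_weight_degree_energy
      by (rule order_trans[OF _ tail_degree_energy(1)[OF lip subset_refl card_edges_le \<theta> k L]])
  qed
  have v: "measure_pmf.prob (ergm n \<theta> \<beta>) {Y. cc_sum_test \<theta> L n Y = 0}
      \<le> exp (- x\<^sup>2 / (8 * (1 + 2 * \<theta>) * (real n)\<^sup>2))" if \<beta>: "\<beta> \<in> alternative n s A" for \<beta>
  proof -
    have "gibbs_mean n (log_weight n \<theta> \<beta>) (\<lambda>Y. of_bool (cc_sum_test \<theta> L n Y = 0))
        \<le> gibbs_mean n (log_weight n \<theta> \<beta>) (\<lambda>Y. of_bool (?S \<beta> Y \<le> - x))"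
    proof (rule gibbs_mean_mono)
      fix Y assume Y: "Y \<in> configs n"
      have "?S \<beta> Y \<le> - x" if "?S (\<lambda>_. 0) Y \<le> L n"
      proof -
        have "gap_rate \<theta> * A * (real n - 1) * s / 2 \<le> gap_rate \<theta> * A * (real n - 1) * real (card (supp n \<beta>)) / 2"
          using \<beta> gap_rate_pos[of \<theta>] A n
          by (intro divide_right_mono mult_left_mono mult_nonneg_nonneg) (auto simp: alternative_def)
        also have "\<dots> \<le> (\<Sum>e\<in>edges n. field_gap n \<theta> \<beta> e Y)"
          using \<beta> A by (intro total_gap_ge[OF Y _ alternative_nonneg \<theta>]) (auto simp: supp_def alternative_def)
        finally show ?thesis using that x centred_sum_null[of n \<theta> "edges n" Y \<beta>] by linarith
      qed
      then show "of_bool (cc_sum_test \<theta> L n Y = 0) \<le> (of_bool (?S \<beta> Y \<le> - x) :: real)"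
        by (auto simp: test[OF Y])
    qed
    then show ?thesis
      unfolding prob_ergm log_weight_degree_energy
      by (rule order_trans[OF _ tail_degree_energy(2)[OF lip subset_refl card_edges_le \<theta> k x(1)]])
  qed
  show "0 \<le> risk n \<theta> s A (cc_sum_test \<theta> L n)"
    and "risk n \<theta> s A (cc_sum_test \<theta> L n) \<le> exp (- (L n)\<^sup>2 / (8 * (1 + 2 * \<theta>) * (real n)\<^sup>2))
      + exp (- x\<^sup>2 / (8 * (1 + 2 * \<theta>) * (real n)\<^sup>2))"
    using risk_bounds[OF s A(1) u v] by blast+
qed

text \<open>The type I error is a union bound over n stars. For the type II error a single vertex of
  the support suffices: its own star must already stay below the threshold.\<close>

lemma risk_max_test:
  fixes C :: real
  assumes \<theta>: "\<theta> \<ge> 0" and n: "n \<ge> 2" and s: "0 < s" "s \<le> real n" and A: "0 < A" "A \<le> 1" and C: "0 \<le> C"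
    and x: "0 \<le> x" "x \<le> gap_rate \<theta> * A * (real n - 1) - C * sqrt (real n * ln (real n))"
  shows "0 \<le> risk n \<theta> s A (cc_max_test \<theta> C n)"
    and "risk n \<theta> s A (cc_max_test \<theta> C n) \<le> 2 * real n * exp (- (C\<^sup>2 * ln (real n)) / (8 * (1 + 2 * \<theta>)))
      + exp (- x\<^sup>2 / (8 * (1 + 2 * \<theta>) * real n))"
proof -
  let ?S = "\<lambda>\<beta> i. centred_sum (log_weight n \<theta> \<beta>) (edges_at n i)"
  define K where "K = C * sqrt (real n * ln (real n))"
  have K: "0 \<le> K" using C n by (simp add: K_def)
  have ne: "{1..n} \<noteq> {}" using n by simp
  have test: "cc_max_test \<theta> C n Y = of_bool (\<exists>i\<in>{1..n}. ?S (\<lambda>_. 0) i Y > K)" if "Y \<in> configs n" for Y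
    using ne by (simp add: cc_max_test_def centred_sum_cond_mean[OF that edges_at_subset] Max_gr_iff K_def)
  note lip = two_star_lipschitz_facts[OF \<theta> n]
  have u: "measure_pmf.prob (ergm n \<theta> (\<lambda>_. 0)) {Y. cc_max_test \<theta> C n Y = 1}
      \<le> 2 * real n * exp (- (C\<^sup>2 * ln (real n)) / (8 * (1 + 2 * \<theta>)))"
  proof -
    have "gibbs_mean n (null_weight n \<theta>) (\<lambda>Y. of_bool (cc_max_test \<theta> C n Y = 1))
        \<le> gibbs_mean n (null_weight n \<theta>) (\<lambda>Y. of_bool (\<exists>i\<in>{1..n}. K < \<bar>?S (\<lambda>_. 0) i Y\<bar>))"
      by (intro gibbs_mean_mono) (force simp: test)
    also have "\<dots> \<le> 2 * real n * exp (- K\<^sup>2 / (8 * (1 + 2 * \<theta>) * real n))"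
      unfolding log_weight_degree_energy using n by (intro some_vertex_sum_large[OF lip \<theta> _ K]) simp
    also have "K\<^sup>2 = C\<^sup>2 * ln (real n) * real n" using n by (simp add: K_def power_mult_distrib)
    finally show ?thesis using n \<theta> by (simp add: prob_ergm)
  qed
  have v: "measure_pmf.prob (ergm n \<theta> \<beta>) {Y. cc_max_test \<theta> C n Y = 0}
      \<le> exp (- x\<^sup>2 / (8 * (1 + 2 * \<theta>) * real n))" if \<beta>: "\<beta> \<in> alternative n s A" for \<beta>
  proof -
    have "card (supp n \<beta>) \<noteq> 0" using \<beta> s(1) by (auto simp: alternative_def)
    then obtain i where i: "i \<in> supp n \<beta>" by fastforce
    then have i': "i \<in> {1..n}" and "A \<le> \<beta> i" using \<beta> by (auto simp: supp_def alternative_def)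
    have k: "real (card (edges_at n i)) \<le> real n" using card_edges_at[OF i'] by simp
    have "gibbs_mean n (log_weight n \<theta> \<beta>) (\<lambda>Y. of_bool (cc_max_test \<theta> C n Y = 0))
        \<le> gibbs_mean n (log_weight n \<theta> \<beta>) (\<lambda>Y. of_bool (?S \<beta> i Y \<le> - x))"
    proof (rule gibbs_mean_mono)
      fix Y assume Y: "Y \<in> configs n"
      have "?S \<beta> i Y \<le> - x" if "?S (\<lambda>_. 0) i Y \<le> K"
      proof -
        have "gap_rate \<theta> * A * (real n - 1) \<le> (\<Sum>e\<in>edges_at n i. field_gap n \<theta> \<beta> e Y)"
          using \<beta> A \<open>A \<le> \<beta> i\<close> by (intro vertex_gap_ge[OF Y i' alternative_nonneg \<theta>]) auto
        then show ?thesis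
          using that x centred_sum_null[of n \<theta> "edges_at n i" Y \<beta>] unfolding K_def by linarith
      qed
      then show "of_bool (cc_max_test \<theta> C n Y = 0) \<le> (of_bool (?S \<beta> i Y \<le> - x) :: real)"
        using i' by (force simp: test[OF Y])
    qed
    then show ?thesis
      unfolding prob_ergm log_weight_degree_energy
      by (rule order_trans[OF _ tail_degree_energy(2)[OF lip edges_at_subset k \<theta> _ x(1)]]) (use n in simp)
  qed
  show "0 \<le> risk n \<theta> s A (cc_max_test \<theta> C n)"
    and "risk n \<theta> s A (cc_max_test \<theta> C n) \<le> 2 * real n * exp (- (C\<^sup>2 * ln (real n)) / (8 * (1 + 2 * \<theta>)))
      + exp (- x\<^sup>2 / (8 * (1 + 2 * \<theta>) * real n))"
    using risk_bounds[OF s(2) A(1) u v] by blast+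
qed

section \<open>Asymptotics of the two test risks\<close>

lemma sum_test_powerful:
  fixes \<theta> b t :: real
  assumes \<theta>: "\<theta> > 0" and b: "b < 1" and t: "t < 0" and bt: "b + t > 0"
    and L: "\<forall>\<^sub>F n in sequentially. L n > 0" "much_less (\<lambda>n. real n) L"
      "much_less L (\<lambda>n. real n * real n powr b * real n powr t)"
  shows "asymp_powerful \<theta> (\<lambda>n. real n powr b) (\<lambda>n. real n powr t) (cc_sum_test \<theta> L)"
proof -
  define c where "c = 8 * (1 + 2 * \<theta>)"
  define \<kappa> where "\<kappa> = gap_rate \<theta>"
  have c: "c > 0" and \<kappa>: "\<kappa> > 0" using \<theta> gap_rate_pos by (auto simp: c_def \<kappa>_def)
  \<comment> \<open>For n \<ge> 2 the signal is at least \<kappa> n s A / 4, which is twice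
    \<open>x n\<close>. The threshold is eventually below \<open>x n\<close>, so a margin of
    \<open>x n\<close> remains.\<close>
  define x where "x n = \<kappa> / 8 * (real n * real n powr b * real n powr t)" for n :: nat
  have "\<forall>\<^sub>F n in sequentially. L n / (real n * real n powr b * real n powr t) < \<kappa> / 8"
    using L(3) \<kappa> unfolding much_less_def by (intro order_tendstoD(2)) auto
  then have ev: "\<forall>\<^sub>F n in sequentially. 0 \<le> risk n \<theta> (real n powr b) (real n powr t) (cc_sum_test \<theta> L n) \<and>
      risk n \<theta> (real n powr b) (real n powr t) (cc_sum_test \<theta> L n)
        \<le> exp (- (1 / (real n / L n))\<^sup>2 / c) + exp (- (\<kappa> / 8 * real n powr (b + t))\<^sup>2 / c)"
    using L(1) eventually_ge_at_top[of 2]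
  proof eventually_elim
    case (elim n)
    then have n: "n \<ge> 2" "real n \<ge> 2" by auto
    define w where "w = real n powr b * real n powr t"
    have w: "w > 0" using n by (simp add: w_def)
    have s: "real n powr b \<le> real n" using powr_mono[of b 1 "real n"] b n by simp
    have A: "0 < real n powr t" "real n powr t \<le> 1" using powr_mono[of t 0 "real n"] t n by simp_all
    have xL: "L n \<le> x n"
      using elim(1) n by (simp add: x_def divide_less_eq)
    have "\<kappa> * real n powr t * (real n - 1) * real n powr b / 2 = \<kappa> * w * ((real n - 1) / 2)"
      by (simp add: w_def)
    moreover have "\<kappa> * w * (real n / 4) \<le> \<kappa> * w * ((real n - 1) / 2)"
      using \<kappa> w n by (intro mult_left_mono) auto
    moreover have "\<kappa> * w * (real n / 4) = 2 * x n" by (simp add: x_def w_def)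
    ultimately have x: "x n \<le> \<kappa> * real n powr t * (real n - 1) * real n powr b / 2 - L n"
      using xL by linarith
    have x0: "0 \<le> x n" using \<kappa> by (simp add: x_def)
    have r: "(1 / (real n / L n))\<^sup>2 / c = (L n)\<^sup>2 / (c * (real n)\<^sup>2)"
      "(\<kappa> / 8 * real n powr (b + t))\<^sup>2 / c = (x n)\<^sup>2 / (c * (real n)\<^sup>2)"
      using n c by (simp_all add: x_def power_divide power_mult_distrib powr_add field_simps)
    show ?case
      using risk_sum_test[where \<theta> = \<theta> and L = L and s = "real n powr b" and x = "x n", OF less_imp_le[OF \<theta>] n(1) s A less_imp_le[OF elim(2)] x0 x[unfolded \<kappa>_def]]
      unfolding minus_divide_left[symmetric] r by (simp add: c_def)
  qed
  have inf: "filterlim (\<lambda>n. 1 / (real n / L n)) at_top sequentially"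
  proof (rule filterlim_at_top_mono[OF filterlim_inverse_at_top[of "\<lambda>n. real n / L n"]])
    show "(\<lambda>n. real n / L n) \<longlonglongrightarrow> 0" using L(2) by (simp add: much_less_def)
    show "\<forall>\<^sub>F n in sequentially. real n / L n > 0"
      using L(1) eventually_gt_at_top[of 0] by eventually_elim simp
  qed (simp add: inverse_eq_divide)
  have "((\<lambda>y. exp (- y\<^sup>2 / c)) \<longlongrightarrow> 0) at_top" using c by real_asymp
  from filterlim_compose[OF this inf]
  have "(\<lambda>n. exp (- (1 / (real n / L n))\<^sup>2 / c)) \<longlonglongrightarrow> 0" .
  moreover have "(\<lambda>n. exp (- (\<kappa> / 8 * real n powr (b + t))\<^sup>2 / c)) \<longlonglongrightarrow> 0"
    using c \<kappa> bt by real_asymp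
  ultimately have "(\<lambda>n. exp (- (1 / (real n / L n))\<^sup>2 / c) + exp (- (\<kappa> / 8 * real n powr (b + t))\<^sup>2 / c)) \<longlonglongrightarrow> 0"
    by (rule tendsto_add_zero)
  from tendsto_sandwich[OF _ _ tendsto_const this] show ?thesis
    unfolding asymp_powerful_def using ev by (simp only: eventually_conj_iff)
qed

lemma max_test_powerful:
  fixes \<theta> b t :: real
  assumes \<theta>: "\<theta> > 0" and b: "b < 1" and t: "t < 0" and t': "t + 1/2 > 0"
  shows "\<exists>C>0. asymp_powerful \<theta> (\<lambda>n. real n powr b) (\<lambda>n. real n powr t) (cc_max_test \<theta> C)"
proof -
  define c where "c = 8 * (1 + 2 * \<theta>)"
  define \<kappa> where "\<kappa> = gap_rate \<theta>"
  \<comment> \<open>With C^2 = 2 c each of the n stars exceeds the threshold with probability of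
    order n^(-2), so the union bound leaves 2 / n.\<close>
  define C where "C = sqrt (2 * c)"
  have c: "c > 0" and \<kappa>: "\<kappa> > 0" using \<theta> gap_rate_pos by (auto simp: c_def \<kappa>_def)
  then have C: "C > 0" "C\<^sup>2 = 2 * c" by (auto simp: C_def)
  define x where "x n = \<kappa> / 4 * (real n * real n powr t)" for n :: nat
  have "\<forall>\<^sub>F n in sequentially. C * sqrt (real n * ln (real n)) < \<kappa> / 4 * (real n * real n powr t)"
    using \<kappa> C(1) t' by real_asymp
  then have ev: "\<forall>\<^sub>F n in sequentially. 0 \<le> risk n \<theta> (real n powr b) (real n powr t) (cc_max_test \<theta> C n) \<and>
      risk n \<theta> (real n powr b) (real n powr t) (cc_max_test \<theta> C n)
        \<le> 2 / real n + exp (- (\<kappa> / 4 * (real n * real n powr t))\<^sup>2 / (c * real n))"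
    using eventually_ge_at_top[of 2]
  proof eventually_elim
    case (elim n)
    then have n: "n \<ge> 2" "real n \<ge> 2" by auto
    have s: "0 < real n powr b" "real n powr b \<le> real n" using powr_mono[of b 1 "real n"] b n by simp_all
    have A: "0 < real n powr t" "real n powr t \<le> 1" using powr_mono[of t 0 "real n"] t n by simp_all
    have "\<kappa> * real n powr t * (real n / 2) \<le> \<kappa> * real n powr t * (real n - 1)"
      using \<kappa> n by (intro mult_left_mono) auto
    then have x: "x n \<le> \<kappa> * real n powr t * (real n - 1) - C * sqrt (real n * ln (real n))"
      using elim(1) by (simp add: x_def mult_ac)
    have x0: "0 \<le> x n" using \<kappa> by (simp add: x_def)
    have "2 * real n * exp (- (C\<^sup>2 * ln (real n)) / c) = 2 / real n"
      using c C n by (simp add: exp_minus exp_double[of "ln _"] power2_eq_square field_simps mult.commute)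
    then show ?case
      using risk_max_test[where \<theta> = \<theta> and C = C and s = "real n powr b" and x = "x n", OF less_imp_le[OF \<theta>] n(1) s A less_imp_le[OF C(1)] x0 x[unfolded \<kappa>_def]]
      by (simp add: c_def x_def)
  qed
  have "(\<lambda>n. 2 / real n + exp (- (\<kappa> / 4 * (real n * real n powr t))\<^sup>2 / (c * real n))) \<longlonglongrightarrow> 0"
    using c \<kappa> t' by real_asymp
  from tendsto_sandwich[OF _ _ tendsto_const this]
  have "asymp_powerful \<theta> (\<lambda>n. real n powr b) (\<lambda>n. real n powr t) (cc_max_test \<theta> C)"
    unfolding asymp_powerful_def using ev by (simp only: eventually_conj_iff)
  then show ?thesis using C(1) by blast
qed

section \<open>Dobrushin's comparison of Gibbs measures\<close>

definition osc_bound :: "nat \<Rightarrow> (config \<Rightarrow> real) \<Rightarrow> (nat \<times> nat \<Rightarrow> real) \<Rightarrow> bool" where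
  "osc_bound n F d \<longleftrightarrow>
     (\<forall>e\<in>edges n. \<forall>Y\<in>configs n. \<bar>F (set_edge e 1 Y) - F (set_edge e (-1) Y)\<bar> \<le> d e)"

lemma osc_boundD:
  "osc_bound n F d \<Longrightarrow> e \<in> edges n \<Longrightarrow> Y \<in> configs n \<Longrightarrow> \<bar>F (set_edge e 1 Y) - F (set_edge e (-1) Y)\<bar> \<le> d e"
  by (simp add: osc_bound_def)

lemma osc_bound_nonneg:
  assumes "osc_bound n F d" "e \<in> edges n" shows "d e \<ge> 0"
proof -
  obtain Y where "Y \<in> configs n" using configs_nonempty by blast
  from osc_boundD[OF assms this] show ?thesis by linarith
qed

text \<open>Telescoping along a path that changes the differing edges one at a time.\<close>

lemma osc_bound_total:
  assumes osc: "osc_bound n F d" and D: "finite D" "D \<subseteq> edges n"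
    and Y: "Y \<in> configs n" and X: "X \<in> configs n"
    and eq: "\<And>e. e \<in> edges n - D \<Longrightarrow> at_edge Y e = at_edge X e"
  shows "\<bar>F Y - F X\<bar> \<le> (\<Sum>e\<in>D. d e)"
  using D Y eq
proof (induction D arbitrary: Y rule: finite_induct)
  case empty
  then have "Y = X" by (intro config_eqI[OF _ X]) auto
  then show ?case by simp
next
  case (insert e D)
  then have e: "e \<in> edges n" by simp
  define Y' where "Y' = set_edge e (at_edge X e) Y"
  have Y': "Y' \<in> configs n"
    unfolding Y'_def using at_edge_cases[OF X e] insert.prems(2) e by auto
  have "\<bar>F Y' - F X\<bar> \<le> (\<Sum>e\<in>D. d e)"
    using insert.prems by (intro insert.IH Y') (auto simp: Y'_def at_edge_set_edge[OF e])
  moreover have "\<bar>F Y - F Y'\<bar> \<le> d e"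
    using osc_boundD[OF osc e insert.prems(2)] set_edge_self[OF insert.prems(2), of e]
      at_edge_cases[OF X e] at_edge_cases[OF insert.prems(2) e] osc_bound_nonneg[OF osc e]
    unfolding Y'_def by (auto simp: abs_minus_commute)
  ultimately show ?case using insert.hyps by simp
qed

definition estimate ::
    "nat \<Rightarrow> (config \<Rightarrow> real) \<Rightarrow> (config \<Rightarrow> real) \<Rightarrow> (nat \<times> nat \<Rightarrow> real) \<Rightarrow> bool" where
  "estimate n H H' r \<longleftrightarrow> (\<forall>F d. osc_bound n F d \<longrightarrow>
     \<bar>gibbs_mean n H F - gibbs_mean n H' F\<bar> \<le> (\<Sum>e\<in>edges n. r e * d e))"

lemma estimate_mono:
  assumes "estimate n H H' r" "\<And>e. e \<in> edges n \<Longrightarrow> r e \<le> r' e"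
  shows "estimate n H H' r'"
  unfolding estimate_def
proof (intro allI impI)
  fix F d assume osc: "osc_bound n F d"
  then have "\<bar>gibbs_mean n H F - gibbs_mean n H' F\<bar> \<le> (\<Sum>e\<in>edges n. r e * d e)"
    using assms(1) by (simp add: estimate_def)
  also have "\<dots> \<le> (\<Sum>e\<in>edges n. r' e * d e)"
    using assms(2) osc_bound_nonneg[OF osc] by (intro sum_mono mult_right_mono) auto
  finally show "\<bar>gibbs_mean n H F - gibbs_mean n H' F\<bar> \<le> (\<Sum>e\<in>edges n. r' e * d e)" .
qed

lemma estimate_2: "estimate n H H' (\<lambda>_. 2)"
  unfolding estimate_def
proof (intro allI impI)
  fix F d assume osc: "osc_bound n F d"
  obtain X where X: "X \<in> configs n" using configs_nonempty by blast
  have "\<bar>gibbs_mean n K F - F X\<bar> \<le> (\<Sum>e\<in>edges n. d e)" for K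
  proof -
    have "\<bar>gibbs_mean n K (\<lambda>Y. F Y - F X)\<bar> \<le> gibbs_mean n K (\<lambda>Y. \<Sum>e\<in>edges n. d e)"
      by (intro gibbs_mean_abs_le osc_bound_total[OF osc _ _ _ X]) auto
    then show ?thesis by (simp add: gibbs_mean_diff)
  qed
  from this[of H] this[of H'] show "\<bar>gibbs_mean n H F - gibbs_mean n H' F\<bar> \<le> (\<Sum>e\<in>edges n. 2 * d e)"
    unfolding sum_distrib_left[symmetric] by linarith
qed

text \<open>Averaging over \<open>e\<close> removes the dependence on \<open>e\<close>, but the
  averaging weights depend on the other edges; the oscillation at \<open>e\<close> is thereby passed
  on to \<open>f\<close> with factor \<open>J f\<close>.\<close>

lemma osc_bound_resample:
  assumes osc: "osc_bound n F d" and e: "e \<in> edges n"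
    and J: "\<And>f Y. f \<in> edges n \<Longrightarrow> f \<noteq> e \<Longrightarrow> Y \<in> configs n \<Longrightarrow>
      \<bar>local_mean H e (set_edge f 1 Y) - local_mean H e (set_edge f (-1) Y)\<bar> \<le> 2 * J f"
  shows "osc_bound n (resample H e F) (\<lambda>f. if f = e then 0 else d f + J f * d e)"
  unfolding osc_bound_def
proof (intro ballI)
  fix f Y assume f: "f \<in> edges n" and Y: "Y \<in> configs n"
  show "\<bar>resample H e F (set_edge f 1 Y) - resample H e F (set_edge f (-1) Y)\<bar>
      \<le> (if f = e then 0 else d f + J f * d e)"
  proof (cases "f = e")
    case True
    then show ?thesis by (simp add: resample_def)
  next
    case False
    define G where "G v w = F (set_edge e v (set_edge f w Y))" for v w
    define mp where "mp = local_mean H e (set_edge f 1 Y)"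
    define mm where "mm = local_mean H e (set_edge f (-1) Y)"
    have m: "- 1 < mp" "mp < 1" using local_mean_bounds by (auto simp: mp_def)
    have Gf: "\<bar>G v 1 - G v (-1)\<bar> \<le> d f" if "v = 1 \<or> v = -1" for v
      using osc_boundD[OF osc f set_edge_in_configs[OF Y e that]]
      unfolding G_def set_edge_commute[OF e f False[symmetric]] .
    have Ge: "\<bar>G 1 (-1) - G (-1) (-1)\<bar> \<le> d e"
      unfolding G_def using osc_boundD[OF osc e set_edge_in_configs[OF Y f]] by simp
    have eq: "resample H e F (set_edge f 1 Y) - resample H e F (set_edge f (-1) Y)
        = (1 + mp) / 2 * (G 1 1 - G 1 (-1)) + (1 - mp) / 2 * (G (-1) 1 - G (-1) (-1))
          + (mp - mm) / 2 * (G 1 (-1) - G (-1) (-1))"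
      by (simp add: resample_def G_def[symmetric] mp_def[symmetric] mm_def[symmetric] field_simps)
    have "\<bar>resample H e F (set_edge f 1 Y) - resample H e F (set_edge f (-1) Y)\<bar>
        \<le> \<bar>(1 + mp) / 2 * (G 1 1 - G 1 (-1))\<bar> + \<bar>(1 - mp) / 2 * (G (-1) 1 - G (-1) (-1))\<bar>
        + \<bar>(mp - mm) / 2 * (G 1 (-1) - G (-1) (-1))\<bar>"
      unfolding eq by linarith
    also have "\<dots> = (1 + mp) / 2 * \<bar>G 1 1 - G 1 (-1)\<bar> + (1 - mp) / 2 * \<bar>G (-1) 1 - G (-1) (-1)\<bar>
        + \<bar>mp - mm\<bar> / 2 * \<bar>G 1 (-1) - G (-1) (-1)\<bar>"
      using m by (simp add: abs_mult)
    also have "\<dots> \<le> (1 + mp) / 2 * d f + (1 - mp) / 2 * d f + J f * d e"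
      using m Gf[of 1] Gf[of "-1"] Ge J[OF f False Y] osc_bound_nonneg[OF osc e]
      by (intro add_mono mult_mono) (auto simp: mp_def mm_def)
    also have "\<dots> = d f + J f * d e" by (simp add: field_simps)
    finally show ?thesis using False by simp
  qed
qed

text \<open>Stationarity allows one heat-bath step of each measure to be inserted. The
  \<open>H\<close> kernel is compared under the two measures by the old estimate, and then the two
  kernels are compared under \<open>H'\<close> through \<open>b\<close>.\<close>

lemma estimate_update:
  assumes est: "estimate n H H' r" and e: "e \<in> edges n"
    and J: "\<And>f Y. f \<in> edges n \<Longrightarrow> f \<noteq> e \<Longrightarrow> Y \<in> configs n \<Longrightarrow>
      \<bar>local_mean H e (set_edge f 1 Y) - local_mean H e (set_edge f (-1) Y)\<bar> \<le> 2 * J f"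
    and b: "\<And>Y. Y \<in> configs n \<Longrightarrow> \<bar>local_mean H e Y - local_mean H' e Y\<bar> \<le> 2 * b"
  shows "estimate n H H' (r(e := b + (\<Sum>f\<in>edges n - {e}. J f * r f)))"
  unfolding estimate_def
proof (intro allI impI)
  fix F d assume osc: "osc_bound n F d"
  have "\<bar>gibbs_mean n H (resample H e F) - gibbs_mean n H' (resample H e F)\<bar>
      \<le> (\<Sum>f\<in>edges n. r f * (if f = e then 0 else d f + J f * d e))"
    using est osc_bound_resample[OF osc e J] unfolding estimate_def by blast
  also have "\<dots> = (\<Sum>f\<in>edges n - {e}. r f * (d f + J f * d e))"
    using e by (subst sum.remove[of _ e]) auto
  also have "\<dots> = (\<Sum>f\<in>edges n - {e}. r f * d f) + d e * (\<Sum>f\<in>edges n - {e}. J f * r f)"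
    by (simp add: sum_distrib_left sum.distrib algebra_simps)
  finally have 1: "\<bar>gibbs_mean n H F - gibbs_mean n H' (resample H e F)\<bar>
      \<le> (\<Sum>f\<in>edges n - {e}. r f * d f) + d e * (\<Sum>f\<in>edges n - {e}. J f * r f)"
    by (simp only: gibbs_mean_resample[OF e])
  have "\<bar>gibbs_mean n H' (\<lambda>Y. resample H e F Y - resample H' e F Y)\<bar> \<le> gibbs_mean n H' (\<lambda>Y. b * d e)"
  proof (rule gibbs_mean_abs_le)
    fix Y assume Y: "Y \<in> configs n"
    have eq: "resample H e F Y - resample H' e F Y =
        (local_mean H e Y - local_mean H' e Y) / 2 * (F (set_edge e 1 Y) - F (set_edge e (-1) Y))"
      by (simp add: resample_def field_simps)
    have "\<bar>resample H e F Y - resample H' e F Y\<bar>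
        = \<bar>local_mean H e Y - local_mean H' e Y\<bar> / 2 * \<bar>F (set_edge e 1 Y) - F (set_edge e (-1) Y)\<bar>"
      unfolding eq by (simp add: abs_mult)
    also have "\<dots> \<le> b * d e"
      using b[OF Y] osc_boundD[OF osc e Y] by (intro mult_mono) auto
    finally show "\<bar>resample H e F Y - resample H' e F Y\<bar> \<le> b * d e" .
  qed
  then have 2: "\<bar>gibbs_mean n H' (resample H e F) - gibbs_mean n H' F\<bar> \<le> b * d e"
    by (simp only: gibbs_mean_diff gibbs_mean_resample[OF e] gibbs_mean_const)
  have "(\<Sum>f\<in>edges n. (r(e := b + (\<Sum>f\<in>edges n - {e}. J f * r f))) f * d f)
      = (b + (\<Sum>f\<in>edges n - {e}. J f * r f)) * d e + (\<Sum>f\<in>edges n - {e}. r f * d f)"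
    using e by (subst sum.remove[of _ e]) auto
  then show "\<bar>gibbs_mean n H F - gibbs_mean n H' F\<bar>
      \<le> (\<Sum>f\<in>edges n. (r(e := b + (\<Sum>f\<in>edges n - {e}. J f * r f))) f * d f)"
    using 1 2 by (simp add: algebra_simps)
qed

text \<open>The vector \<open>r\<close> is a supersolution of r = b + J r and stands in for the
  Neumann series applied to \<open>b\<close>. Starting from the trivial estimate, each sweep over
  all edges multiplies the excess over \<open>r\<close> by \<open>l\<close>, and the limit leaves
  \<open>r\<close> itself.\<close>

theorem dobrushin_comparison:
  assumes J: "\<And>e f Y. e \<in> edges n \<Longrightarrow> f \<in> edges n \<Longrightarrow> f \<noteq> e \<Longrightarrow> Y \<in> configs n \<Longrightarrow>
      \<bar>local_mean H e (set_edge f 1 Y) - local_mean H e (set_edge f (-1) Y)\<bar> \<le> 2 * J e f"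
    and J0: "\<And>e f. 0 \<le> J e f"
    and b: "\<And>e Y. e \<in> edges n \<Longrightarrow> Y \<in> configs n \<Longrightarrow> \<bar>local_mean H e Y - local_mean H' e Y\<bar> \<le> 2 * b e"
    and row: "\<And>e. e \<in> edges n \<Longrightarrow> (\<Sum>f\<in>edges n. J e f) \<le> l" and l: "0 \<le> l" "l < 1"
    and r0: "\<And>e. 0 \<le> r e"
    and super: "\<And>e. e \<in> edges n \<Longrightarrow> b e + (\<Sum>f\<in>edges n. J e f * r f) \<le> r e"
  shows "estimate n H H' r"
proof -
  \<comment> \<open>Edges are updated one at a time, as in Gauss-Seidel iteration, and
    \<open>D\<close> collects those already done. Updated entries are no larger than before since l
    c \<le> c, so the row sum bound still applies to the others.\<close>
  have sweep: "estimate n H H' (\<lambda>e. if e \<in> D then r e + l * c else r e + c)"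
    if est: "estimate n H H' (\<lambda>e. r e + c)" and c: "0 \<le> c" and D: "finite D" "D \<subseteq> edges n" for c D
    using D
  proof (induction D rule: finite_induct)
    case empty
    then show ?case using est by simp
  next
    case (insert e D)
    then have e: "e \<in> edges n" by simp
    define \<rho> where "\<rho> = (\<lambda>e. if e \<in> D then r e + l * c else r e + c)"
    have lc: "l * c \<le> c" using l c by (simp add: mult_left_le_one_le)
    have "estimate n H H' (\<rho>(e := b e + (\<Sum>f\<in>edges n - {e}. J e f * \<rho> f)))"
      using insert.IH insert.prems e by (intro estimate_update J b) (auto simp: \<rho>_def)
    then show ?case
    proof (rule estimate_mono)
      fix f assume "f \<in> edges n"
      have "(\<Sum>f\<in>edges n - {e}. J e f * \<rho> f) \<le> (\<Sum>f\<in>edges n. J e f * (r f + c))"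
      proof (rule order_trans[OF sum_mono2[where B = "edges n"]])
        show "(\<Sum>f\<in>edges n. J e f * \<rho> f) \<le> (\<Sum>f\<in>edges n. J e f * (r f + c))"
          using J0 lc by (intro sum_mono mult_left_mono) (auto simp: \<rho>_def)
      qed (use J0 r0 l c in \<open>auto simp: \<rho>_def intro!: mult_nonneg_nonneg add_nonneg_nonneg\<close>)
      also have "\<dots> = (\<Sum>f\<in>edges n. J e f * r f) + (\<Sum>f\<in>edges n. J e f) * c"
        by (simp add: distrib_left sum.distrib sum_distrib_right)
      also have "\<dots> \<le> r e - b e + l * c"
        using super[OF e] row[OF e] c by (intro add_mono mult_right_mono) auto
      finally show "(\<rho>(e := b e + (\<Sum>f\<in>edges n - {e}. J e f * \<rho> f))) f
          \<le> (if f \<in> insert e D then r f + l * c else r f + c)"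
        by (auto simp: \<rho>_def)
    qed
  qed
  have iter: "estimate n H H' (\<lambda>e. r e + l ^ k * 2)" for k
  proof (induction k)
    case 0
    show ?case by (rule estimate_mono[OF estimate_2]) (use r0 in auto)
  next
    case (Suc k)
    from sweep[OF this _ finite_edges subset_refl] l
    have "estimate n H H' (\<lambda>e. if e \<in> edges n then r e + l * (l ^ k * 2) else r e + l ^ k * 2)"
      by simp
    then show ?case by (rule estimate_mono) (simp add: mult.assoc)
  qed
  show ?thesis
    unfolding estimate_def
  proof (intro allI impI)
    fix F d assume osc: "osc_bound n F d"
    have "(\<lambda>k. l ^ k) \<longlonglongrightarrow> 0" using l by (intro LIMSEQ_realpow_zero)
    note tendsto_add[OF tendsto_const tendsto_mult_right[OF this, of 2]]
    from tendsto_sum[OF tendsto_mult_right[OF this]] have "(\<lambda>k. \<Sum>e\<in>edges n. (r e + l ^ k * 2) * d e) \<longlonglongrightarrow> (\<Sum>e\<in>edges n. (r e + 0 * 2) * d e)" .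
    then show "\<bar>gibbs_mean n H F - gibbs_mean n H' F\<bar> \<le> (\<Sum>e\<in>edges n. r e * d e)"
      using iter osc by (intro LIMSEQ_le_const[of "\<lambda>k. \<Sum>e\<in>edges n. (r e + l ^ k * 2) * d e"])
        (auto simp: estimate_def)
  qed
qed

section \<open>Response of degree sums to an external field\<close>

definition degree_sum :: "nat \<Rightarrow> nat set \<Rightarrow> config \<Rightarrow> real" where
  "degree_sum n S Y = (\<Sum>i\<in>S. degree n Y i)"

definition add_field :: "(nat \<Rightarrow> real \<Rightarrow> real) \<Rightarrow> real \<Rightarrow> nat set \<Rightarrow> nat \<Rightarrow> real \<Rightarrow> real" where
  "add_field U a S i x = U i x + a * of_bool (i \<in> S) * x"

lemma degree_sum_indicator:
  assumes "S \<subseteq> {1..n}"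
  shows "degree_sum n S Y = (\<Sum>i=1..n. of_bool (i \<in> S) * degree n Y i)"
  unfolding degree_sum_def using assms
  by (intro sum.mono_neutral_cong_left) auto

lemma degree_energy_add_field:
  assumes "S \<subseteq> {1..n}"
  shows "degree_energy n (add_field U a S) Y = degree_energy n U Y + a * degree_sum n S Y"
  unfolding degree_energy_def add_field_def degree_sum_indicator[OF assms]
  by (simp add: sum.distrib mult.assoc flip: sum_distrib_left)

lemma drive_add_field: "drive (add_field U a S) i x = drive U i x + a * of_bool (i \<in> S)"
  by (simp add: drive_def add_field_def field_simps)

lemma abs_degree_sum_le:
  assumes "Y \<in> configs n" "S \<subseteq> {1..n}"
  shows "\<bar>degree_sum n S Y\<bar> \<le> real (card S) * (real n - 1)"
proof -
  have "\<bar>degree_sum n S Y\<bar> \<le> (\<Sum>i\<in>S. \<bar>degree n Y i\<bar>)" unfolding degree_sum_def by (rule sum_abs)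
  also have "\<dots> \<le> (\<Sum>i\<in>S. real n - 1)" using assms by (intro sum_mono abs_degree_le) auto
  finally show ?thesis by simp
qed

lemma sum_edges_at_indicator:
  assumes i: "i \<in> {1..n}" and S: "S \<subseteq> {1..n}" and a: "a \<ge> 0"
  shows "(\<Sum>e\<in>edges_at n i. a * (of_bool (fst e \<in> S) + of_bool (snd e \<in> S)) + g)
    \<le> (real n - 1) * (a * of_bool (i \<in> S) + g) + a * real (card S)"
proof -
  have fin: "finite S" by (rule finite_subset[OF S]) simp
  have "(\<Sum>e\<in>edges_at n i. a * (of_bool (fst e \<in> S) + of_bool (snd e \<in> S)) + g)
      = (\<Sum>j\<in>{1..n}-{i}. a * (of_bool (i \<in> S) + of_bool (j \<in> S)) + g)"
    by (rule sum_edges_at[OF i, where g = "\<lambda>i j. a * (of_bool (i \<in> S) + of_bool (j \<in> S)) + g"])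
      (simp add: add.commute)
  also have "\<dots> = (real n - 1) * (a * of_bool (i \<in> S) + g) + a * (\<Sum>j\<in>{1..n}-{i}. of_bool (j \<in> S))"
    using i by (simp add: sum.distrib sum_distrib_left distrib_left of_nat_diff algebra_simps)
  also have "(\<Sum>j\<in>{1..n}-{i}. of_bool (j \<in> S)) \<le> (\<Sum>j\<in>S. 1 :: real)"
    using fin by (simp add: sum.If_cases of_bool_def) (auto intro!: card_mono)
  finally show ?thesis using a by (simp add: mult_left_mono)
qed

text \<open>The response of an edge to a field on \<open>S'\<close> has a direct part, proportional
  to its number of endpoints in \<open>S'\<close>, and a uniform feedback of order a |S'| / n
  through the degrees. Summed over the edges at \<open>S\<close>, the direct part gives both n |S
  \<inter> S'| and |S| |S'|, and the feedback only the latter.\<close>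

lemma degree_sum_response:
  assumes lip: "tanh_lipschitz n U \<gamma>" and \<gamma>: "0 \<le> \<gamma>" "2 * \<gamma> * (real n - 1) \<le> l" and l: "0 \<le> l" "l < 1"
    and n: "n \<ge> 2" and S: "S \<subseteq> {1..n}" and S': "S' \<subseteq> {1..n}" and a: "0 \<le> a"
  shows "\<bar>gibbs_mean n (degree_energy n (add_field U a S')) (degree_sum n S)
      - gibbs_mean n (degree_energy n U) (degree_sum n S)\<bar>
    \<le> 2 * a / (1 - l) * (real n * real (card (S \<inter> S')) + real (card S) * real (card S'))"
proof -
  have nr: "real n - 1 > 0" using n by simp
  define I where "I = (\<lambda>e. of_bool (fst e \<in> S) + of_bool (snd e \<in> S) :: real)"
  define I' where "I' = (\<lambda>e. of_bool (fst e \<in> S') + of_bool (snd e \<in> S') :: real)"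
  define m where "m = real (card S)"
  define m' where "m' = real (card S')"
  \<comment> \<open>The solution of g = l (g + a m' / (n - 1)), which makes \<open>r\<close> a
    supersolution.\<close>
  define g where "g = l * a * m' / ((real n - 1) * (1 - l))"
  define r where "r = (\<lambda>e. a * I' e + g)"
  have g0: "0 \<le> g" unfolding g_def m'_def using l a nr by simp
  have I0: "0 \<le> I e" "0 \<le> I' e" for e by (auto simp: I_def I'_def)
  have finS: "finite S" by (rule finite_subset[OF S]) simp
  let ?H = "degree_energy n U" and ?H' = "degree_energy n (add_field U a S')"
  have est: "estimate n ?H ?H' r"
  proof (rule dobrushin_comparison[where J = "\<lambda>e f. \<gamma> * share e f" and b = "\<lambda>e. a * I' e / 2" and l = l])
    fix e f Y assume "e \<in> edges n" "f \<in> edges n" "f \<noteq> e" "Y \<in> configs n"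
    then show "\<bar>local_mean ?H e (set_edge f 1 Y) - local_mean ?H e (set_edge f (-1) Y)\<bar> \<le> 2 * (\<gamma> * share e f)"
      using local_mean_flip_le[OF lip, of Y f e] by simp
  next
    fix e Y assume e: "e \<in> edges n" and Y: "Y \<in> configs n"
    have "\<bar>local_mean ?H e Y - local_mean ?H' e Y\<bar> \<le> \<bar>a * I' e\<bar>"
      unfolding local_mean_degree_energy[OF Y e] drive_add_field
      by (rule order_trans[OF tanh_lipschitz_1]) (simp add: I'_def algebra_simps abs_minus_commute)
    then show "\<bar>local_mean ?H e Y - local_mean ?H' e Y\<bar> \<le> 2 * (a * I' e / 2)"
      using a I0 by simp
  next
    fix e assume e: "e \<in> edges n"
    note D = edgesD[OF e]
    have "(\<Sum>f\<in>edges n. \<gamma> * share e f) = \<gamma> * (\<Sum>f\<in>edges n. share e f * 1)"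
      by (simp add: sum_distrib_left)
    also have "\<dots> = 2 * \<gamma> * (real n - 1)"
      unfolding sum_share[OF e] using D by (simp add: card_edges_at)
    finally show "(\<Sum>f\<in>edges n. \<gamma> * share e f) \<le> l" using \<gamma> by simp
    have at: "(\<Sum>f\<in>edges_at n i. r f) \<le> (real n - 1) * (a * of_bool (i \<in> S') + g) + a * m'"
      if "i \<in> {1..n}" for i
      unfolding r_def I'_def m'_def by (rule sum_edges_at_indicator[OF that S' a])
    have "(\<Sum>f\<in>edges n. \<gamma> * share e f * r f) = \<gamma> * (\<Sum>f\<in>edges n. share e f * r f)"
      by (simp add: sum_distrib_left mult.assoc)
    also have "\<dots> \<le> \<gamma> * ((real n - 1) * (a * I' e + 2 * g) + 2 * a * m')"
      unfolding sum_share[OF e] using at[OF D(1)] at[OF D(2)] \<gamma>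
      by (intro mult_left_mono) (auto simp: I'_def algebra_simps)
    also have "\<dots> = (2 * \<gamma> * (real n - 1)) * (a * I' e / 2 + g + a * m' / (real n - 1))"
      using nr by (simp add: field_simps)
    also have "\<dots> \<le> l * (a * I' e / 2 + g + a * m' / (real n - 1))"
      using \<gamma> a g0 I0 nr by (intro mult_right_mono) (auto simp: m'_def)
    also have "\<dots> = l * (a * I' e / 2) + g"
    proof -
      have "l * a * m' / (real n - 1) = g * (1 - l)" using nr l by (simp add: g_def)
      then show ?thesis by (simp add: algebra_simps)
    qed
    also have "\<dots> \<le> a * I' e / 2 + g"
      using l a I0[of e] by (intro add_mono mult_left_le_one_le) auto
    finally show "a * I' e / 2 + (\<Sum>f\<in>edges n. \<gamma> * share e f * r f) \<le> r e"
      by (simp add: r_def)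
  qed (use \<gamma> l a g0 I0 in \<open>auto simp: r_def\<close>)
  have osc: "osc_bound n (degree_sum n S) (\<lambda>e. 2 * I e)"
    unfolding osc_bound_def
  proof (intro ballI)
    fix e Y assume e: "e \<in> edges n" and Y: "Y \<in> configs n"
    note D = edgesD[OF e]
    have "degree_sum n S (set_edge e 1 Y) - degree_sum n S (set_edge e (-1) Y)
        = (\<Sum>i\<in>S. (if fst e = i then 2 else 0) + (if snd e = i then 2 else 0))"
      unfolding degree_sum_def sum_subtractf[symmetric]
      using S D by (intro sum.cong refl) (auto simp: degree_set_edge[OF Y e])
    also have "\<dots> = 2 * I e" using finS by (simp add: sum.distrib I_def)
    finally show "\<bar>degree_sum n S (set_edge e 1 Y) - degree_sum n S (set_edge e (-1) Y)\<bar> \<le> 2 * I e"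
      using I0 by simp
  qed
  have "(\<Sum>e\<in>edges n. r e * I e) = (\<Sum>i=1..n. \<Sum>e\<in>edges_at n i. of_bool (i \<in> S) * r e)"
    by (subst sum_vertices_edges) (simp add: I_def algebra_simps)
  also have "\<dots> = (\<Sum>i\<in>S. \<Sum>e\<in>edges_at n i. r e)"
    unfolding sum_distrib_left[symmetric] using S
    by (intro sum.mono_neutral_cong_right) auto
  also have "\<dots> \<le> (\<Sum>i\<in>S. (real n - 1) * (a * of_bool (i \<in> S') + g) + a * m')"
    unfolding r_def I'_def m'_def using S by (intro sum_mono sum_edges_at_indicator S' a) auto
  also have "\<dots> = (\<Sum>i\<in>S. (a * (real n - 1)) * of_bool (i \<in> S')) + (\<Sum>i\<in>S. (real n - 1) * g + a * m')"
    unfolding sum.distrib[symmetric] by (intro sum.cong refl) (simp only: algebra_simps)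
  also have "\<dots> = a * ((real n - 1) * (\<Sum>i\<in>S. of_bool (i \<in> S'))) + m * ((real n - 1) * g) + a * m * m'"
    unfolding sum_distrib_left[symmetric] by (simp add: m_def distrib_left mult_ac)
  also have "(\<Sum>i\<in>S. of_bool (i \<in> S')) = real (card (S \<inter> S'))"
    using finS by (simp add: of_bool_def sum.If_cases)
  also have "a * ((real n - 1) * real (card (S \<inter> S'))) + m * ((real n - 1) * g) + a * m * m'
      \<le> a * (real n * real (card (S \<inter> S'))) + m * (l * a * m' / (1 - l)) + a * m * m'"
    using a nr l by (intro add_mono mult_left_mono mult_right_mono) (auto simp: g_def m_def)
  also have "\<dots> = a * (real n * real (card (S \<inter> S'))) + a / (1 - l) * (m * m')"
    using l by (simp add: field_simps)
  also have "\<dots> \<le> a / (1 - l) * (real n * real (card (S \<inter> S'))) + a / (1 - l) * (m * m')"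
    using l a by (intro add_right_mono mult_right_mono) (auto simp: pos_le_divide_eq mult_left_le)
  also have "\<dots> = a / (1 - l) * (real n * real (card (S \<inter> S')) + m * m')"
    by (simp add: distrib_left)
  finally have main: "(\<Sum>e\<in>edges n. r e * I e)
      \<le> a / (1 - l) * (real n * real (card (S \<inter> S')) + m * m')" .
  have "\<bar>gibbs_mean n ?H' (degree_sum n S) - gibbs_mean n ?H (degree_sum n S)\<bar> \<le> (\<Sum>e\<in>edges n. r e * (2 * I e))"
    using est osc unfolding estimate_def by (subst abs_minus_commute) blast
  also have "\<dots> = 2 * (\<Sum>e\<in>edges n. r e * I e)"
    by (simp add: sum_distrib_left mult_ac)
  finally show ?thesis using main by (simp add: m_def m'_def)
qed

text \<open>Interpolation in the strength \<open>u\<close> of the field on \<open>S\<close>: the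
  derivative of ln Z(a, u) - ln Z(0, u) is the response of the degree sum over \<open>S\<close> to a
  field \<open>a\<close> on \<open>S'\<close>, bounded uniformly in \<open>u\<close>. Integration
  over [0, a] gives the square of \<open>a\<close>. The Lipschitz hypothesis is required for all
  nonnegative \<open>u\<close> because the intermediate measures must be contractive too.\<close>

lemma partition_decorrelation:
  assumes lip: "\<And>u. 0 \<le> u \<Longrightarrow> tanh_lipschitz n (add_field U u S) \<gamma>"
    and \<gamma>: "0 \<le> \<gamma>" "2 * \<gamma> * (real n - 1) \<le> l" and l: "0 \<le> l" "l < 1"
    and n: "n \<ge> 2" and S: "S \<subseteq> {1..n}" and S': "S' \<subseteq> {1..n}" and a: "0 \<le> a"
  shows "gibbs_mean n (degree_energy n U) (\<lambda>Y. exp (a * degree_sum n S Y) * exp (a * degree_sum n S' Y))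
    \<le> gibbs_mean n (degree_energy n U) (\<lambda>Y. exp (a * degree_sum n S Y))
      * gibbs_mean n (degree_energy n U) (\<lambda>Y. exp (a * degree_sum n S' Y))
      * exp (2 * a\<^sup>2 / (1 - l) * (real n * real (card (S \<inter> S')) + real (card S) * real (card S')))"
proof -
  let ?H = "degree_energy n U" and ?K = "degree_sum n S" and ?K' = "degree_sum n S'"
  define B where "B = 2 * a / (1 - l) * (real n * real (card (S \<inter> S')) + real (card S) * real (card S'))"
  define Z where "Z c u = gibbs_mean n ?H (\<lambda>Y. exp (u * ?K Y) * exp (c * ?K' Y))" for c u
  define M where "M c u = gibbs_mean n ?H (\<lambda>Y. exp (u * ?K Y) * exp (c * ?K' Y) * ?K Y)" for c u
  have Zpos: "Z c u > 0" for c u unfolding Z_def by (rule gibbs_mean_pos) simp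
  have dZ: "(Z c has_real_derivative M c u) (at u)" for c u
  proof -
    have "(\<Sum>Y\<in>configs n. exp (?H Y)) \<noteq> 0"
      using gibbs_sum_one_pos[of n ?H] by (simp add: gibbs_sum_def)
    then show ?thesis unfolding Z_def M_def gibbs_mean_def gibbs_sum_def
      by (auto intro!: derivative_eq_intros sum.cong simp: mult_ac)
  qed
  have MZ: "M c u / Z c u = gibbs_mean n (degree_energy n (add_field (add_field U u S) c S')) ?K" for c u
  proof -
    have "gibbs_sum n (degree_energy n (add_field (add_field U u S) c S')) F
        = gibbs_sum n ?H (\<lambda>Y. exp (u * ?K Y) * exp (c * ?K' Y) * F Y)" for F
      by (simp add: gibbs_sum_def degree_energy_add_field[OF S] degree_energy_add_field[OF S'] exp_add mult_ac)
    then show ?thesis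
      using gibbs_sum_one_pos[of n ?H] by (simp add: M_def Z_def gibbs_mean_def)
  qed
  have "ln (Z a a) - ln (Z 0 a) - B * a \<le> ln (Z a 0) - ln (Z 0 0) - B * 0"
  proof (rule DERIV_nonpos_imp_nonincreasing[where f = "\<lambda>u. ln (Z a u) - ln (Z 0 u) - B * u", OF a])
    fix u assume u: "0 \<le> u" "u \<le> a"
    have d: "((\<lambda>u. ln (Z a u) - ln (Z 0 u) - B * u) has_real_derivative
        M a u / Z a u - M 0 u / Z 0 u - B) (at u)"
      using Zpos by (auto intro!: derivative_eq_intros dZ)
    have 0: "degree_energy n (add_field (add_field U u S) 0 S') = degree_energy n (add_field U u S)"
      by (simp add: add_field_def fun_eq_iff degree_energy_def)
    have "M a u / Z a u - M 0 u / Z 0 u \<le> B"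
      using degree_sum_response[OF lip[OF u(1)] \<gamma> l n S S' a] unfolding MZ 0 B_def by linarith
    then show "\<exists>y. ((\<lambda>u. ln (Z a u) - ln (Z 0 u) - B * u) has_real_derivative y) (at u) \<and> y \<le> 0"
      using d by (intro exI[of _ "M a u / Z a u - M 0 u / Z 0 u - B"]) auto
  qed
  moreover have "Z 0 0 = 1" by (simp add: Z_def)
  ultimately have "ln (Z a a) \<le> ln (Z 0 a) + ln (Z a 0) + B * a" by simp
  also have "\<dots> = ln (Z 0 a * Z a 0 * exp (B * a))"
    using Zpos[of 0 a] Zpos[of a 0] by (simp add: ln_mult order_less_imp_not_eq2)
  finally have "Z a a \<le> Z 0 a * Z a 0 * exp (B * a)"
    using Zpos by (subst (asm) ln_le_cancel_iff) auto
  then show ?thesis by (simp add: Z_def B_def power2_eq_square mult_ac)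
qed

section \<open>The mean-field equation\<close>

lemma tanh_slope_less:
  fixes u :: real assumes u: "u > 0" shows "u * (1 - (tanh u)\<^sup>2) < tanh u"
proof -
  define f where "f x = tanh x - x * (1 - (tanh x)\<^sup>2)" for x :: real
  have d: "(f has_real_derivative 2 * x * tanh x * (1 - (tanh x)\<^sup>2)) (at x)" for x
    unfolding f_def
    by (auto intro!: derivative_eq_intros simp: power2_eq_square algebra_simps)
  have "f 0 < f u"
  proof (rule DERIV_pos_imp_increasing_open[OF u])
    fix x assume "0 < x" "x < u"
    then have "2 * x * tanh x * (1 - (tanh x)\<^sup>2) > 0"
      using tanh_sq_less_1[of x] by simp
    then show "\<exists>y. (f has_real_derivative y) (at x) \<and> y > 0" using d by blast
  next
    show "continuous_on {0..u} f" by (intro continuous_at_imp_continuous_on ballI DERIV_isCont[OF d])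
  qed
  then show ?thesis by (simp add: f_def)
qed

text \<open>This yields uniqueness of the positive solution of the mean-field equation, and the side
  of the chord on which tanh lies before and after it.\<close>

lemma tanh_div_strict_decreasing:
  fixes u v :: real assumes "0 < u" "u < v" shows "tanh v / v < tanh u / u"
proof (rule DERIV_neg_imp_decreasing[OF assms(2), where f = "\<lambda>x. tanh x / x"])
  fix x assume "u \<le> x" "x \<le> v"
  then have x: "x > 0" using assms by simp
  have "((\<lambda>x. tanh x / x) has_real_derivative ((1 - (tanh x)\<^sup>2) * x - tanh x * 1) / (x * x)) (at x)"
    using x by (auto intro!: derivative_eq_intros)
  moreover have "((1 - (tanh x)\<^sup>2) * x - tanh x * 1) / (x * x) < 0"
    using tanh_slope_less[OF x] x by (intro divide_neg_pos) (auto simp: mult.commute)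
  ultimately show "\<exists>y. ((\<lambda>x. tanh x / x) has_real_derivative y) (at x) \<and> y < 0" by blast
qed

lemma tanh_lipschitz_above:
  fixes v a b :: real
  assumes v: "0 \<le> v" "v \<le> a" "v \<le> b"
  shows "\<bar>tanh a - tanh b\<bar> \<le> (1 - (tanh v)\<^sup>2) * \<bar>a - b\<bar>"
proof -
  define L where "L = 1 - (tanh v)\<^sup>2"
  have *: "tanh b - tanh a \<le> L * (b - a)" if ab: "a \<le> b" "v \<le> a" for a b :: real
  proof -
    have "tanh b - L * b \<le> tanh a - L * a"
    proof (rule DERIV_nonpos_imp_nonincreasing[OF ab(1), where f = "\<lambda>x. tanh x - L * x"])
      fix x assume "a \<le> x" "x \<le> b"
      then have "(tanh v)\<^sup>2 \<le> (tanh x)\<^sup>2" using v ab by (intro tanh_sq_mono) auto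
      moreover have "((\<lambda>x. tanh x - L * x) has_real_derivative (1 - (tanh x)\<^sup>2) - L) (at x)"
        by (auto intro!: derivative_eq_intros)
      ultimately show "\<exists>y. ((\<lambda>x. tanh x - L * x) has_real_derivative y) (at x) \<and> y \<le> 0"
        by (intro exI[of _ "(1 - (tanh x)\<^sup>2) - L"]) (simp add: L_def)
    qed
    then show ?thesis by (simp add: algebra_simps)
  qed
  show ?thesis
  proof (cases "a \<le> b")
    case True
    then have "tanh a \<le> tanh b" by simp
    then show ?thesis using *[OF True v(2)] True by (simp add: L_def)
  next
    case False
    then have "tanh b \<le> tanh a" by simp
    then show ?thesis using *[of b a] v(3) False by (simp add: L_def)
  qed
qed

text \<open>Here \<open>r\<close> is the spontaneous magnetisation: if both endpoints of an edge
  have rescaled degree \<open>r\<close>, the field on the edge is 2 \<theta> r and its mean is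
  \<open>r\<close> again.\<close>

locale low_temperature =
  fixes \<theta> r :: real
  assumes \<theta>: "\<theta> > 1/2" and r: "0 < r" "r < 1" and fix_r: "tanh (2 * \<theta> * r) = r"

lemma low_temperature_exists:
  assumes "\<theta> > 1/2" shows "\<exists>r. low_temperature \<theta> r"
proof -
  define f where "f x = tanh (2 * \<theta> * x) - x" for x :: real
  have d: "(f has_real_derivative (1 - (tanh (2 * \<theta> * x))\<^sup>2) * (2 * \<theta>) - 1) (at x)" for x
    unfolding f_def by (auto intro!: derivative_eq_intros DERIV_chain2[OF has_real_derivative_tanh])
  have "(f has_real_derivative 2 * \<theta> - 1) (at 0)" using d[of 0] by simp
  from DERIV_pos_inc_right[OF this] assms obtain h where h: "h > 0" "\<And>x. 0 < x \<Longrightarrow> x < h \<Longrightarrow> f 0 < f (0 + x)"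
    by auto
  define x0 where "x0 = min (h / 2) (1 / 2)"
  have x0: "0 < x0" "x0 < 1" "f x0 > 0" using h(1) h(2)[of x0] by (auto simp: x0_def f_def)
  have "f 1 < 0" using tanh_real_lt_1 by (simp add: f_def)
  moreover have "continuous_on {x0..1} f" by (intro continuous_at_imp_continuous_on ballI DERIV_isCont[OF d])
  ultimately obtain x where x: "x0 \<le> x" "x \<le> 1" "f x = 0"
    using IVT2'[of f 1 0 x0] x0 by auto
  then have "x \<noteq> 1" using \<open>f 1 < 0\<close> by auto
  then have "low_temperature \<theta> x" using x x0 assms by unfold_locales (auto simp: f_def)
  then show ?thesis by blast
qed

context low_temperature
begin

text \<open>The derivative of the mean-field map at \<open>r\<close>. The fixed point is stable
  although the slope at 0 is 2 \<theta> > 1; this is the source of the contraction.\<close>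

lemma slope_less_1: "2 * \<theta> * (1 - r\<^sup>2) < 1"
proof -
  have "2 * \<theta> * r * (1 - r\<^sup>2) < r"
    using tanh_slope_less[of "2 * \<theta> * r"] \<theta> r fix_r by simp
  then have "r * (2 * \<theta> * (1 - r\<^sup>2)) < r * 1" by (simp add: mult_ac)
  then show ?thesis using r by simp
qed

lemma tanh_above_chord:
  assumes "0 < v" "v < 2 * r" shows "v / 2 < tanh (\<theta> * v)"
  using tanh_div_strict_decreasing[of "\<theta> * v" "2 * \<theta> * r"] assms \<theta> r fix_r
  by (simp add: field_simps)

lemma tanh_below_chord:
  assumes "2 * r < v" shows "tanh (\<theta> * v) < v / 2"
  using tanh_div_strict_decreasing[of "2 * \<theta> * r" "\<theta> * v"] assms \<theta> r fix_r
  by (simp add: field_simps)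

text \<open>A vertex whose neighbours nearly all have rescaled degree \<open>r\<close> must nearly
  solve x = tanh (\<theta> (x + r)), its own degree being part of the field. The inequality says
  quantitatively that \<open>r\<close> is the only solution in [-1, 1].\<close>

lemma mean_field_gap:
  assumes x: "\<bar>x\<bar> \<le> 1"
  shows "r / 4 * \<bar>x - r\<bar> \<le> \<bar>x - tanh (\<theta> * (x + r))\<bar>"
proof -
  have half: "r / 4 * y \<le> y / 2" if "y \<ge> 0" for y
    using mult_right_mono[of r 1 y] r that by simp
  consider "r < x" | "x = r" | "- r < x" "x < r" | "x \<le> - r" by linarith
  then show ?thesis
  proof cases
    case 1
    then have "tanh (\<theta> * (x + r)) < (x + r) / 2" by (intro tanh_below_chord) auto
    then show ?thesis using half[of "x - r"] 1 by auto
  next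
    case 2
    then show ?thesis by simp
  next
    case 3
    then have "(x + r) / 2 < tanh (\<theta> * (x + r))" by (intro tanh_above_chord) auto
    then show ?thesis using half[of "r - x"] 3 by auto
  next
    \<comment> \<open>Here x + r is nonpositive and the chord comparison is silent. A strongly
      negative vertex could sustain itself only if \<theta> (1 - r) were large, and stability of
      \<open>r\<close> bounds it by 1/2.\<close>
    case 4
    have "\<theta> * (1 - r) * 1 \<le> \<theta> * (1 - r) * (1 + r)" using \<theta> r by (intro mult_left_mono) auto
    also have "\<dots> < 1 / 2" using slope_less_1 by (simp add: power2_eq_square algebra_simps)
    finally have c: "\<theta> * (1 - r) < 1 / 2" by simp
    have "r * (- x) \<le> r * 1" using x r by (intro mult_left_mono) auto
    then have "- x - r \<le> (1 - r) * (- x)" by (simp add: algebra_simps)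
    then have "\<theta> * (- x - r) \<le> \<theta> * ((1 - r) * (- x))" using \<theta> by (intro mult_left_mono) auto
    also have "\<dots> \<le> 1 / 2 * (- x)"
      unfolding mult.assoc[symmetric] using c 4 r by (intro mult_right_mono) auto
    finally have "- x / 2 \<le> \<theta> * (x + r) - x" by (simp add: algebra_simps)
    moreover have "\<theta> * (x + r) \<le> tanh (\<theta> * (x + r))"
    proof -
      have "\<theta> * (x + r) \<le> 0" using 4 \<theta> by (intro mult_nonneg_nonpos) auto
      moreover from this have "tanh (\<theta> * (x + r)) \<le> 0" by (simp only: tanh_real_nonpos_iff)
      ultimately show ?thesis using tanh_lipschitz_1[of "\<theta> * (x + r)" 0] by simp
    qed
    moreover have "r / 4 * \<bar>x - r\<bar> \<le> r / 4 * 2" using x r by (intro mult_left_mono) auto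
    ultimately have "r / 4 * \<bar>x - r\<bar> \<le> r / 2" "r / 2 \<le> tanh (\<theta> * (x + r)) - x"
      using 4 by linarith+
    then show ?thesis by linarith
  qed
qed

text \<open>Uniform control of every degree, not of an average: the surrogate energy is truncated
  vertex by vertex and agrees with the model only if no degree leaves the window.\<close>

definition window :: "nat \<Rightarrow> real \<Rightarrow> config \<Rightarrow> bool" where
  "window n \<epsilon> Y \<longleftrightarrow> (\<forall>i\<in>{1..n}. \<bar>degree n Y i - (real n - 1) * r\<bar> \<le> \<epsilon> * (real n - 1))"

abbreviation no_phase :: "nat \<Rightarrow> real \<Rightarrow> config \<Rightarrow> bool" where
  "no_phase n \<epsilon> Y \<equiv> \<not> window n \<epsilon> Y \<and> \<not> window n \<epsilon> (\<lambda>i j. - Y i j)"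

end

section \<open>A high-temperature surrogate inside the plus phase\<close>

text \<open>The square in the energy is replaced by its linear extension beyond a window around the
  magnetisation. Weights inside the window do not change, and the mean-field slope is below 1 everywhere,
  so that the surrogate satisfies Dobrushin's condition.\<close>

definition huber :: "real \<Rightarrow> real \<Rightarrow> real \<Rightarrow> real" where
  "huber lo hi y = y\<^sup>2 - (max 0 (y - hi))\<^sup>2 - (max 0 (lo - y))\<^sup>2"

definition clip :: "real \<Rightarrow> real \<Rightarrow> real \<Rightarrow> real" where
  "clip lo hi y = max lo (min hi y)"

lemma has_real_derivative_pos_part_sq:
  "((\<lambda>x. (max 0 x)\<^sup>2) has_real_derivative 2 * max 0 x) (at (x::real))"
proof -
  consider "x > 0" | "x < 0" | "x = 0" by linarith
  then show ?thesis
  proof cases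
    case 1
    have "((\<lambda>x. x\<^sup>2) has_real_derivative 2 * x) (at x)" by (auto intro!: derivative_eq_intros)
    from has_field_derivative_transform_within_open[OF this open_greaterThan[of 0]] 1 show ?thesis by simp
  next
    case 2
    have "((\<lambda>x. 0) has_real_derivative 0) (at x)" by simp
    from has_field_derivative_transform_within_open[OF this open_lessThan[of 0], of "\<lambda>x. (max 0 x)\<^sup>2"] 2
    show ?thesis by simp
  next
    case 3
    have "isCont (\<lambda>z::real. max 0 z) 0" by (intro continuous_intros)
    moreover have "(max 0 z)\<^sup>2 = max 0 z * z" for z :: real
      by (auto simp: max_def power2_eq_square)
    ultimately show ?thesis unfolding 3
      by (subst CARAT_DERIV) (intro exI[of _ "\<lambda>z. max 0 z"], simp)
  qed
qed

lemma has_real_derivative_huber: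
  assumes "lo \<le> hi"
  shows "(huber lo hi has_real_derivative 2 * clip lo hi y) (at y)"
proof -
  have "(huber lo hi has_real_derivative
      2 * y - 2 * max 0 (y - hi) * 1 - 2 * max 0 (lo - y) * (- 1)) (at y)"
    unfolding huber_def[abs_def]
    by (intro DERIV_diff DERIV_chain2[OF has_real_derivative_pos_part_sq])
       (auto intro!: derivative_eq_intros)
  moreover have "2 * y - 2 * max 0 (y - hi) * 1 - 2 * max 0 (lo - y) * (- 1) = 2 * clip lo hi y"
    using assms by (auto simp: clip_def max_def min_def)
  ultimately show ?thesis by simp
qed

lemma huber_eq_square: "lo \<le> y \<Longrightarrow> y \<le> hi \<Longrightarrow> huber lo hi y = y\<^sup>2"
  by (simp add: huber_def)

text \<open>A symmetric difference quotient rather than a derivative, because flipping an edge moves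
  a rescaled degree by 2/N. The normalization makes it the identity where \<open>huber\<close> is
  the square.\<close>

definition huber_slope :: "real \<Rightarrow> real \<Rightarrow> real \<Rightarrow> real \<Rightarrow> real" where
  "huber_slope N lo hi y = N / 4 * (huber lo hi (y + 1 / N) - huber lo hi (y - 1 / N))"

lemma huber_slope_bounds:
  assumes "lo \<le> hi" "N > 0"
  shows "lo \<le> huber_slope N lo hi y" "huber_slope N lo hi y \<le> hi"
proof -
  have "y - 1 / N < y + 1 / N" using assms by simp
  from MVT2[OF this has_real_derivative_huber[OF assms(1)]]
  obtain z where "huber lo hi (y + 1 / N) - huber lo hi (y - 1 / N) = (y + 1 / N - (y - 1 / N)) * (2 * clip lo hi z)"
    by blast
  then have "huber_slope N lo hi y = clip lo hi z"
    using assms by (simp add: huber_slope_def)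
  then show "lo \<le> huber_slope N lo hi y" "huber_slope N lo hi y \<le> hi"
    using assms by (auto simp: clip_def)
qed

lemma huber_slope_lipschitz:
  assumes "lo \<le> hi" "N > 0"
  shows "\<bar>huber_slope N lo hi x - huber_slope N lo hi y\<bar> \<le> \<bar>x - y\<bar>"
proof -
  have *: "\<bar>huber_slope N lo hi b - huber_slope N lo hi a\<bar> \<le> b - a" if "a < b" for a b
  proof -
    define D where "D z = N / 4 * (2 * clip lo hi (z + 1 / N) - 2 * clip lo hi (z - 1 / N))" for z
    have "(huber_slope N lo hi has_real_derivative D z) (at z)" for z
      unfolding huber_slope_def[abs_def] D_def
      by (auto intro!: derivative_eq_intros DERIV_chain2[OF has_real_derivative_huber[OF assms(1)]])
    from MVT2[OF that this] obtain z where
      z: "huber_slope N lo hi b - huber_slope N lo hi a = (b - a) * D z" by blast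
    have "\<bar>clip lo hi (z + h) - clip lo hi (z - h)\<bar> \<le> 2 * h" if "h \<ge> 0" for h
      using assms(1) that by (auto simp: clip_def max_def min_def)
    from this[of "1 / N"] have "\<bar>clip lo hi (z + 1 / N) - clip lo hi (z - 1 / N)\<bar> \<le> 2 / N"
      using assms(2) by simp
    then have "N / 2 * \<bar>clip lo hi (z + 1 / N) - clip lo hi (z - 1 / N)\<bar> \<le> N / 2 * (2 / N)"
      using assms by (intro mult_left_mono) auto
    moreover have "N / 4 * (2 * p - 2 * q) = N / 2 * (p - q)" for p q by (simp add: right_diff_distrib)
    then have D: "D z = N / 2 * (clip lo hi (z + 1 / N) - clip lo hi (z - 1 / N))" by (simp only: D_def)
    ultimately have "\<bar>D z\<bar> \<le> 1" unfolding D using assms(2) by (simp add: abs_mult)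
    then show ?thesis unfolding z abs_mult using that mult_left_mono[of "\<bar>D z\<bar>" 1 "b - a"] by simp
  qed
  show ?thesis using *[of x y] *[of y x] by (cases x y rule: linorder_cases) auto
qed

context low_temperature
begin

definition surrogate :: "nat \<Rightarrow> real \<Rightarrow> nat \<Rightarrow> real \<Rightarrow> real" where
  "surrogate n \<epsilon> i x =
     \<theta> * (real n - 1) / 2 * huber (r - \<epsilon>) (r + \<epsilon>) (x / (real n - 1)) - \<theta> / 2"

text \<open>The mean-field slope at the smallest field the surrogate can exert on an edge, 2
  \<theta> (r - \<epsilon>). The slope of tanh decreases on the positive axis, so this is the worst
  case.\<close>

definition contraction :: "real \<Rightarrow> real" where
  "contraction \<epsilon> = 2 * \<theta> * (1 - (tanh (2 * \<theta> * (r - \<epsilon>)))\<^sup>2)"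

lemma contraction_exists: "\<exists>\<epsilon>>0. \<epsilon> < r \<and> contraction \<epsilon> < 1"
proof -
  have "isCont contraction 0"
    unfolding contraction_def[abs_def] by (intro continuous_intros) (simp add: cosh_real_nonzero)
  then have "(contraction \<longlongrightarrow> contraction 0) (at_right 0)"
    by (simp add: isCont_def filterlim_at_split)
  moreover have "contraction 0 < 1" using slope_less_1 fix_r by (simp add: contraction_def)
  ultimately have "\<forall>\<^sub>F \<epsilon> in at_right 0. contraction \<epsilon> < 1" by (rule order_tendstoD)
  moreover have "\<forall>\<^sub>F \<epsilon> in at_right 0. 0 < \<epsilon> \<and> \<epsilon> < r"
    using r(1) by (rule eventually_at_right_real[THEN eventually_mono]) auto
  ultimately have "\<forall>\<^sub>F \<epsilon> in at_right 0. contraction \<epsilon> < 1 \<and> 0 < \<epsilon> \<and> \<epsilon> < r"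
    by eventually_elim auto
  from eventually_happens[OF this] show ?thesis by auto
qed

lemma contraction_nonneg: "0 \<le> contraction \<epsilon>"
  using \<theta> tanh_sq_less_1[of "2 * \<theta> * (r - \<epsilon>)"] by (simp add: contraction_def)

lemma drive_surrogate:
  assumes "n \<ge> 2"
  shows "drive (surrogate n \<epsilon>) i x = \<theta> * huber_slope (real n - 1) (r - \<epsilon>) (r + \<epsilon>) (x / (real n - 1))"
  using assms by (simp add: drive_def surrogate_def huber_slope_def add_divide_distrib diff_divide_distrib algebra_simps)

text \<open>Truncation keeps both endpoint slopes at least r - \<epsilon>, so all fields lie where
  tanh is flat enough. A nonnegative extra field \<open>h\<close> only moves them further out; hence
  the bound is uniform over positive planted effects.\<close>

lemma surrogate_args:
  assumes n: "n \<ge> 2" and \<epsilon>: "0 \<le> \<epsilon>" "\<epsilon> < r" and h: "0 \<le> h" and h': "0 \<le> h'"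
  shows "\<bar>tanh (drive (surrogate n \<epsilon>) i x + drive (surrogate n \<epsilon>) j y + h)
      - tanh (drive (surrogate n \<epsilon>) i' x' + drive (surrogate n \<epsilon>) j' y' + h)\<bar>
    \<le> contraction \<epsilon> / 2 * (\<bar>x - x'\<bar> / (real n - 1) + \<bar>y - y'\<bar> / (real n - 1))"
proof -
  define N where "N = real n - 1"
  have N: "N > 0" using n by (simp add: N_def)
  define c where "c x = huber_slope N (r - \<epsilon>) (r + \<epsilon>) (x / N)" for x
  have lo: "r - \<epsilon> \<le> c x" for x unfolding c_def using \<epsilon> N by (intro huber_slope_bounds) auto
  have lip: "\<bar>c x - c y\<bar> \<le> \<bar>x - y\<bar> / N" for x y
    using huber_slope_lipschitz[of "r - \<epsilon>" "r + \<epsilon>" N "x / N" "y / N"] \<epsilon> N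
    by (simp add: c_def abs_divide flip: diff_divide_distrib)
  have v: "2 * \<theta> * (r - \<epsilon>) \<le> \<theta> * c x + \<theta> * c y + h" for x y
    using mult_left_mono[OF lo, of \<theta> x] mult_left_mono[OF lo, of \<theta> y] \<theta> h by (simp add: algebra_simps)
  have v0: "0 \<le> 2 * \<theta> * (r - \<epsilon>)" using \<theta> \<epsilon> by simp
  have "\<bar>tanh (\<theta> * c x + \<theta> * c y + h) - tanh (\<theta> * c x' + \<theta> * c y' + h)\<bar>
      \<le> (1 - (tanh (2 * \<theta> * (r - \<epsilon>)))\<^sup>2) * \<bar>\<theta> * c x + \<theta> * c y + h - (\<theta> * c x' + \<theta> * c y' + h)\<bar>"
    by (rule tanh_lipschitz_above[OF v0 v v])
  also have "\<theta> * c x + \<theta> * c y + h - (\<theta> * c x' + \<theta> * c y' + h) = \<theta> * ((c x - c x') + (c y - c y'))"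
    by (simp add: algebra_simps)
  also have "(1 - (tanh (2 * \<theta> * (r - \<epsilon>)))\<^sup>2) * \<bar>\<theta> * ((c x - c x') + (c y - c y'))\<bar>
      = contraction \<epsilon> / 2 * \<bar>(c x - c x') + (c y - c y')\<bar>"
    using \<theta> by (simp add: abs_mult contraction_def)
  also have "\<dots> \<le> contraction \<epsilon> / 2 * (\<bar>x - x'\<bar> / N + \<bar>y - y'\<bar> / N)"
    using lip[of x x'] lip[of y y'] contraction_nonneg[of \<epsilon>] by (intro mult_left_mono) auto
  finally show ?thesis unfolding drive_surrogate[OF n] c_def N_def by simp
qed

lemma tanh_lipschitz_surrogate:
  assumes n: "n \<ge> 2" and \<epsilon>: "0 \<le> \<epsilon>" "\<epsilon> < r" and u: "0 \<le> u"
  shows "tanh_lipschitz n (add_field (surrogate n \<epsilon>) u S) (contraction \<epsilon> / (2 * (real n - 1)))"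
  unfolding tanh_lipschitz_def drive_add_field
proof (intro ballI allI)
  fix i j and x y x' y' :: real
  define h where "h = u * of_bool (i \<in> S) + u * (of_bool (j \<in> S) :: real)"
  have h: "0 \<le> h" using u by (simp add: h_def)
  have "\<bar>tanh (drive (surrogate n \<epsilon>) i x + drive (surrogate n \<epsilon>) j y + h)
      - tanh (drive (surrogate n \<epsilon>) i x' + drive (surrogate n \<epsilon>) j y' + h)\<bar>
      \<le> contraction \<epsilon> / 2 * (\<bar>x - x'\<bar> / (real n - 1) + \<bar>y - y'\<bar> / (real n - 1))"
    by (rule surrogate_args[OF n \<epsilon> h h])
  also have "\<dots> = contraction \<epsilon> / (2 * (real n - 1)) * (\<bar>x - x'\<bar> + \<bar>y - y'\<bar>)"
    unfolding add_divide_distrib[symmetric] by simp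
  finally show "\<bar>tanh (drive (surrogate n \<epsilon>) i x + u * of_bool (i \<in> S) + (drive (surrogate n \<epsilon>) j y + u * of_bool (j \<in> S)))
      - tanh (drive (surrogate n \<epsilon>) i x' + u * of_bool (i \<in> S) + (drive (surrogate n \<epsilon>) j y' + u * of_bool (j \<in> S)))\<bar>
      \<le> contraction \<epsilon> / (2 * (real n - 1)) * (\<bar>x - x'\<bar> + \<bar>y - y'\<bar>)"
    by (simp add: h_def algebra_simps)
qed

lemma surrogate_eq_two_star:
  assumes n: "n \<ge> 2" and w: "window n \<epsilon> Y"
  shows "degree_energy n (surrogate n \<epsilon>) Y = null_weight n \<theta> Y"
  unfolding log_weight_degree_energy degree_energy_def
proof (rule sum.cong[OF refl])
  fix i assume i: "i \<in> {1..n}"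
  define N where "N = real n - 1"
  have N: "N > 0" using n by (simp add: N_def)
  define k where "k = degree n Y i"
  have "\<bar>k - N * r\<bar> \<le> \<epsilon> * N" using w i by (simp add: window_def N_def k_def)
  then have "huber (r - \<epsilon>) (r + \<epsilon>) (k / N) = (k / N)\<^sup>2"
    using N by (intro huber_eq_square; subst pos_le_divide_eq pos_divide_le_eq) (auto simp: abs_le_iff algebra_simps)
  then show "surrogate n \<epsilon> i (degree n Y i) = two_star n \<theta> (\<lambda>_. 0) i (degree n Y i)"
    using N unfolding surrogate_def two_star_def N_def[symmetric] k_def[symmetric]
    by (simp add: power2_eq_square field_simps)
qed

lemma huber_slope_centre:
  assumes "N > 0" "1 / N \<le> \<epsilon>"
  shows "huber_slope N (r - \<epsilon>) (r + \<epsilon>) r = r"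
proof -
  have "0 < 1 / N" using assms by simp
  then show ?thesis unfolding huber_slope_def using assms
    by (subst (1 2) huber_eq_square) (auto simp: power2_eq_square field_simps)
qed

text \<open>A self-consistent bound on the largest deviation \<open>D\<close>: a degree deviates by
  its centred sum plus the deviations of the conditional means, and the latter total at most
  \<kappa> (D + 1). The extra 1 comes from leaving out the edge itself and is absorbed by
  \<open>large\<close>.\<close>

lemma surrogate_window:
  assumes n: "n \<ge> 2" and \<epsilon>: "0 < \<epsilon>" "\<epsilon> < r" and l: "contraction \<epsilon> < 1"
    and large: "2 \<le> (1 - contraction \<epsilon>) * \<epsilon> * (real n - 1)"
    and Y: "Y \<in> configs n"
    and S: "\<And>i. i \<in> {1..n} \<Longrightarrow> \<bar>centred_sum (degree_energy n (surrogate n \<epsilon>)) (edges_at n i) Y\<bar>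
      \<le> (1 - contraction \<epsilon>) * \<epsilon> * (real n - 1) / 2"
  shows "window n \<epsilon> Y"
proof -
  define N where "N = real n - 1"
  define \<kappa> where "\<kappa> = contraction \<epsilon>"
  have N: "N \<ge> 1" using n by (simp add: N_def)
  have \<kappa>: "0 \<le> \<kappa>" "\<kappa> < 1" using l contraction_nonneg by (auto simp: \<kappa>_def)
  have "(1 - \<kappa>) * \<epsilon> \<le> 1 * \<epsilon>" using \<kappa> \<epsilon> by (intro mult_right_mono) auto
  then have "(1 - \<kappa>) * \<epsilon> * N \<le> \<epsilon> * N" using N by (intro mult_right_mono) auto
  then have "1 / N \<le> \<epsilon>" using large N by (simp add: \<kappa>_def N_def[symmetric] field_simps)
  then have centre: "huber_slope N (r - \<epsilon>) (r + \<epsilon>) r = r" using N by (intro huber_slope_centre) auto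
  let ?f = "\<lambda>i. \<bar>degree n Y i - N * r\<bar>"
  define D where "D = Max (?f ` {1..n})"
  have fin: "finite (?f ` {1..n})" "?f ` {1..n} \<noteq> {}" using n by auto
  have D: "?f i \<le> D" if "i \<in> {1..n}" for i unfolding D_def using that by (intro Max_ge fin) auto
  obtain i where i: "i \<in> {1..n}" "?f i = D" using Max_in[OF fin] unfolding D_def by auto
  have m: "\<bar>local_mean (degree_energy n (surrogate n \<epsilon>)) e Y - r\<bar> \<le> \<kappa> * ((D + 1) / N)"
    if e: "e \<in> edges n" for e
  proof -
    note E = edgesD[OF e]
    have k: "\<bar>degree n Y j - at_edge Y e - N * r\<bar> \<le> D + 1" if "j \<in> {1..n}" for j
      using D[OF that] abs_at_edge[OF Y e] by linarith
    have tr: "r = tanh (drive (surrogate n \<epsilon>) (fst e) (N * r) + drive (surrogate n \<epsilon>) (snd e) (N * r) + 0)"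
      unfolding drive_surrogate[OF n] N_def[symmetric] using centre N fix_r by (simp add: mult.assoc)
    have "\<bar>local_mean (degree_energy n (surrogate n \<epsilon>)) e Y - r\<bar>
        \<le> \<kappa> / 2 * (\<bar>degree n Y (fst e) - at_edge Y e - N * r\<bar> / N + \<bar>degree n Y (snd e) - at_edge Y e - N * r\<bar> / N)"
      unfolding local_mean_degree_energy[OF Y e] \<kappa>_def N_def[symmetric]
      using surrogate_args[OF n less_imp_le[OF \<epsilon>(1)] \<epsilon>(2) order_refl order_refl,
          of "fst e" _ "snd e" _ "fst e" "N * r" "snd e" "N * r", folded tr N_def] by simp
    also have "\<dots> \<le> \<kappa> / 2 * ((D + 1) / N + (D + 1) / N)"
      using k[OF E(1)] k[OF E(2)] \<kappa> N by (intro mult_left_mono add_mono divide_right_mono) auto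
    also have "a / 2 * (w + w) = a * w" for a w :: real by simp
    finally show ?thesis .
  qed
  have "degree n Y i - N * r = (\<Sum>e\<in>edges_at n i. at_edge Y e - r)"
    using card_edges_at[OF i(1)] by (simp add: degree_edges[OF Y i(1)] sum_subtractf N_def)
  also have "\<dots> = centred_sum (degree_energy n (surrogate n \<epsilon>)) (edges_at n i) Y
      + (\<Sum>e\<in>edges_at n i. local_mean (degree_energy n (surrogate n \<epsilon>)) e Y - r)"
    by (simp add: centred_sum_def flip: sum.distrib)
  finally have "D \<le> \<bar>centred_sum (degree_energy n (surrogate n \<epsilon>)) (edges_at n i) Y\<bar>
      + (\<Sum>e\<in>edges_at n i. \<bar>local_mean (degree_energy n (surrogate n \<epsilon>)) e Y - r\<bar>)"
    unfolding i(2)[symmetric] by (simp only:) (intro order_trans[OF abs_triangle_ineq] add_left_mono sum_abs)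
  also have "\<dots> \<le> (1 - \<kappa>) * \<epsilon> * N / 2 + (\<Sum>e\<in>edges_at n i. \<kappa> * ((D + 1) / N))"
    using S[OF i(1)] edges_at_subset by (intro add_mono sum_mono m) (auto simp: \<kappa>_def N_def)
  also have "(\<Sum>e\<in>edges_at n i. \<kappa> * ((D + 1) / N)) = \<kappa> * (D + 1)"
    using N by (simp add: card_edges_at[OF i(1)] N_def[symmetric])
  finally have "(1 - \<kappa>) * D \<le> (1 - \<kappa>) * \<epsilon> * N / 2 + \<kappa>" by (simp add: algebra_simps)
  also have "\<dots> \<le> (1 - \<kappa>) * (\<epsilon> * N)" using large \<kappa> unfolding \<kappa>_def[symmetric] N_def[symmetric] by (simp add: mult.assoc)
  finally have "D \<le> \<epsilon> * N" using \<kappa> by simp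
  then show ?thesis unfolding window_def N_def[symmetric] using D by force
qed

lemma surrogate_window_prob:
  assumes n: "n \<ge> 2" and \<epsilon>: "0 < \<epsilon>" "\<epsilon> < r" and l: "contraction \<epsilon> < 1"
    and large: "2 \<le> (1 - contraction \<epsilon>) * \<epsilon> * (real n - 1)"
  shows "gibbs_mean n (degree_energy n (surrogate n \<epsilon>)) (\<lambda>Y. of_bool (\<not> window n \<epsilon> Y))
    \<le> 2 * real n * exp (- ((1 - contraction \<epsilon>) * \<epsilon> * (real n - 1) / 2)\<^sup>2 / (8 * (1 + 2 * \<theta>) * real n))"
proof -
  let ?H = "degree_energy n (surrogate n \<epsilon>)"
  define x where "x = (1 - contraction \<epsilon>) * \<epsilon> * (real n - 1) / 2"
  have x: "0 \<le> x" using large by (simp add: x_def)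
  have add0: "add_field (surrogate n \<epsilon>) 0 {} = surrogate n \<epsilon>" by (simp add: add_field_def fun_eq_iff)
  have lip: "tanh_lipschitz n (surrogate n \<epsilon>) (contraction \<epsilon> / (2 * (real n - 1)))"
    using tanh_lipschitz_surrogate[OF n less_imp_le[OF \<epsilon>(1)] \<epsilon>(2), of 0 "{}"] add0 by simp
  have \<gamma>: "0 \<le> contraction \<epsilon> / (2 * (real n - 1))" "contraction \<epsilon> / (2 * (real n - 1)) * (real n - 1) \<le> \<theta>"
  proof -
    have half: "c / (2 * N) * N = c / 2" if "N > 0" for c N :: real using that by simp
    show "0 \<le> contraction \<epsilon> / (2 * (real n - 1))" using contraction_nonneg[of \<epsilon>] n by simp
    have "contraction \<epsilon> / (2 * (real n - 1)) * (real n - 1) = contraction \<epsilon> / 2"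
      by (rule half) (use n in simp)
    then show "contraction \<epsilon> / (2 * (real n - 1)) * (real n - 1) \<le> \<theta>" using l \<theta> by linarith
  qed
  have "gibbs_mean n ?H (\<lambda>Y. of_bool (\<not> window n \<epsilon> Y))
      \<le> gibbs_mean n ?H (\<lambda>Y. of_bool (\<exists>i\<in>{1..n}. x < \<bar>centred_sum ?H (edges_at n i) Y\<bar>))"
  proof (rule gibbs_mean_mono)
    fix Y assume "Y \<in> configs n"
    from surrogate_window[OF n \<epsilon> l large this]
    have "\<exists>i\<in>{1..n}. x < \<bar>centred_sum ?H (edges_at n i) Y\<bar>" if "\<not> window n \<epsilon> Y"
      using that unfolding x_def by (meson linorder_not_less)
    then show "(of_bool (\<not> window n \<epsilon> Y) :: real)
        \<le> of_bool (\<exists>i\<in>{1..n}. x < \<bar>centred_sum ?H (edges_at n i) Y\<bar>)" by simp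
  qed
  also have "\<dots> \<le> 2 * real n * exp (- x\<^sup>2 / (8 * (1 + 2 * \<theta>) * real n))"
    using \<theta> n by (intro some_vertex_sum_large[OF lip \<gamma> _ _ x]) auto
  finally show ?thesis by (simp only: x_def)
qed

end

section \<open>The null distribution concentrates on two phases\<close>

text \<open>Edges are independent under the uniform measure, so an exponential of a linear form
  factorises.\<close>

lemma sum_exp_edges:
  assumes "D \<subseteq> edges n"
  shows "(\<Sum>Y\<in>configs n. exp (\<Sum>e\<in>D. c e * at_edge Y e)) = real (card (configs n)) * (\<Prod>e\<in>D. cosh (c e))"
proof -
  have "finite D" by (rule finite_subset[OF assms]) simp
  then show ?thesis using assms
  proof (induction D rule: finite_induct)
    case empty
    show ?case by simp
  next
    case (insert e D)
    then have e: "e \<in> edges n" and De: "D \<subseteq> edges n" by auto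
    have same: "(\<Sum>f\<in>D. c f * at_edge (set_edge e v Y) f) = (\<Sum>f\<in>D. c f * at_edge Y f)" for v Y
    proof (intro sum.cong refl)
      fix f assume f: "f \<in> D"
      then have "f \<noteq> e" using insert.hyps by blast
      then show "c f * at_edge (set_edge e v Y) f = c f * at_edge Y f"
        using f De by (simp add: at_edge_set_edge[OF e] subsetD)
    qed
    have "(\<Sum>Y\<in>configs n. exp (\<Sum>e\<in>insert e D. c e * at_edge Y e))
        = (\<Sum>Y\<in>configs n. exp (c e * at_edge Y e) * exp (\<Sum>f\<in>D. c f * at_edge Y f))"
      using insert.hyps by (simp add: exp_add)
    also have "\<dots> = (\<Sum>Y\<in>configs n. cosh (c e) * exp (\<Sum>f\<in>D. c f * at_edge Y f))"
      by (subst sum_set_edge[OF e])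
        (simp add: same at_edge_set_edge[OF e e] cosh_field_def algebra_simps add_divide_distrib)
    also have "\<dots> = cosh (c e) * (\<Sum>Y\<in>configs n. exp (\<Sum>f\<in>D. c f * at_edge Y f))"
      by (simp add: sum_distrib_left)
    also have "\<dots> = cosh (c e) * (real (card (configs n)) * (\<Prod>f\<in>D. cosh (c f)))"
      using insert.IH[OF De] by simp
    finally show ?case using insert.hyps by simp
  qed
qed

text \<open>Expansion of the quadratic energy about an arbitrary profile \<open>y\<close>: a linear
  form in the edges, a constant, and a nonnegative square. Dropping the square bounds the weight
  from below; on configurations whose rescaled degrees equal \<open>y\<close> the square vanishes
  and the expansion is exact.\<close>

lemma log_weight_tangent:
  assumes Y: "Y \<in> configs n" and n: "n \<ge> 2"
  shows "null_weight n \<theta> Y = - \<theta> * real n / 2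
    + (\<Sum>e\<in>edges n. \<theta> * (y (fst e) + y (snd e)) * at_edge Y e)
    - (\<Sum>e\<in>edges n. \<theta> / 2 * ((y (fst e))\<^sup>2 + (y (snd e))\<^sup>2))
    + \<theta> / (2 * (real n - 1)) * (\<Sum>i=1..n. (degree n Y i - (real n - 1) * y i)\<^sup>2)"
proof -
  define N where "N = real n - 1"
  have N: "N > 0" using n by (simp add: N_def)
  have 1: "(\<Sum>e\<in>edges n. \<theta> * (y (fst e) + y (snd e)) * at_edge Y e) = \<theta> * (\<Sum>i=1..n. y i * degree n Y i)"
    unfolding sum_weighted_degrees[OF Y] by (simp add: sum_distrib_left mult.assoc)
  have "(\<Sum>e\<in>edges n. \<theta> / 2 * ((y (fst e))\<^sup>2 + (y (snd e))\<^sup>2)) = \<theta> / 2 * (\<Sum>i=1..n. \<Sum>e\<in>edges_at n i. (y i)\<^sup>2)"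
    unfolding sum_vertices_edges by (simp add: sum_distrib_left)
  also have "(\<Sum>i=1..n. \<Sum>e\<in>edges_at n i. (y i)\<^sup>2) = N * (\<Sum>i=1..n. (y i)\<^sup>2)"
    unfolding sum_distrib_left by (intro sum.cong refl) (simp add: card_edges_at N_def)
  finally have 2: "(\<Sum>e\<in>edges n. \<theta> / 2 * ((y (fst e))\<^sup>2 + (y (snd e))\<^sup>2)) = \<theta> / 2 * (N * (\<Sum>i=1..n. (y i)\<^sup>2))" .
  have "(\<Sum>i=1..n. (degree n Y i - N * y i)\<^sup>2)
      = (\<Sum>i=1..n. (degree n Y i)\<^sup>2 - 2 * N * (y i * degree n Y i) + N\<^sup>2 * (y i)\<^sup>2)"
    by (intro sum.cong refl) (simp add: power2_eq_square algebra_simps)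
  also have "\<dots> = (\<Sum>i=1..n. (degree n Y i)\<^sup>2) - 2 * N * (\<Sum>i=1..n. y i * degree n Y i) + N\<^sup>2 * (\<Sum>i=1..n. (y i)\<^sup>2)"
    by (simp add: sum.distrib sum_subtractf sum_distrib_left)
  finally have 3: "(\<Sum>i=1..n. (degree n Y i - N * y i)\<^sup>2)
      = (\<Sum>i=1..n. (degree n Y i)\<^sup>2) - 2 * N * (\<Sum>i=1..n. y i * degree n Y i) + N\<^sup>2 * (\<Sum>i=1..n. (y i)\<^sup>2)" .
  have alg: "\<theta> / N * (1/2 * a - real n * N / 2) = - \<theta> * real n / 2 + \<theta> * b - \<theta> / 2 * (N * c)
      + \<theta> / (2 * N) * (a - 2 * N * b + N\<^sup>2 * c)" for a b c
    using N by (simp add: power2_eq_square field_simps)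
  show ?thesis unfolding N_def[symmetric] 1 2 3 log_weight_def
    using alg by simp
qed

context low_temperature
begin

section \<open>The double well for a pair of rescaled degrees\<close>

definition well :: "real \<Rightarrow> real" where
  "well v = \<theta> / 4 * v\<^sup>2 - ln (cosh (\<theta> * v))"

text \<open>The free energy per edge after linearisation: the quadratic term left by the expansion
  minus the log moment generating function of a fair sign in the field \<theta> (x + y).\<close>

definition pair_energy :: "real \<Rightarrow> real \<Rightarrow> real" where
  "pair_energy x y = \<theta> / 2 * (x\<^sup>2 + y\<^sup>2) - ln (cosh (\<theta> * (x + y)))"

text \<open>The sum of the two degrees sees a double well with minima at 2 r and -2 r, the
  difference a convex penalty. Near-minimal pairs therefore lie near (r, r) or (-r, -r), never in
  opposite phases.\<close>

lemma pair_energy_well: "pair_energy x y = well (x + y) + \<theta> / 4 * (x - y)\<^sup>2"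
  by (simp add: pair_energy_def well_def power2_eq_square algebra_simps)

lemma well_deriv: "(well has_real_derivative \<theta> * (v / 2 - tanh (\<theta> * v))) (at v)"
  unfolding well_def[abs_def]
  by (auto intro!: derivative_eq_intros simp: cosh_real_pos tanh_def field_simps)

lemma well_continuous: "continuous_on A well"
  by (intro continuous_at_imp_continuous_on ballI DERIV_isCont[OF well_deriv])

lemma well_decreasing:
  assumes "0 \<le> a" "a < b" "b \<le> 2 * r" shows "well b < well a"
proof (rule DERIV_neg_imp_decreasing_open[OF assms(2)])
  fix x assume "a < x" "x < b"
  then have "x / 2 < tanh (\<theta> * x)" using assms by (intro tanh_above_chord) auto
  then have "\<theta> * (x / 2 - tanh (\<theta> * x)) < 0" using \<theta> by (intro mult_pos_neg) auto
  then show "\<exists>y. (well has_real_derivative y) (at x) \<and> y < 0" using well_deriv by blast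
qed (rule well_continuous)

lemma well_increasing:
  assumes "2 * r \<le> a" "a < b" shows "well a < well b"
proof (rule DERIV_pos_imp_increasing_open[OF assms(2)])
  fix x assume "a < x" "x < b"
  then have "tanh (\<theta> * x) < x / 2" using assms by (intro tanh_below_chord) auto
  then have "\<theta> * (x / 2 - tanh (\<theta> * x)) > 0" using \<theta> by (intro mult_pos_pos) auto
  then show "\<exists>y. (well has_real_derivative y) (at x) \<and> y > 0" using well_deriv by blast
qed (rule well_continuous)

lemma well_abs: "well \<bar>v\<bar> = well v"
  by (auto simp: well_def abs_if)

lemma well_min: "well (2 * r) \<le> well v"
  using well_decreasing[of "\<bar>v\<bar>" "2 * r"] well_increasing[of "2 * r" "\<bar>v\<bar>"] well_abs[of v]
  by (cases "\<bar>v\<bar>" "2 * r" rule: linorder_cases) auto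

lemma well_near:
  assumes \<eta>: "0 < \<eta>" "\<eta> < 2 * r"
  shows "\<exists>\<zeta>>0. \<forall>v. well v - well (2 * r) < \<zeta> \<longrightarrow> \<bar>\<bar>v\<bar> - 2 * r\<bar> < \<eta>"
proof -
  define \<zeta> where "\<zeta> = min (well (2 * r - \<eta>)) (well (2 * r + \<eta>)) - well (2 * r)"
  have "\<zeta> > 0"
    using well_decreasing[of "2 * r - \<eta>" "2 * r"] well_increasing[of "2 * r" "2 * r + \<eta>"] \<eta> by (simp add: \<zeta>_def)
  moreover have "\<bar>\<bar>v\<bar> - 2 * r\<bar> < \<eta>" if v: "well v - well (2 * r) < \<zeta>" for v
  proof (rule ccontr)
    assume "\<not> ?thesis"
    then consider "\<bar>v\<bar> \<le> 2 * r - \<eta>" | "2 * r + \<eta> \<le> \<bar>v\<bar>" by linarith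
    then have "\<zeta> \<le> well \<bar>v\<bar> - well (2 * r)"
    proof cases
      case 1
      then show ?thesis
        using well_decreasing[of "\<bar>v\<bar>" "2 * r - \<eta>"] \<eta> by (cases "\<bar>v\<bar> = 2 * r - \<eta>") (auto simp: \<zeta>_def)
    next
      case 2
      then show ?thesis
        using well_increasing[of "2 * r + \<eta>" "\<bar>v\<bar>"] \<eta> by (cases "\<bar>v\<bar> = 2 * r + \<eta>") (auto simp: \<zeta>_def)
    qed
    then show False using v by (simp add: well_abs)
  qed
  ultimately show ?thesis by blast
qed

lemma pair_energy_min: "pair_energy r r \<le> pair_energy x y"
proof -
  have "0 \<le> \<theta> / 4 * (x - y)\<^sup>2" using \<theta> by simp
  then show ?thesis using well_min[of "x + y"] by (simp add: pair_energy_well)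
qed

lemma pair_energy_near:
  assumes \<eta>: "0 < \<eta>" "\<eta> < r"
  shows "\<exists>\<zeta>>0. \<forall>x y. pair_energy x y - pair_energy r r < \<zeta> \<longrightarrow>
    \<bar>x - r\<bar> \<le> \<eta> \<and> \<bar>y - r\<bar> \<le> \<eta> \<or> \<bar>x + r\<bar> \<le> \<eta> \<and> \<bar>y + r\<bar> \<le> \<eta>"
proof -
  obtain \<zeta>1 where \<zeta>1: "\<zeta>1 > 0" "\<And>v. well v - well (2 * r) < \<zeta>1 \<Longrightarrow> \<bar>\<bar>v\<bar> - 2 * r\<bar> < \<eta>"
    using well_near[of \<eta>] \<eta> r by auto
  define \<zeta> where "\<zeta> = min \<zeta>1 (\<theta> / 4 * \<eta>\<^sup>2)"
  have "\<zeta> > 0" using \<zeta>1 \<theta> \<eta> by (simp add: \<zeta>_def)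
  moreover have "\<bar>x - r\<bar> \<le> \<eta> \<and> \<bar>y - r\<bar> \<le> \<eta> \<or> \<bar>x + r\<bar> \<le> \<eta> \<and> \<bar>y + r\<bar> \<le> \<eta>"
    if "pair_energy x y - pair_energy r r < \<zeta>" for x y
  proof -
    have p: "well (x + y) - well (2 * r) + \<theta> / 4 * (x - y)\<^sup>2 < \<zeta>"
      using that by (simp add: pair_energy_well)
    have sq: "0 \<le> \<theta> / 4 * (x - y)\<^sup>2" using \<theta> by simp
    have "\<bar>\<bar>x + y\<bar> - 2 * r\<bar> < \<eta>" using p sq by (intro \<zeta>1(2)) (simp add: \<zeta>_def)
    moreover have "\<bar>x - y\<bar> < \<eta>"
    proof -
      have "\<theta> / 4 * (x - y)\<^sup>2 < \<theta> / 4 * \<eta>\<^sup>2" using p well_min[of "x + y"] by (simp add: \<zeta>_def)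
      then have "(x - y)\<^sup>2 < \<eta>\<^sup>2" using \<theta> by simp
      then show ?thesis using \<eta>(1) by (metis abs_le_square_iff abs_of_pos not_le)
    qed
    ultimately show ?thesis by linarith
  qed
  ultimately show ?thesis by blast
qed

section \<open>Free-energy excess of a degree sequence\<close>

definition excess :: "nat \<Rightarrow> (nat \<Rightarrow> real) \<Rightarrow> real" where
  "excess n y = (\<Sum>e\<in>edges n. pair_energy (y (fst e)) (y (snd e)) - pair_energy r r)"

lemma tangent_partition:
  "(\<Sum>Y\<in>configs n. exp (- \<theta> * real n / 2 + (\<Sum>e\<in>edges n. \<theta> * (y (fst e) + y (snd e)) * at_edge Y e)
      - (\<Sum>e\<in>edges n. \<theta> / 2 * ((y (fst e))\<^sup>2 + (y (snd e))\<^sup>2))))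
   = exp (- \<theta> * real n / 2) * real (card (configs n))
      * exp (- (\<Sum>e\<in>edges n. pair_energy (y (fst e)) (y (snd e))))"
proof -
  let ?q = "\<Sum>e\<in>edges n. \<theta> / 2 * ((y (fst e))\<^sup>2 + (y (snd e))\<^sup>2)"
  have "(\<Prod>e\<in>edges n. cosh (\<theta> * (y (fst e) + y (snd e))))
      = exp (\<Sum>e\<in>edges n. ln (cosh (\<theta> * (y (fst e) + y (snd e)))))"
    unfolding exp_sum[OF finite_edges] by (intro prod.cong refl) (simp add: cosh_real_pos)
  then have c: "(\<Sum>Y\<in>configs n. exp (\<Sum>e\<in>edges n. \<theta> * (y (fst e) + y (snd e)) * at_edge Y e))
      = real (card (configs n)) * exp (\<Sum>e\<in>edges n. ln (cosh (\<theta> * (y (fst e) + y (snd e)))))"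
    by (simp add: sum_exp_edges[OF subset_refl])
  have "(\<Sum>Y\<in>configs n. exp (- \<theta> * real n / 2 + (\<Sum>e\<in>edges n. \<theta> * (y (fst e) + y (snd e)) * at_edge Y e) - ?q))
      = (\<Sum>Y\<in>configs n. exp (- \<theta> * real n / 2) * exp (- ?q) * exp (\<Sum>e\<in>edges n. \<theta> * (y (fst e) + y (snd e)) * at_edge Y e))"
    by (intro sum.cong refl) (simp flip: exp_add)
  also have "\<dots> = exp (- \<theta> * real n / 2) * exp (- ?q) *
      (real (card (configs n)) * exp (\<Sum>e\<in>edges n. ln (cosh (\<theta> * (y (fst e) + y (snd e))))))"
    unfolding sum_distrib_left[symmetric] c ..
  also have "\<dots> = exp (- \<theta> * real n / 2) * real (card (configs n))
      * exp ((\<Sum>e\<in>edges n. ln (cosh (\<theta> * (y (fst e) + y (snd e))))) - ?q)"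
    by (simp add: exp_diff exp_minus field_simps)
  also have "(\<Sum>e\<in>edges n. ln (cosh (\<theta> * (y (fst e) + y (snd e))))) - ?q = - (\<Sum>e\<in>edges n. pair_energy (y (fst e)) (y (snd e)))"
    by (simp add: pair_energy_def sum_subtractf)
  finally show ?thesis .
qed

text \<open>The expansion is used with two profiles. The constant profile \<open>r\<close>, with the
  square dropped, bounds the normalizer from below; for a given degree sequence its own profile
  makes the square vanish, and extending the sum to all configurations bounds its total weight. The
  ratio is exp of minus the excess.\<close>

lemma excess_prob:
  assumes n: "n \<ge> 2"
  shows "gibbs_mean n (null_weight n \<theta>) (\<lambda>Y. of_bool (\<delta> \<le> excess n (\<lambda>i. degree n Y i / (real n - 1))))
    \<le> (2 * real n) ^ n * exp (- \<delta>)"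
proof -
  let ?H = "null_weight n \<theta>"
  let ?Z = "gibbs_sum n ?H (\<lambda>_. 1)"
  define N where "N = real n - 1"
  have N: "N > 0" using n by (simp add: N_def)
  define E where "E Y = excess n (\<lambda>i. degree n Y i / N)" for Y
  define vec where "vec Y = restrict (degree n Y) {1..n}" for Y
  define w where "w = exp (- \<theta> * real n / 2) * real (card (configs n)) * exp (- (\<Sum>e\<in>edges n. pair_energy r r))"
  have wZ: "w \<le> ?Z"
  proof -
    have "w = (\<Sum>Y\<in>configs n. exp (- \<theta> * real n / 2 + (\<Sum>e\<in>edges n. \<theta> * (r + r) * at_edge Y e)
        - (\<Sum>e\<in>edges n. \<theta> / 2 * (r\<^sup>2 + r\<^sup>2))))"
      unfolding w_def by (rule tangent_partition[symmetric])
    also have "\<dots> \<le> (\<Sum>Y\<in>configs n. exp (?H Y) * 1)"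
    proof (rule sum_mono)
      fix Y assume Y: "Y \<in> configs n"
      have "0 \<le> \<theta> / (2 * (real n - 1)) * (\<Sum>i=1..n. (degree n Y i - (real n - 1) * r)\<^sup>2)"
        using \<theta> N by (intro mult_nonneg_nonneg sum_nonneg) (auto simp: N_def)
      then show "exp (- \<theta> * real n / 2 + (\<Sum>e\<in>edges n. \<theta> * (r + r) * at_edge Y e)
          - (\<Sum>e\<in>edges n. \<theta> / 2 * (r\<^sup>2 + r\<^sup>2))) \<le> exp (?H Y) * 1"
        using log_weight_tangent[OF Y n, of \<theta> "\<lambda>_. r"] by simp
    qed
    finally show ?thesis by (simp add: gibbs_sum_def)
  qed
  have E_vec: "E Y = E X" if "vec Y = vec X" for X Y
  proof -
    have "degree n Y i = degree n X i" if "i \<in> {1..n}" for i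
      using \<open>vec Y = vec X\<close> that unfolding vec_def by (metis restrict_apply')
    then show ?thesis unfolding E_def excess_def by (intro sum.cong refl) (metis edgesD(1,2))
  qed
  have inner: "(\<Sum>Y\<in>{Y\<in>configs n. vec Y = v}. exp (?H Y) * of_bool (\<delta> \<le> E Y)) \<le> w * exp (- \<delta>)"
    if v: "v \<in> vec ` configs n" for v
  proof -
    obtain X where X: "X \<in> configs n" "v = vec X" using v by blast
    show ?thesis
    proof (cases "\<delta> \<le> E X")
      case False
      then have "(\<Sum>Y\<in>{Y\<in>configs n. vec Y = v}. exp (?H Y) * of_bool (\<delta> \<le> E Y)) = 0"
      proof (intro sum.neutral ballI)
        fix Y assume "Y \<in> {Y \<in> configs n. vec Y = v}"
        then have "vec Y = vec X" using X by simp
        from E_vec[OF this] show "exp (?H Y) * of_bool (\<delta> \<le> E Y) = 0" using False by simp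
      qed
      then show ?thesis by (simp add: w_def)
    next
      case True
      define y where "y i = degree n X i / N" for i
      have "(\<Sum>Y\<in>{Y\<in>configs n. vec Y = v}. exp (?H Y) * of_bool (\<delta> \<le> E Y))
          \<le> (\<Sum>Y\<in>{Y\<in>configs n. vec Y = v}. exp (- \<theta> * real n / 2 + (\<Sum>e\<in>edges n. \<theta> * (y (fst e) + y (snd e)) * at_edge Y e)
            - (\<Sum>e\<in>edges n. \<theta> / 2 * ((y (fst e))\<^sup>2 + (y (snd e))\<^sup>2))))"
      proof (rule sum_mono)
        fix Y assume "Y \<in> {Y \<in> configs n. vec Y = v}"
        then have Y: "Y \<in> configs n" "vec Y = vec X" using X by auto
        have "degree n Y i = degree n X i" if "i \<in> {1..n}" for i
          using Y(2) that unfolding vec_def by (metis restrict_apply')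
        then have "(\<Sum>i=1..n. (degree n Y i - (real n - 1) * y i)\<^sup>2) = 0"
          using N by (intro sum.neutral) (auto simp: y_def N_def)
        then show "exp (?H Y) * of_bool (\<delta> \<le> E Y) \<le> exp (- \<theta> * real n / 2 + (\<Sum>e\<in>edges n. \<theta> * (y (fst e) + y (snd e)) * at_edge Y e)
            - (\<Sum>e\<in>edges n. \<theta> / 2 * ((y (fst e))\<^sup>2 + (y (snd e))\<^sup>2)))"
          using log_weight_tangent[OF Y(1) n, of \<theta> y] by simp
      qed
      also have "\<dots> \<le> (\<Sum>Y\<in>configs n. exp (- \<theta> * real n / 2 + (\<Sum>e\<in>edges n. \<theta> * (y (fst e) + y (snd e)) * at_edge Y e)
            - (\<Sum>e\<in>edges n. \<theta> / 2 * ((y (fst e))\<^sup>2 + (y (snd e))\<^sup>2))))"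
        by (intro sum_mono2 finite_configs) auto
      also have "\<dots> = w * exp (- E X)"
        unfolding tangent_partition w_def E_def excess_def y_def[symmetric]
        by (simp add: sum_subtractf mult.assoc flip: exp_add)
      also have "\<dots> \<le> w * exp (- \<delta>)" using True by (intro mult_left_mono) (auto simp: w_def)
      finally show ?thesis .
    qed
  qed
  have card: "real (card (vec ` configs n)) \<le> (2 * real n) ^ n"
  proof -
    \<comment> \<open>Degrees are integers between -(n - 1) and n - 1, at most 2 n values each. With
      an excess of order n^2, the count (2n)^n is negligible.\<close>
    define K where "K = real_of_int ` {- (int n - 1)..int n - 1}"
    have "finite K" by (simp add: K_def)
    have "vec ` configs n \<subseteq> PiE {1..n} (\<lambda>_. K)"
    proof
      fix v assume "v \<in> vec ` configs n"
      then obtain Y where Y: "Y \<in> configs n" "v = vec Y" by blast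
      have "degree n Y i \<in> K" if i: "i \<in> {1..n}" for i
      proof -
        have "at_edge Y e \<in> \<int>" if "e \<in> edges_at n i" for e
          using at_edge_cases[OF Y(1), of e] that edges_at_subset by fastforce
        then have "degree n Y i \<in> \<int>" unfolding degree_edges[OF Y(1) i] by (rule Ints_sum)
        then obtain k where k: "degree n Y i = real_of_int k" by (auto elim: Ints_cases)
        have "\<bar>real_of_int k\<bar> \<le> real n - 1" using abs_degree_le[OF Y(1) i] k by simp
        then have "k \<in> {- (int n - 1)..int n - 1}" by (auto simp: abs_le_iff)
        then show ?thesis unfolding K_def k by blast
      qed
      then show "v \<in> PiE {1..n} (\<lambda>_. K)" unfolding Y(2) vec_def by auto
    qed
    then have "card (vec ` configs n) \<le> card (PiE {1..n} (\<lambda>_. K))"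
      using \<open>finite K\<close> by (intro card_mono finite_PiE) auto
    also have "\<dots> = card K ^ n" by (simp add: card_PiE)
    also have "\<dots> \<le> (2 * n) ^ n"
    proof (rule power_mono)
      have "card K \<le> card {- (int n - 1)..int n - 1}" unfolding K_def by (rule card_image_le) simp
      then show "card K \<le> 2 * n" using n by simp
    qed simp
    finally have "real (card (vec ` configs n)) \<le> real ((2 * n) ^ n)" by (rule of_nat_mono)
    then show ?thesis by simp
  qed
  have "gibbs_sum n ?H (\<lambda>Y. of_bool (\<delta> \<le> E Y))
      = (\<Sum>v\<in>vec ` configs n. \<Sum>Y\<in>{Y\<in>configs n. vec Y = v}. exp (?H Y) * of_bool (\<delta> \<le> E Y))"
    unfolding gibbs_sum_def by (rule sum.group[symmetric]) (auto simp: finite_configs)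
  also have "\<dots> \<le> (\<Sum>v\<in>vec ` configs n. w * exp (- \<delta>))" by (intro sum_mono inner)
  also have "\<dots> = real (card (vec ` configs n)) * (w * exp (- \<delta>))" by simp
  also have "\<dots> \<le> (2 * real n) ^ n * (?Z * exp (- \<delta>))"
    using wZ less_imp_le[OF gibbs_sum_one_pos] by (intro mult_mono card mult_right_mono) (auto simp: w_def)
  finally show ?thesis
    using gibbs_sum_one_pos[of n ?H] by (simp add: gibbs_mean_def E_def N_def pos_divide_le_eq mult_ac)
qed

text \<open>Each pair of vertices off the double well costs at least \<zeta>, so fewer than \<eta>
  n^2 ordered pairs are bad, and some vertex \<open>i\<close> has fewer than \<eta> n bad partners.
  All its other partners share its phase; the additional 1 allows for \<open>i\<close>
  itself.\<close>

lemma majority_phase: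
  assumes \<eta>: "0 < \<eta>" and \<zeta>: "0 < \<zeta>"
    and near: "\<And>x y. pair_energy x y - pair_energy r r < \<zeta> \<Longrightarrow>
      \<bar>x - r\<bar> \<le> \<eta> \<and> \<bar>y - r\<bar> \<le> \<eta> \<or> \<bar>x + r\<bar> \<le> \<eta> \<and> \<bar>y + r\<bar> \<le> \<eta>"
    and \<eta>r: "\<eta> < r" and n: "n \<ge> 1" and ex: "excess n y < \<zeta> * \<eta> * (real n)\<^sup>2 / 2"
  shows "\<exists>\<sigma>\<in>{1, -1}. real (card {j \<in> {1..n}. \<eta> < \<bar>y j - \<sigma> * r\<bar>}) \<le> \<eta> * real n + 1"
proof -
  define bad where "bad i j \<longleftrightarrow> \<zeta> \<le> pair_energy (y i) (y j) - pair_energy r r" for i j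
  have bad_sym: "bad i j = bad j i" for i j by (simp add: bad_def pair_energy_def add.commute)
  have "\<zeta> * (\<Sum>e\<in>edges n. of_bool (bad (fst e) (snd e))) \<le> excess n y"
    unfolding excess_def sum_distrib_left
    by (intro sum_mono) (use pair_energy_min in \<open>auto simp: bad_def\<close>)
  then have "\<zeta> * (\<Sum>e\<in>edges n. of_bool (bad (fst e) (snd e))) < \<zeta> * (\<eta> * (real n)\<^sup>2 / 2)" using ex by simp
  then have total: "(\<Sum>e\<in>edges n. of_bool (bad (fst e) (snd e)) :: real) < \<eta> * (real n)\<^sup>2 / 2"
    using \<zeta> by (simp only: mult_less_cancel_left_pos)
  have "(\<Sum>i=1..n. \<Sum>j\<in>{1..n}-{i}. of_bool (bad i j)) = (\<Sum>i=1..n. \<Sum>e\<in>edges_at n i. of_bool (bad (fst e) (snd e)) :: real)"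
  proof (rule sum.cong[OF refl])
    fix i assume i: "i \<in> {1..n}"
    have sym: "(of_bool (bad i j) :: real) = of_bool (bad j i)" for j using bad_sym by simp
    show "(\<Sum>j\<in>{1..n}-{i}. of_bool (bad i j)) = (\<Sum>e\<in>edges_at n i. of_bool (bad (fst e) (snd e)) :: real)"
      using sum_edges_at[OF i, where g = "\<lambda>i j. of_bool (bad i j)", OF sym] by simp
  qed
  also have "\<dots> = 2 * (\<Sum>e\<in>edges n. of_bool (bad (fst e) (snd e)))"
    unfolding sum_vertices_edges by (simp add: sum_distrib_left)
  finally have "(\<Sum>i=1..n. \<Sum>j\<in>{1..n}-{i}. of_bool (bad i j)) < (\<Sum>i=1..n. \<eta> * real n)"
    using total by (simp add: power2_eq_square mult_ac)
  then obtain i where i: "i \<in> {1..n}" "(\<Sum>j\<in>{1..n}-{i}. of_bool (bad i j)) < \<eta> * real n"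
    by (meson linorder_not_less sum_mono)
  define \<sigma> where "\<sigma> = (if \<bar>y i - r\<bar> \<le> \<eta> then 1 else - 1 :: real)"
  have "{j \<in> {1..n}. \<eta> < \<bar>y j - \<sigma> * r\<bar>} \<subseteq> insert i {j \<in> {1..n} - {i}. bad i j}"
  proof
    fix j assume j: "j \<in> {j \<in> {1..n}. \<eta> < \<bar>y j - \<sigma> * r\<bar>}"
    have "bad i j"
    proof (rule ccontr)
      assume "\<not> bad i j"
      then have "\<bar>y i - r\<bar> \<le> \<eta> \<and> \<bar>y j - r\<bar> \<le> \<eta> \<or> \<bar>y i + r\<bar> \<le> \<eta> \<and> \<bar>y j + r\<bar> \<le> \<eta>"
        by (intro near) (simp add: bad_def)
      then show False using j \<eta>r by (auto simp: \<sigma>_def split: if_splits)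
    qed
    then show "j \<in> insert i {j \<in> {1..n} - {i}. bad i j}" using j by auto
  qed
  then have "card {j \<in> {1..n}. \<eta> < \<bar>y j - \<sigma> * r\<bar>} \<le> card (insert i {j \<in> {1..n} - {i}. bad i j})"
    by (intro card_mono) auto
  also have "\<dots> \<le> Suc (card {j \<in> {1..n} - {i}. bad i j})" by (simp add: card_insert_if)
  finally have "real (card {j \<in> {1..n}. \<eta> < \<bar>y j - \<sigma> * r\<bar>}) \<le> 1 + real (card {j \<in> {1..n} - {i}. bad i j})" by simp
  also have "real (card {j \<in> {1..n} - {i}. bad i j}) = (\<Sum>j\<in>{1..n}-{i}. of_bool (bad i j))"
    by (simp add: of_bool_def sum.If_cases Int_def)
  finally show ?thesis using i(2) by (intro bexI[of _ \<sigma>]) (auto simp: \<sigma>_def)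
qed

text \<open>From most vertices to all of them: the degree of \<open>i\<close> is its centred sum
  plus conditional means, and these are close to tanh (\<theta> (y i + r)) except on edges to the
  few far vertices. Then \<open>mean_field_gap\<close> excludes any position of \<open>y i\<close>
  other than near \<open>r\<close>.\<close>

lemma plus_phase_window:
  assumes n: "n \<ge> 2" and Y: "Y \<in> configs n" and \<eta>: "0 < \<eta>" "2 * \<theta> + 2 \<le> \<eta> * (real n - 1)"
    and S: "\<And>i. i \<in> {1..n} \<Longrightarrow> \<bar>centred_sum (null_weight n \<theta>) (edges_at n i) Y\<bar> \<le> \<eta> * real n"
    and maj: "real (card {j \<in> {1..n}. \<eta> < \<bar>degree n Y j / (real n - 1) - r\<bar>}) \<le> \<eta> * real n + 1"
  shows "window n (4 * (7 + \<theta>) * \<eta> / r) Y"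
  unfolding window_def
proof
  fix i assume i: "i \<in> {1..n}"
  define N where "N = real n - 1"
  have N: "N \<ge> 1" "real n \<le> 2 * N" using n by (auto simp: N_def)
  define y where "y j = degree n Y j / N" for j
  define far where "far j = (of_bool (\<eta> < \<bar>y j - r\<bar>) :: real)" for j
  define T where "T = tanh (\<theta> * (y i + r))"
  let ?m = "local_mean (null_weight n \<theta>)"
  have m: "\<bar>?m e Y - T\<bar> \<le> 2 * \<theta> / N + \<theta> * \<eta> + 2 * far j"
    if e: "e \<in> edges n" and ij: "i = fst e \<and> j = snd e \<or> i = snd e \<and> j = fst e" for e j
  proof -
    have me: "?m e Y = tanh (\<theta> * (y i + y j) - 2 * \<theta> * at_edge Y e / N)"
      unfolding local_mean_two_star[OF Y e] using ij N
      by (auto simp: y_def N_def[symmetric] intro!: arg_cong[of _ _ tanh])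
         (simp_all add: field_simps)
    show ?thesis
    proof (cases "\<eta> < \<bar>y j - r\<bar>")
      case True
      have "\<bar>?m e Y - T\<bar> \<le> 2"
        unfolding me T_def using tanh_real_bounds[of "\<theta> * (y i + r)"]
          tanh_real_bounds[of "\<theta> * (y i + y j) - 2 * \<theta> * at_edge Y e / N"] by auto
      moreover have "0 \<le> 2 * \<theta> / N + \<theta> * \<eta>" using \<theta> N \<eta> by simp
      ultimately show ?thesis using True by (simp add: far_def)
    next
      case False
      have "\<bar>?m e Y - T\<bar> \<le> \<bar>\<theta> * (y i + y j) - 2 * \<theta> * at_edge Y e / N - \<theta> * (y i + r)\<bar>"
        unfolding me T_def by (rule tanh_lipschitz_1)
      also have "\<dots> = \<bar>\<theta> * (y j - r) - 2 * \<theta> / N * at_edge Y e\<bar>" by (simp add: algebra_simps)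
      also have "\<dots> \<le> \<bar>\<theta> * (y j - r)\<bar> + \<bar>2 * \<theta> / N * at_edge Y e\<bar>" by linarith
      also have "\<dots> = \<theta> * \<bar>y j - r\<bar> + 2 * \<theta> / N"
        using \<theta> N abs_at_edge[OF Y e] by (simp add: abs_mult)
      also have "\<dots> \<le> \<theta> * \<eta> + 2 * \<theta> / N" using False \<theta> by (intro add_mono mult_left_mono) auto
      finally show ?thesis by (simp add: far_def)
    qed
  qed
  have "(\<Sum>e\<in>edges_at n i. \<bar>?m e Y - T\<bar>) \<le> (\<Sum>e\<in>edges_at n i. 2 * \<theta> / N + \<theta> * \<eta> + 2 * (far (fst e) + far (snd e) - far i))"
  proof (rule sum_mono)
    fix e assume "e \<in> edges_at n i"
    then have e: "e \<in> edges n" and ie: "i = fst e \<or> i = snd e" by (auto simp: edges_at_def)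
    show "\<bar>?m e Y - T\<bar> \<le> 2 * \<theta> / N + \<theta> * \<eta> + 2 * (far (fst e) + far (snd e) - far i)"
      using ie m[OF e, of "fst e"] m[OF e, of "snd e"] by auto
  qed
  also have "\<dots> = (\<Sum>j\<in>{1..n}-{i}. 2 * \<theta> / N + \<theta> * \<eta> + 2 * (far i + far j - far i))"
    by (rule sum_edges_at[OF i, where g = "\<lambda>p q. 2 * \<theta> / N + \<theta> * \<eta> + 2 * (far p + far q - far i)"]) simp
  also have "\<dots> = N * (2 * \<theta> / N + \<theta> * \<eta>) + 2 * (\<Sum>j\<in>{1..n}-{i}. far j)"
    using i by (simp add: sum.distrib sum_distrib_left N_def of_nat_diff)
  also have "(\<Sum>j\<in>{1..n}-{i}. far j) \<le> (\<Sum>j=1..n. far j)"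
    by (intro sum_mono2) (auto simp: far_def)
  also have "(\<Sum>j=1..n. far j) = real (card {j \<in> {1..n}. \<eta> < \<bar>y j - r\<bar>})"
    by (simp add: far_def of_bool_def sum.If_cases Int_def)
  also have "\<dots> \<le> \<eta> * real n + 1" using maj by (simp add: y_def N_def)
  finally have sum_m: "(\<Sum>e\<in>edges_at n i. \<bar>?m e Y - T\<bar>) \<le> N * (2 * \<theta> / N + \<theta> * \<eta>) + 2 * (\<eta> * real n + 1)"
    by simp
  have "N * (y i - T) = (\<Sum>e\<in>edges_at n i. at_edge Y e - T)"
    using N card_edges_at[OF i] by (simp add: y_def degree_edges[OF Y i] sum_subtractf N_def right_diff_distrib)
  also have "\<dots> = centred_sum (null_weight n \<theta>) (edges_at n i) Y + (\<Sum>e\<in>edges_at n i. ?m e Y - T)"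
    by (simp add: centred_sum_def flip: sum.distrib)
  finally have eq: "N * (y i - T) = centred_sum (null_weight n \<theta>) (edges_at n i) Y + (\<Sum>e\<in>edges_at n i. ?m e Y - T)" .
  have "\<bar>N * (y i - T)\<bar> \<le> \<eta> * real n + (\<Sum>e\<in>edges_at n i. \<bar>?m e Y - T\<bar>)"
    unfolding eq by (intro order_trans[OF abs_triangle_ineq] add_mono S i sum_abs)
  also have "\<dots> \<le> \<eta> * real n + (N * (2 * \<theta> / N + \<theta> * \<eta>) + 2 * (\<eta> * real n + 1))" using sum_m by simp
  also have "\<dots> = 3 * (\<eta> * real n) + (2 * \<theta> + 2) + N * (\<theta> * \<eta>)" using N by (simp add: algebra_simps)
  \<comment> \<open>The constant 7 + \<theta>: one \<eta> n from the centred sum and two from far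
    neighbours give 6 since n \<le> 2 N, one more from the bounded terms, and \<theta> from the
    field error at near neighbours. The factor 4 / r of the conclusion is the inverse of the
    mean-field gap.\<close>
  also have "\<dots> \<le> 3 * (\<eta> * (2 * N)) + \<eta> * N + N * (\<theta> * \<eta>)"
    using mult_left_mono[OF N(2) less_imp_le[OF \<eta>(1)]] \<eta>(2) unfolding N_def[symmetric] by linarith
  also have "\<dots> = N * ((7 + \<theta>) * \<eta>)" by (simp add: algebra_simps)
  finally have "N * \<bar>y i - T\<bar> \<le> N * ((7 + \<theta>) * \<eta>)" using N by (simp add: abs_mult)
  then have yT: "\<bar>y i - T\<bar> \<le> (7 + \<theta>) * \<eta>" using N by simp
  have "\<bar>y i\<bar> \<le> 1" using abs_degree_le[OF Y i] N by (simp add: y_def abs_divide N_def)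
  then have "r / 4 * \<bar>y i - r\<bar> \<le> \<bar>y i - T\<bar>" unfolding T_def by (rule mean_field_gap)
  then have "\<bar>y i - r\<bar> \<le> 4 * (7 + \<theta>) * \<eta> / r" using yT r by (simp add: field_simps)
  then have "N * \<bar>y i - r\<bar> \<le> N * (4 * (7 + \<theta>) * \<eta> / r)" using N by (intro mult_left_mono) auto
  also have "N * \<bar>y i - r\<bar> = \<bar>N * (y i - r)\<bar>" using N by (simp add: abs_mult)
  also have "N * (y i - r) = degree n Y i - N * r" using N by (simp add: y_def right_diff_distrib)
  finally show "\<bar>degree n Y i - (real n - 1) * r\<bar> \<le> 4 * (7 + \<theta>) * \<eta> / r * (real n - 1)"
    by (simp add: N_def mult.commute)
qed

lemma centred_sum_uminus:
  assumes Y: "Y \<in> configs n" and Q: "Q \<subseteq> edges n"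
  shows "centred_sum (null_weight n \<theta>) Q (\<lambda>i j. - Y i j) = - centred_sum (null_weight n \<theta>) Q Y"
  unfolding centred_sum_def sum_negf[symmetric]
proof (rule sum.cong[OF refl])
  fix e assume "e \<in> Q"
  then have e: "e \<in> edges n" using Q by blast
  have a: "at_edge (\<lambda>i j. - Y i j) e = - at_edge Y e" by (simp add: at_edge_def)
  have "\<theta> / (real n - 1) * (- degree n Y (fst e) + - degree n Y (snd e) - 2 * - at_edge Y e)
      = - (\<theta> / (real n - 1) * (degree n Y (fst e) + degree n Y (snd e) - 2 * at_edge Y e))"
    by (simp add: algebra_simps)
  then show "at_edge (\<lambda>i j. - Y i j) e - local_mean (null_weight n \<theta>) e (\<lambda>i j. - Y i j)
      = - (at_edge Y e - local_mean (null_weight n \<theta>) e Y)"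
    unfolding local_mean_two_star[OF Y e] local_mean_two_star[OF uminus_in_configs[OF Y] e] a degree_uminus
    by simp
qed

lemma null_two_phases:
  assumes \<epsilon>: "0 < \<epsilon>"
  shows "\<exists>c>0. \<forall>\<^sub>F n in sequentially. gibbs_mean n (null_weight n \<theta>)
      (\<lambda>Y. of_bool (no_phase n \<epsilon> Y)) \<le> exp (- c * real n)"
proof -
  \<comment> \<open>Small enough that the window obtained from a majority phase has width at most
    \<epsilon>, and below \<open>r\<close> so that the two phases are disjoint.\<close>
  define \<eta> where "\<eta> = min (\<epsilon> * r / (4 * (7 + \<theta>))) (r / 2)"
  have \<eta>: "0 < \<eta>" "\<eta> < r" using \<epsilon> r \<theta> by (auto simp: \<eta>_def)
  have \<eta>\<epsilon>: "4 * (7 + \<theta>) * \<eta> / r \<le> \<epsilon>"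
  proof -
    have "4 * (7 + \<theta>) * \<eta> \<le> 4 * (7 + \<theta>) * (\<epsilon> * r / (4 * (7 + \<theta>)))"
      using \<theta> by (intro mult_left_mono) (auto simp: \<eta>_def)
    also have "\<dots> = \<epsilon> * r" using \<theta> by simp
    finally show ?thesis using r by (simp add: pos_divide_le_eq)
  qed
  obtain \<zeta> where \<zeta>: "\<zeta> > 0" and near: "\<And>x y. pair_energy x y - pair_energy r r < \<zeta> \<Longrightarrow>
      \<bar>x - r\<bar> \<le> \<eta> \<and> \<bar>y - r\<bar> \<le> \<eta> \<or> \<bar>x + r\<bar> \<le> \<eta> \<and> \<bar>y + r\<bar> \<le> \<eta>"
    using pair_energy_near[OF \<eta>] by blast
  define d where "d = \<zeta> * \<eta> / 2"
  define c where "c = \<eta>\<^sup>2 / (8 * (1 + 2 * \<theta>))"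
  have d: "d > 0" and c: "c > 0" using \<zeta> \<eta> \<theta> by (auto simp: d_def c_def)
  have bound: "gibbs_mean n (null_weight n \<theta>)
      (\<lambda>Y. of_bool (no_phase n \<epsilon> Y))
      \<le> (2 * real n) ^ n * exp (- (d * (real n)\<^sup>2)) + 2 * real n * exp (- (c * real n))"
    if n: "n \<ge> 2" and large: "2 * \<theta> + 2 \<le> \<eta> * (real n - 1)" for n
  proof -
    let ?H = "null_weight n \<theta>"
    let ?S = "\<lambda>i. centred_sum ?H (edges_at n i)"
    let ?E = "\<lambda>Y. excess n (\<lambda>i. degree n Y i / (real n - 1))"
    define x where "x = \<eta> * real n"
    have x: "0 \<le> x" using \<eta> by (simp add: x_def)
    note lip = two_star_lipschitz_facts[where \<theta> = \<theta>, OF _ n]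
    have \<theta>0: "0 \<le> \<theta>" using \<theta> by simp
    have xc: "- x\<^sup>2 / (8 * (1 + 2 * \<theta>) * real n) = - (c * real n)"
      using n \<theta> by (simp add: x_def c_def power2_eq_square)
    have "gibbs_mean n ?H (\<lambda>Y. of_bool (no_phase n \<epsilon> Y))
        \<le> gibbs_mean n ?H (\<lambda>Y. of_bool (d * (real n)\<^sup>2 \<le> ?E Y) + of_bool (\<exists>i\<in>{1..n}. x < \<bar>?S i Y\<bar>))"
    proof (rule gibbs_mean_mono)
      fix Y assume Y: "Y \<in> configs n"
      have "window n \<epsilon> Y \<or> window n \<epsilon> (\<lambda>i j. - Y i j)"
        if "\<not> d * (real n)\<^sup>2 \<le> ?E Y" and no: "\<not> (\<exists>i\<in>{1..n}. x < \<bar>?S i Y\<bar>)"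
      proof -
        have S: "\<bar>?S i Y\<bar> \<le> \<eta> * real n" if "i \<in> {1..n}" for i
          using no that unfolding x_def[symmetric] by (meson linorder_not_less)
        have wide: "window n \<epsilon> X" if "window n (4 * (7 + \<theta>) * \<eta> / r) X" for X
          unfolding window_def
        proof
          fix i assume "i \<in> {1..n}"
          then have "\<bar>degree n X i - (real n - 1) * r\<bar> \<le> 4 * (7 + \<theta>) * \<eta> / r * (real n - 1)"
            using that unfolding window_def by blast
          also have "\<dots> \<le> \<epsilon> * (real n - 1)" using \<eta>\<epsilon> n by (intro mult_right_mono) auto
          finally show "\<bar>degree n X i - (real n - 1) * r\<bar> \<le> \<epsilon> * (real n - 1)" .
        qed
        have ex: "?E Y < \<zeta> * \<eta> * (real n)\<^sup>2 / 2" using that(1) by (simp add: d_def)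
        have n1: "n \<ge> 1" using n by simp
        from majority_phase[OF \<eta>(1) \<zeta> near \<eta>(2) n1 ex] obtain \<sigma> :: real where
          \<sigma>: "\<sigma> = 1 \<or> \<sigma> = -1" and maj: "real (card {j \<in> {1..n}. \<eta> < \<bar>degree n Y j / (real n - 1) - \<sigma> * r\<bar>}) \<le> \<eta> * real n + 1"
          by blast
        from \<sigma> show ?thesis
        proof
          assume "\<sigma> = 1"
          then show ?thesis
            using maj by (intro disjI1 wide plus_phase_window[OF n Y \<eta>(1) large S]) auto
        next
          assume \<sigma>: "\<sigma> = -1"
          have flip: "\<bar>degree n (\<lambda>i j. - Y i j) j / (real n - 1) - r\<bar> = \<bar>degree n Y j / (real n - 1) - \<sigma> * r\<bar>" for j
            unfolding degree_uminus \<sigma> by simp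
          show ?thesis
          proof (intro disjI2 wide plus_phase_window[OF n uminus_in_configs[OF Y] \<eta>(1) large])
            fix i assume "i \<in> {1..n}"
            then show "\<bar>?S i (\<lambda>i j. - Y i j)\<bar> \<le> \<eta> * real n"
              using S centred_sum_uminus[OF Y edges_at_subset] by simp
          qed (use maj flip in simp)
        qed
      qed
      then show "(of_bool (no_phase n \<epsilon> Y) :: real)
          \<le> of_bool (d * (real n)\<^sup>2 \<le> ?E Y) + of_bool (\<exists>i\<in>{1..n}. x < \<bar>?S i Y\<bar>)" by auto
    qed
    also have "\<dots> \<le> (2 * real n) ^ n * exp (- (d * (real n)\<^sup>2)) + 2 * real n * exp (- (c * real n))"
      unfolding gibbs_mean_add xc[symmetric]
    proof (intro add_mono excess_prob[OF n])
      show "gibbs_mean n ?H (\<lambda>Y. of_bool (\<exists>i\<in>{1..n}. x < \<bar>?S i Y\<bar>))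
          \<le> 2 * real n * exp (- x\<^sup>2 / (8 * (1 + 2 * \<theta>) * real n))"
        unfolding log_weight_degree_energy using n by (intro some_vertex_sum_large[OF lip[OF \<theta>0] \<theta>0 _ x]) simp
    qed
    finally show ?thesis .
  qed
  have "\<forall>\<^sub>F n in sequentially. 2 * \<theta> + 2 \<le> \<eta> * (real n - 1)"
    using \<eta>(1) by real_asymp
  \<comment> \<open>The term d n^2 beats n ln (2 n), and halving the rate \<open>c\<close> absorbs
    the prefactor 2 n.\<close>
  moreover have "\<forall>\<^sub>F n in sequentially. exp (real n * ln (2 * real n)) * exp (- (d * (real n)\<^sup>2)) + 2 * real n * exp (- (c * real n)) \<le> exp (- (c / 2) * real n)"
    using c d by real_asymp
  ultimately have "\<forall>\<^sub>F n in sequentially. gibbs_mean n (null_weight n \<theta>)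
      (\<lambda>Y. of_bool (no_phase n \<epsilon> Y)) \<le> exp (- (c / 2) * real n)"
    using eventually_ge_at_top[of 2]
  proof eventually_elim
    case (elim n)
    have "exp (real n * ln (2 * real n)) = (2 * real n) ^ n"
      using elim(3) by (simp add: exp_of_nat_mult)
    then show ?case using bound[OF elim(3,1)] elim(2) by simp
  qed
  then show ?thesis using c by (intro exI[of _ "c / 2"]) auto
qed

end

section \<open>The prior on planted sets\<close>

text \<open>One vertex is planted in each of \<open>m\<close> disjoint blocks of length \<open>q\<close>, independently and uniformly,
  so that the overlap of two planted sets is a sum of independent Bernoulli variables.\<close>

definition plant :: "nat \<Rightarrow> nat \<Rightarrow> (nat \<Rightarrow> nat) \<Rightarrow> nat set" where
  "plant m q \<sigma> = (\<lambda>l. 1 + l * q + \<sigma> l) ` {..<m}"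

definition plants :: "nat \<Rightarrow> nat \<Rightarrow> (nat \<Rightarrow> nat) set" where
  "plants m q = PiE {..<m} (\<lambda>_. {..<q})"

lemma finite_plants [simp]: "finite (plants m q)"
  by (simp add: plants_def finite_PiE)

lemma plants_nonempty: "0 < q \<Longrightarrow> plants m q \<noteq> {}"
  by (auto simp: plants_def PiE_eq_empty_iff)

lemma block_eq_iff:
  fixes q :: nat assumes "x < q" "y < q"
  shows "1 + l * q + x = 1 + k * q + y \<longleftrightarrow> l = k \<and> x = y"
proof
  assume "1 + l * q + x = 1 + k * q + y"
  then have e: "l * q + x = k * q + y" by simp
  have "(l * q + x) div q = l" "(k * q + y) div q = k" using assms by simp_all
  moreover have "(l * q + x) mod q = x" "(k * q + y) mod q = y" using assms by simp_all
  ultimately show "l = k \<and> x = y" using e by metis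
qed auto

lemma plantsD: "\<sigma> \<in> plants m q \<Longrightarrow> l < m \<Longrightarrow> \<sigma> l < q"
  by (auto simp: plants_def PiE_iff)

lemma plant_subset:
  assumes "\<sigma> \<in> plants m q" "m * q \<le> n" shows "plant m q \<sigma> \<subseteq> {1..n}"
proof
  fix i assume "i \<in> plant m q \<sigma>"
  then obtain l where l: "l < m" "i = 1 + l * q + \<sigma> l" by (auto simp: plant_def)
  have "l * q + q \<le> m * q" using l(1) mult_le_mono1[of "Suc l" m q] by simp
  then show "i \<in> {1..n}" using plantsD[OF assms(1) l(1)] assms(2) l(2) by auto
qed

lemma card_plant:
  assumes "\<sigma> \<in> plants m q" shows "card (plant m q \<sigma>) = m"
proof -
  have "inj_on (\<lambda>l. 1 + l * q + \<sigma> l) {..<m}"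
    by (rule inj_onI) (use block_eq_iff plantsD[OF assms] in blast)
  then show ?thesis by (simp add: plant_def card_image)
qed

lemma card_plant_Int:
  assumes \<sigma>: "\<sigma> \<in> plants m q" and \<tau>: "\<tau> \<in> plants m q"
  shows "real (card (plant m q \<sigma> \<inter> plant m q \<tau>)) = (\<Sum>l<m. of_bool (\<sigma> l = \<tau> l))"
proof -
  have "plant m q \<sigma> \<inter> plant m q \<tau> = (\<lambda>l. 1 + l * q + \<sigma> l) ` {l \<in> {..<m}. \<sigma> l = \<tau> l}"
  proof (intro set_eqI iffI)
    fix i assume "i \<in> plant m q \<sigma> \<inter> plant m q \<tau>"
    then obtain l k where "l < m" "i = 1 + l * q + \<sigma> l" "k < m" "i = 1 + k * q + \<tau> k"
      by (auto simp: plant_def)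
    then have "l = k \<and> \<sigma> l = \<tau> k" using block_eq_iff plantsD[OF \<sigma>] plantsD[OF \<tau>] by metis
    then show "i \<in> (\<lambda>l. 1 + l * q + \<sigma> l) ` {l \<in> {..<m}. \<sigma> l = \<tau> l}"
      using \<open>l < m\<close> \<open>i = 1 + l * q + \<sigma> l\<close> by blast
  next
    fix i assume "i \<in> (\<lambda>l. 1 + l * q + \<sigma> l) ` {l \<in> {..<m}. \<sigma> l = \<tau> l}"
    then obtain l where l: "l \<in> {..<m}" "i = 1 + l * q + \<sigma> l" "\<sigma> l = \<tau> l" by blast
    then have "i = 1 + l * q + \<tau> l" by simp
    with l show "i \<in> plant m q \<sigma> \<inter> plant m q \<tau>" unfolding plant_def by blast
  qed
  moreover have "inj_on (\<lambda>l. 1 + l * q + \<sigma> l) {l \<in> {..<m}. \<sigma> l = \<tau> l}"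
    by (rule inj_onI) (use block_eq_iff plantsD[OF \<sigma>] in blast)
  ultimately have "card (plant m q \<sigma> \<inter> plant m q \<tau>) = card {l \<in> {..<m}. \<sigma> l = \<tau> l}"
    by (simp only: card_image)
  then show ?thesis by (simp add: of_bool_def sum.If_cases Int_def)
qed

text \<open>For fixed \<sigma> the block coincidences are independent of probability 1/q, and 1 + x
  \<le> exp x turns the product into the Poisson bound.\<close>

lemma overlap_mgf:
  assumes q: "0 < q" and \<sigma>: "\<sigma> \<in> plants m q" and k: "0 \<le> k"
  shows "(\<Sum>\<tau>\<in>plants m q. exp (k * real (card (plant m q \<sigma> \<inter> plant m q \<tau>))))
    \<le> real (card (plants m q)) * exp (real m * (exp k - 1) / real q)"
proof -
  have "(\<Sum>\<tau>\<in>plants m q. exp (k * real (card (plant m q \<sigma> \<inter> plant m q \<tau>))))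
      = (\<Sum>\<tau>\<in>plants m q. \<Prod>l<m. exp (k * of_bool (\<sigma> l = \<tau> l)))"
    by (intro sum.cong refl) (simp add: card_plant_Int[OF \<sigma>] sum_distrib_left flip: exp_sum)
  also have "\<dots> = (\<Prod>l<m. \<Sum>x<q. exp (k * of_bool (\<sigma> l = x)))"
    unfolding plants_def by (rule prod_sum_PiE[symmetric]) auto
  also have "\<dots> = (\<Prod>l<m. real q * (1 + (exp k - 1) / real q))"
  proof (rule prod.cong[OF refl])
    fix l assume "l \<in> {..<m}"
    then have l: "\<sigma> l < q" using plantsD[OF \<sigma>] by simp
    have "(\<Sum>x<q. exp (k * of_bool (\<sigma> l = x))) = (\<Sum>x<q. 1 + (if \<sigma> l = x then exp k - 1 else 0))"
      by (intro sum.cong refl) auto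
    also have "\<dots> = real q + (exp k - 1)" using l by (simp add: sum.distrib)
    also have "\<dots> = real q * (1 + (exp k - 1) / real q)" using q by (simp add: field_simps)
    finally show "(\<Sum>x<q. exp (k * of_bool (\<sigma> l = x))) = real q * (1 + (exp k - 1) / real q)" .
  qed
  also have "\<dots> = real q ^ m * (1 + (exp k - 1) / real q) ^ m" by (simp add: power_mult_distrib)
  also have "\<dots> \<le> real q ^ m * exp ((exp k - 1) / real q) ^ m"
    using k q by (intro mult_left_mono power_mono exp_ge_add_one_self) auto
  also have "exp ((exp k - 1) / real q) ^ m = exp (real m * (exp k - 1) / real q)"
    by (simp flip: exp_of_nat_mult)
  also have "real q ^ m = real (card (plants m q))" by (simp add: plants_def card_PiE)
  finally show ?thesis .
qed

section \<open>Impossibility below the thresholds\<close>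

definition planted :: "real \<Rightarrow> nat set \<Rightarrow> nat \<Rightarrow> real" where
  "planted A S i = (if i \<in> S then A else 0)"

lemma log_weight_planted:
  assumes "S \<subseteq> {1..n}"
  shows "log_weight n \<theta> (planted A S) Y = null_weight n \<theta> Y + A / 2 * degree_sum n S Y"
proof -
  have "(\<Sum>i=1..n. planted A S i * degree n Y i) = A * degree_sum n S Y"
    unfolding degree_sum_indicator[OF assms] sum_distrib_left
    by (intro sum.cong refl) (simp add: planted_def)
  then show ?thesis by (simp add: log_weight_def)
qed

lemma planted_alternative:
  assumes "S \<subseteq> {1..n}" "A > 0" "s \<le> real (card S)"
  shows "planted A S \<in> alternative n s A"
proof -
  have "supp n (planted A S) = S" using assms by (auto simp: supp_def planted_def)
  then show ?thesis using assms by (auto simp: alternative_def planted_def)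
qed

lemma gibbs_mean_tilt:
  assumes "\<And>Y. Y \<in> configs n \<Longrightarrow> H' Y = H Y + G Y"
  shows "gibbs_mean n H' F = gibbs_mean n H (\<lambda>Y. exp (G Y) * F Y) / gibbs_mean n H (\<lambda>Y. exp (G Y))"
proof -
  have "gibbs_sum n H' F = gibbs_sum n H (\<lambda>Y. exp (G Y) * F Y)" for F
    unfolding gibbs_sum_def using assms by (intro sum.cong refl) (simp add: exp_add)
  then show ?thesis using gibbs_sum_one_pos[of n H] by (simp add: gibbs_mean_def)
qed

lemma gibbs_mean_uminus_config:
  "gibbs_mean n (null_weight n \<theta>) (\<lambda>Y. F (\<lambda>i j. - Y i j)) = gibbs_mean n (null_weight n \<theta>) F"
proof -
  have H: "null_weight n \<theta> (\<lambda>i j. - Y i j) = null_weight n \<theta> Y" for Y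
    by (simp add: log_weight_def degree_uminus)
  have "gibbs_sum n (null_weight n \<theta>) (\<lambda>Y. F (\<lambda>i j. - Y i j)) = gibbs_sum n (null_weight n \<theta>) F"
    unfolding gibbs_sum_def
    by (rule sum.reindex_bij_witness[where i = "\<lambda>Y i j. - Y i j" and j = "\<lambda>Y i j. - Y i j"])
      (auto simp: H uminus_in_configs)
  then show ?thesis by (simp add: gibbs_mean_def)
qed

lemma risk_ge:
  assumes "\<beta> \<in> alternative n s A"
  shows "measure_pmf.prob (ergm n \<theta> (\<lambda>_. 0)) {Y. T Y = 1} + measure_pmf.prob (ergm n \<theta> \<beta>) {Y. T Y = 0}
    \<le> risk n \<theta> s A T"
  unfolding risk_def
  by (intro add_left_mono cSUP_upper assms bdd_aboveI2[of _ _ 1]) auto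

text \<open>For x \<ge> 0 the left side is a minorant of min 1 x. It bounds the sum of the two
  testing errors from below using only the first and second moments of the likelihood ratio.\<close>

lemma min_one_ge_quadratic:
  fixes x :: real shows "x - x\<^sup>2 / 4 \<le> 1"
proof -
  have "0 \<le> (x / 2 - 1)\<^sup>2" by simp
  then show ?thesis by (simp add: power2_eq_square field_simps)
qed

context low_temperature
begin

text \<open>The first summand bounds the feedback exponent through a m \<le> 1. The second bounds
  the logarithm of the averaged overlap factor, where n a^2 \<le> 1/4 keeps the rate
  \<open>k\<close> below 1 / (2 (1 - l)).\<close>

definition overlap_const :: "real \<Rightarrow> real" where
  "overlap_const l = exp (2 / (1 - l) + 4 * exp (1 / (2 * (1 - l))) / (1 - l))"

text \<open>The square of the mixture is an average over pairs of planted sets. Decorrelation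
  replaces each mixed mean by a constant times exp (k |S \<inter> S'|), and the overlap bound
  averages this over the prior.\<close>

lemma second_moment_bound:
  assumes n: "n \<ge> 2" and \<epsilon>: "0 < \<epsilon>" "\<epsilon> < r" and l: "contraction \<epsilon> < 1"
    and m: "1 \<le> m" "m \<le> n" and q: "q = n div m"
    and a: "0 \<le> a" "a * real m \<le> 1" "real n * a\<^sup>2 \<le> 1 / 4"
  defines "H \<equiv> degree_energy n (surrogate n \<epsilon>)"
  defines "w \<equiv> \<lambda>\<sigma> Y. exp (a * degree_sum n (plant m q \<sigma>) Y)"
  shows "gibbs_mean n H (\<lambda>Y. ((\<Sum>\<sigma>\<in>plants m q. w \<sigma> Y / gibbs_mean n H (w \<sigma>)) / real (card (plants m q)))\<^sup>2)
    \<le> overlap_const (contraction \<epsilon>)"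
proof -
  define \<kappa> where "\<kappa> = contraction \<epsilon>"
  define k where "k = 2 * a\<^sup>2 * real n / (1 - \<kappa>)"
  define p where "p = real (card (plants m q))"
  have \<kappa>: "0 \<le> \<kappa>" "\<kappa> < 1" using l contraction_nonneg by (auto simp: \<kappa>_def)
  have q0: "0 < q" using m q by (simp add: div_greater_zero_iff)
  have mq: "m * q \<le> n" using q by simp
  have p: "p > 0" using plants_nonempty[OF q0] by (simp add: p_def card_gt_0_iff)
  have k0: "0 \<le> k" using \<kappa> by (simp add: k_def)
  have k1: "k \<le> 1 / (2 * (1 - \<kappa>))"
  proof -
    have "2 * a\<^sup>2 * real n \<le> 1 / 2" using a(3) by (simp add: mult_ac)
    then have "k \<le> (1 / 2) / (1 - \<kappa>)" unfolding k_def using \<kappa> by (intro divide_right_mono) auto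
    then show ?thesis by simp
  qed
  have w0: "gibbs_mean n H (w \<sigma>) > 0" for \<sigma> unfolding w_def by (rule gibbs_mean_pos) simp
  define b where "b = exp (2 * a\<^sup>2 / (1 - \<kappa>) * (real m * real m))"
  have pair: "gibbs_mean n H (\<lambda>Y. (w \<sigma> Y / gibbs_mean n H (w \<sigma>)) * (w \<tau> Y / gibbs_mean n H (w \<tau>)))
      \<le> b * exp (k * real (card (plant m q \<sigma> \<inter> plant m q \<tau>)))"
    if \<sigma>: "\<sigma> \<in> plants m q" and \<tau>: "\<tau> \<in> plants m q" for \<sigma> \<tau>
  proof -
    have half: "2 * (\<kappa> / (2 * N)) * N = \<kappa>" if "N > 0" for N :: real using that by simp
    have "gibbs_mean n H (\<lambda>Y. w \<sigma> Y * w \<tau> Y) \<le> gibbs_mean n H (w \<sigma>) * gibbs_mean n H (w \<tau>)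
        * exp (2 * a\<^sup>2 / (1 - \<kappa>) * (real n * real (card (plant m q \<sigma> \<inter> plant m q \<tau>))
            + real (card (plant m q \<sigma>)) * real (card (plant m q \<tau>))))"
      unfolding H_def w_def
    proof (rule partition_decorrelation[where \<gamma> = "\<kappa> / (2 * (real n - 1))"])
      show "tanh_lipschitz n (add_field (surrogate n \<epsilon>) u (plant m q \<sigma>)) (\<kappa> / (2 * (real n - 1)))" if "0 \<le> u" for u
        unfolding \<kappa>_def using \<epsilon> that by (intro tanh_lipschitz_surrogate n) auto
      show "2 * (\<kappa> / (2 * (real n - 1))) * (real n - 1) \<le> \<kappa>"
        using half[of "real n - 1"] n by simp
      show "0 \<le> \<kappa> / (2 * (real n - 1))" using \<kappa> n by simp
    qed (use \<kappa> n a plant_subset[OF \<sigma> mq] plant_subset[OF \<tau> mq] in auto)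
    also have "exp (2 * a\<^sup>2 / (1 - \<kappa>) * (real n * real (card (plant m q \<sigma> \<inter> plant m q \<tau>))
            + real (card (plant m q \<sigma>)) * real (card (plant m q \<tau>))))
        = b * exp (k * real (card (plant m q \<sigma> \<inter> plant m q \<tau>)))"
      unfolding card_plant[OF \<sigma>] card_plant[OF \<tau>] b_def k_def exp_add[symmetric]
      by (simp add: algebra_simps)
    finally have "gibbs_mean n H (\<lambda>Y. w \<sigma> Y * w \<tau> Y) / (gibbs_mean n H (w \<sigma>) * gibbs_mean n H (w \<tau>))
        \<le> b * exp (k * real (card (plant m q \<sigma> \<inter> plant m q \<tau>)))"
      using w0[of \<sigma>] w0[of \<tau>] by (simp add: pos_divide_le_eq mult_ac)
    moreover have "gibbs_mean n H (\<lambda>Y. (w \<sigma> Y / gibbs_mean n H (w \<sigma>)) * (w \<tau> Y / gibbs_mean n H (w \<tau>)))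
        = gibbs_mean n H (\<lambda>Y. w \<sigma> Y * w \<tau> Y) / (gibbs_mean n H (w \<sigma>) * gibbs_mean n H (w \<tau>))"
      using gibbs_mean_cmult[of n H "1 / (gibbs_mean n H (w \<sigma>) * gibbs_mean n H (w \<tau>))" "\<lambda>Y. w \<sigma> Y * w \<tau> Y"]
      by (simp add: mult_ac)
    ultimately show ?thesis by simp
  qed
  define B where "B = b * exp (real m * (exp k - 1) / real q)"
  have "gibbs_mean n H (\<lambda>Y. ((\<Sum>\<sigma>\<in>plants m q. w \<sigma> Y / gibbs_mean n H (w \<sigma>)) / p)\<^sup>2)
      = gibbs_mean n H (\<lambda>Y. 1 / p\<^sup>2 * (\<Sum>\<sigma>\<in>plants m q. \<Sum>\<tau>\<in>plants m q.
          (w \<sigma> Y / gibbs_mean n H (w \<sigma>)) * (w \<tau> Y / gibbs_mean n H (w \<tau>))))"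
    by (simp add: power_divide power2_eq_square[of "sum _ _"] sum_product)
  also have "\<dots> = 1 / p\<^sup>2 * (\<Sum>\<sigma>\<in>plants m q. \<Sum>\<tau>\<in>plants m q.
      gibbs_mean n H (\<lambda>Y. (w \<sigma> Y / gibbs_mean n H (w \<sigma>)) * (w \<tau> Y / gibbs_mean n H (w \<tau>))))"
    unfolding gibbs_mean_cmult gibbs_mean_sum ..
  also have "\<dots> \<le> 1 / p\<^sup>2 * (\<Sum>\<sigma>\<in>plants m q. \<Sum>\<tau>\<in>plants m q. b * exp (k * real (card (plant m q \<sigma> \<inter> plant m q \<tau>))))"
    by (intro mult_left_mono sum_mono pair) auto
  also have "\<dots> \<le> 1 / p\<^sup>2 * (\<Sum>\<sigma>\<in>plants m q. b * (p * exp (real m * (exp k - 1) / real q)))"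
  proof (intro mult_left_mono sum_mono)
    fix \<sigma> assume "\<sigma> \<in> plants m q"
    from overlap_mgf[OF q0 this k0]
    show "(\<Sum>\<tau>\<in>plants m q. b * exp (k * real (card (plant m q \<sigma> \<inter> plant m q \<tau>))))
        \<le> b * (p * exp (real m * (exp k - 1) / real q))"
      unfolding sum_distrib_left[symmetric] p_def by (intro mult_left_mono) (auto simp: b_def)
  qed simp
  also have "\<dots> = B" using p by (simp add: B_def p_def[symmetric] power2_eq_square)
  also have "B \<le> overlap_const \<kappa>"
  proof -
    have am2: "a\<^sup>2 * (real m * real m) \<le> 1"
    proof -
      have "(a * real m)\<^sup>2 \<le> 1" using a by (intro power_le_one) auto
      then show ?thesis by (simp add: power2_eq_square mult_ac)
    qed
    \<comment> \<open>Rounding down loses at most a factor 2: n \<le> 2 m q, so the expected overlap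
      m / q is at most 2 m^2 / n.\<close>
    have "n < m * (q + 1)" using m q by (metis add.commute dividend_less_times_div mult.commute mult_Suc_right
        Suc_eq_plus1 less_le_trans zero_less_one)
    also have "m * (q + 1) \<le> m * (2 * q)" using q0 by (intro mult_left_mono) auto
    finally have "real n \<le> real (m * (2 * q))" by (intro of_nat_mono less_imp_le)
    then have nq: "real n \<le> 2 * real m * real q" by simp
    have "exp k * (1 - k) \<le> exp k * exp (- k)"
      using exp_ge_add_one_self[of "- k"] by (intro mult_left_mono) auto
    then have "exp k - 1 \<le> k * exp k" by (simp add: algebra_simps flip: exp_add)
    also have "\<dots> \<le> k * exp (1 / (2 * (1 - \<kappa>)))" using k0 k1 by (intro mult_left_mono) auto
    finally have ek: "exp k - 1 \<le> k * exp (1 / (2 * (1 - \<kappa>)))" .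
    define g where "g = exp (1 / (2 * (1 - \<kappa>))) / (1 - \<kappa>)"
    have g: "0 \<le> g" using \<kappa> by (simp add: g_def)
    have "real m * (exp k - 1) / real q \<le> real m * (k * exp (1 / (2 * (1 - \<kappa>)))) / real q"
      using ek by (intro divide_right_mono mult_left_mono) auto
    also have "\<dots> = 2 * a\<^sup>2 * g * real m * (real n / real q)"
      by (simp add: k_def g_def)
    also have "\<dots> \<le> 2 * a\<^sup>2 * g * real m * (2 * real m)"
      using nq q0 g by (intro mult_left_mono) (auto simp: pos_divide_le_eq mult_ac)
    also have "\<dots> = 4 * g * (a\<^sup>2 * (real m * real m))" by simp
    also have "\<dots> \<le> 4 * g * 1" using am2 g by (intro mult_left_mono) auto
    finally have 1: "real m * (exp k - 1) / real q \<le> 4 * g" by simp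
    have "2 * a\<^sup>2 / (1 - \<kappa>) * (real m * real m) = 2 / (1 - \<kappa>) * (a\<^sup>2 * (real m * real m))" by simp
    also have "\<dots> \<le> 2 / (1 - \<kappa>) * 1" using am2 \<kappa> by (intro mult_left_mono) auto
    finally have 2: "2 * a\<^sup>2 / (1 - \<kappa>) * (real m * real m) \<le> 2 / (1 - \<kappa>)" by simp
    have "B = exp (2 * a\<^sup>2 / (1 - \<kappa>) * (real m * real m) + real m * (exp k - 1) / real q)"
      by (simp add: B_def b_def exp_add)
    also have "\<dots> \<le> exp (2 / (1 - \<kappa>) + 4 * g)" using 1 2 by (subst exp_le_cancel_iff) linarith
    finally show ?thesis by (simp add: overlap_const_def g_def)
  qed
  finally show ?thesis by (simp add: p_def \<kappa>_def)
qed

text \<open>The worst-case risk is at least the Bayes risk under the planting prior. That is bounded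
  below on the plus window, where null expectations are \<rho> times surrogate expectations and the
  second moment is under control.\<close>

lemma risk_lower_bound:
  assumes n: "n \<ge> 2" and \<epsilon>: "0 < \<epsilon>" "\<epsilon> < r" and l: "contraction \<epsilon> < 1"
    and m: "1 \<le> m" "m \<le> n" and A: "0 < A" "A * real m \<le> 2" "real n * A\<^sup>2 \<le> 1"
    and s: "s \<le> real m" and T: "is_test n T"
    and bad: "gibbs_mean n (null_weight n \<theta>)
      (\<lambda>Y. of_bool (no_phase n \<epsilon> Y)) \<le> exp (- c * real n)"
    and c: "exp (- c * real n) \<le> 1 / 2" "A * real m / 2 \<le> c"
    and D: "D = max 34 (overlap_const (contraction \<epsilon>))"
    and out: "gibbs_mean n (degree_energy n (surrogate n \<epsilon>)) (\<lambda>Y. of_bool (\<not> window n \<epsilon> Y)) \<le> 1 / (4 * D)"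
  shows "1 / (8 * D) \<le> risk n \<theta> s A T"
proof -
  define a where "a = A / 2"
  define q where "q = n div m"
  define P where "P = plants m q"
  define p where "p = real (card P)"
  let ?H0 = "null_weight n \<theta>" and ?H1 = "degree_energy n (surrogate n \<epsilon>)"
  let ?E0 = "gibbs_mean n ?H0" and ?E1 = "gibbs_mean n ?H1"
  let ?win = "\<lambda>Y. of_bool (window n \<epsilon> Y) :: real"
  define S where "S \<sigma> = plant m q \<sigma>" for \<sigma>
  define w where "w \<sigma> Y = exp (a * degree_sum n (S \<sigma>) Y)" for \<sigma> Y
  define W where "W \<sigma> = ?E0 (w \<sigma>)" for \<sigma>
  define V where "V \<sigma> = ?E1 (w \<sigma>)" for \<sigma>
  define \<rho> where "\<rho> = gibbs_sum n ?H1 (\<lambda>_. 1) / gibbs_sum n ?H0 (\<lambda>_. 1)"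
  have a: "0 < a" "a * real m \<le> 1" "real n * a\<^sup>2 \<le> 1 / 4" "a * real m \<le> c"
    using A c by (auto simp: a_def power_divide)
  have q0: "0 < q" using m by (simp add: q_def div_greater_zero_iff)
  have mq: "m * q \<le> n" by (simp add: q_def)
  have p: "p > 0" and finP: "finite P"
    using plants_nonempty[OF q0] by (simp_all add: p_def P_def card_gt_0_iff)
  have S: "S \<sigma> \<subseteq> {1..n}" "card (S \<sigma>) = m" if "\<sigma> \<in> P" for \<sigma>
    using that plant_subset[OF _ mq] card_plant by (auto simp: S_def P_def)
  have D34: "D \<ge> 34" "D \<ge> overlap_const (contraction \<epsilon>)" by (auto simp: D)
  have \<rho>: "\<rho> > 0" unfolding \<rho>_def using gibbs_sum_one_pos by simp
  have transfer: "?E0 (\<lambda>Y. ?win Y * F Y) = \<rho> * ?E1 (\<lambda>Y. ?win Y * F Y)" for F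
  proof -
    have "gibbs_sum n ?H0 (\<lambda>Y. ?win Y * F Y) = gibbs_sum n ?H1 (\<lambda>Y. ?win Y * F Y)"
      unfolding gibbs_sum_def by (intro sum.cong refl) (simp add: surrogate_eq_two_star[OF n])
    then show ?thesis
      using gibbs_sum_one_pos[of n ?H1] by (simp add: gibbs_mean_def \<rho>_def)
  qed
  have deg_pos: "0 \<le> degree n Y i" if "window n \<epsilon> Y" "i \<in> {1..n}" for Y i
  proof -
    have "\<bar>degree n Y i - (real n - 1) * r\<bar> \<le> \<epsilon> * (real n - 1)" using that by (simp add: window_def)
    moreover have "\<epsilon> * (real n - 1) \<le> r * (real n - 1)" using \<epsilon> n by (intro mult_right_mono) auto
    ultimately show ?thesis by (simp add: abs_le_iff mult.commute)
  qed
  have K_pos: "0 \<le> degree_sum n (S \<sigma>) Y" if "window n \<epsilon> Y" "\<sigma> \<in> P" for Y \<sigma>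
    unfolding degree_sum_def using deg_pos[OF that(1)] S(1)[OF that(2)] by (intro sum_nonneg) auto
  have w_pos: "0 < w \<sigma> Y" for \<sigma> Y by (simp add: w_def)
  have w_ge: "1 \<le> w \<sigma> Y" if "window n \<epsilon> Y" "\<sigma> \<in> P" for Y \<sigma>
    unfolding w_def using K_pos[OF that] a(1) by simp
  have w_neg: "w \<sigma> Y \<le> 1" if "window n \<epsilon> (\<lambda>i j. - Y i j)" "\<sigma> \<in> P" for Y \<sigma>
  proof -
    have "degree_sum n (S \<sigma>) (\<lambda>i j. - Y i j) = - degree_sum n (S \<sigma>) Y"
      by (simp add: degree_sum_def degree_uminus sum_negf)
    then show ?thesis unfolding w_def using K_pos[OF that] a(1) by (simp add: mult_le_0_iff)
  qed
  have w_le: "w \<sigma> Y \<le> exp (c * real n)" if "Y \<in> configs n" "\<sigma> \<in> P" for Y \<sigma>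
  proof -
    have "a * degree_sum n (S \<sigma>) Y \<le> a * (real m * (real n - 1))"
      using abs_degree_sum_le[OF that(1) S(1)[OF that(2)]] S(2)[OF that(2)] a(1) by (intro mult_left_mono) auto
    also have "\<dots> \<le> c * real n"
    proof -
      have "0 \<le> a * real m" using a(1) by simp
      then have "0 \<le> c" using a(4) by linarith
      then show ?thesis unfolding mult.assoc[symmetric] using a(4) n by (intro mult_mono) auto
    qed
    finally show ?thesis by (simp add: w_def)
  qed
  have win_le: "?E1 ?win \<le> 1"
    using gibbs_mean_mono[of n ?win "\<lambda>_. 1" ?H1] by simp
  have win_ge: "1 / 2 \<le> ?E1 ?win"
  proof -
    have "?E1 (\<lambda>Y. ?win Y + of_bool (\<not> window n \<epsilon> Y)) = ?E1 (\<lambda>_. 1)"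
      by (intro gibbs_mean_cong) auto
    then have "?E1 ?win = 1 - ?E1 (\<lambda>Y. of_bool (\<not> window n \<epsilon> Y))" by (simp add: gibbs_mean_add)
    moreover have "1 / (4 * D) \<le> 1 / 2" using D34 by (intro divide_left_mono) auto
    ultimately show ?thesis using out by linarith
  qed
  have win0: "?E0 ?win = \<rho> * ?E1 ?win" using transfer[of "\<lambda>_. 1"] by simp
  \<comment> \<open>Sign reversal preserves the null, so the two windows have equal mass; with at
    most 1/2 outside, each has at least 1/4.\<close>
  have "?E0 (\<lambda>_. 1) \<le> ?E0 (\<lambda>Y. ?win Y + (?win (\<lambda>i j. - Y i j)
      + of_bool (no_phase n \<epsilon> Y)))"
    by (intro gibbs_mean_mono) auto
  also have "\<dots> \<le> 2 * ?E0 ?win + 1 / 2"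
    using bad c(1) gibbs_mean_uminus_config[of n \<theta> ?win] by (simp add: gibbs_mean_add)
  finally have win0_ge: "1 / 4 \<le> ?E0 ?win" by simp
  have \<rho>4: "1 / 4 \<le> \<rho>"
    using win0_ge win0 mult_left_mono[OF win_le less_imp_le[OF \<rho>]] by simp
  have "?E0 ?win \<le> 1" using gibbs_mean_mono[of n ?win "\<lambda>_. 1" ?H0] by simp
  then have \<rho>2: "\<rho> \<le> 2"
    using win0 mult_left_mono[OF win_ge less_imp_le[OF \<rho>]] by simp
  have V_ge: "1 / 2 \<le> V \<sigma>" if "\<sigma> \<in> P" for \<sigma>
  proof -
    have "?E1 ?win \<le> ?E1 (w \<sigma>)"
      using w_ge[OF _ that] w_pos by (intro gibbs_mean_mono) (auto simp: less_imp_le)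
    then show ?thesis using win_ge by (simp add: V_def)
  qed
  have W_pos: "0 < W \<sigma>" for \<sigma> unfolding W_def by (intro gibbs_mean_pos w_pos)
  \<comment> \<open>The null normalizer of a planted model may exceed the surrogate one only by a
    constant. The plus window gives at most 2 V, the minus window at most 1 because the tilt is then
    at most 1, and the remainder at most exp (c n) exp (- c n). As V \<ge> 1/2, the sum 2 V + 2 is
    at most 6 V; 34 leaves room.\<close>
  have WV: "W \<sigma> \<le> D * V \<sigma>" if \<sigma>: "\<sigma> \<in> P" for \<sigma>
  proof -
    have "W \<sigma> \<le> ?E0 (\<lambda>Y. ?win Y * w \<sigma> Y + (1 + exp (c * real n)
        * of_bool (no_phase n \<epsilon> Y)))"
      unfolding W_def
    proof (rule gibbs_mean_mono)
      fix Y assume Y: "Y \<in> configs n"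
      show "w \<sigma> Y \<le> ?win Y * w \<sigma> Y + (1 + exp (c * real n)
          * of_bool (no_phase n \<epsilon> Y))"
        using w_neg[OF _ \<sigma>, of Y] w_le[OF Y \<sigma>] by (auto intro: add_increasing2 add_increasing)
    qed
    also have "\<dots> = \<rho> * ?E1 (\<lambda>Y. ?win Y * w \<sigma> Y) + (1 + exp (c * real n)
        * ?E0 (\<lambda>Y. of_bool (no_phase n \<epsilon> Y)))"
      by (simp only: gibbs_mean_add gibbs_mean_cmult gibbs_mean_const transfer)
    also have "\<dots> \<le> 2 * V \<sigma> + (1 + exp (c * real n) * exp (- c * real n))"
    proof (intro add_mono mult_mono)
      show "?E1 (\<lambda>Y. ?win Y * w \<sigma> Y) \<le> V \<sigma>"
        unfolding V_def using w_pos by (intro gibbs_mean_mono) (auto simp: less_imp_le)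
      show "0 \<le> ?E1 (\<lambda>Y. ?win Y * w \<sigma> Y)"
        using w_pos by (intro gibbs_mean_nonneg) (auto simp: less_imp_le)
      show "0 \<le> ?E0 (\<lambda>Y. of_bool (no_phase n \<epsilon> Y))"
        by (intro gibbs_mean_nonneg) auto
    qed (use \<rho>2 bad in auto)
    also have "\<dots> = 2 * V \<sigma> + 2" by (simp flip: exp_add)
    also have "\<dots> \<le> 34 * V \<sigma>" using V_ge[OF \<sigma>] by simp
    also have "\<dots> \<le> D * V \<sigma>" using D34 V_ge[OF \<sigma>] by (intro mult_right_mono) auto
    finally show ?thesis .
  qed
  \<comment> \<open>\<open>X\<close> is the likelihood ratio of the mixture normalized under the
    surrogate and has mean 1 there. \<open>X'\<close> is the true likelihood ratio under the null,
    and \<open>WV\<close> gives X' \<ge> X / D.\<close>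
  define X where "X Y = (\<Sum>\<sigma>\<in>P. w \<sigma> Y / V \<sigma>) / p" for Y
  define X' where "X' Y = (\<Sum>\<sigma>\<in>P. w \<sigma> Y / W \<sigma>) / p" for Y
  have X0: "0 \<le> X Y" for Y
    unfolding X_def using p V_ge w_pos by (intro divide_nonneg_pos sum_nonneg) (auto intro!: divide_nonneg_pos simp: less_imp_le intro: less_le_trans[of 0 "1/2"])
  have XX': "X Y / D \<le> X' Y" for Y
  proof -
    have "(\<Sum>\<sigma>\<in>P. w \<sigma> Y / V \<sigma>) / D \<le> (\<Sum>\<sigma>\<in>P. w \<sigma> Y / W \<sigma>)"
      unfolding sum_divide_distrib
    proof (rule sum_mono)
      fix \<sigma> assume \<sigma>: "\<sigma> \<in> P"
      have "w \<sigma> Y / V \<sigma> / D = w \<sigma> Y / (D * V \<sigma>)" by (simp add: mult.commute)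
      also have "\<dots> \<le> w \<sigma> Y / W \<sigma>"
      proof (intro divide_left_mono mult_pos_pos)
        show "0 < D" "0 < V \<sigma>" using D34 V_ge[OF \<sigma>] by linarith+
      qed (use WV[OF \<sigma>] W_pos[of \<sigma>] w_pos[of \<sigma> Y] in auto)
      finally show "w \<sigma> Y / V \<sigma> / D \<le> w \<sigma> Y / W \<sigma>" .
    qed
    then have "(\<Sum>\<sigma>\<in>P. w \<sigma> Y / V \<sigma>) / D / p \<le> (\<Sum>\<sigma>\<in>P. w \<sigma> Y / W \<sigma>) / p"
      using p by (intro divide_right_mono) auto
    then show ?thesis by (simp add: X_def X'_def mult.commute)
  qed
  have mean_X: "?E1 X = 1"
  proof -
    have "?E1 X = ?E1 (\<lambda>Y. 1 / p * (\<Sum>\<sigma>\<in>P. 1 / V \<sigma> * w \<sigma> Y))"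
      by (intro gibbs_mean_cong) (simp add: X_def)
    also have "\<dots> = 1 / p * (\<Sum>\<sigma>\<in>P. 1 / V \<sigma> * V \<sigma>)"
      unfolding gibbs_mean_cmult gibbs_mean_sum V_def ..
    also have "(\<Sum>\<sigma>\<in>P. 1 / V \<sigma> * V \<sigma>) = (\<Sum>\<sigma>\<in>P. 1)"
      using V_ge by (intro sum.cong refl) force
    finally show ?thesis using p by (simp add: p_def)
  qed
  have mean_X2: "?E1 (\<lambda>Y. (X Y)\<^sup>2) \<le> D"
  proof -
    have "w = (\<lambda>\<sigma> Y. exp (a * degree_sum n (plant m q \<sigma>) Y))" by (simp add: w_def S_def fun_eq_iff)
    then have "?E1 (\<lambda>Y. (X Y)\<^sup>2) \<le> overlap_const (contraction \<epsilon>)"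
      using second_moment_bound[OF n \<epsilon> l m q_def less_imp_le[OF a(1)] a(2,3)]
      by (simp add: X_def V_def P_def p_def)
    then show ?thesis using D34 by simp
  qed
  \<comment> \<open>Dividing by \<open>D\<close> before applying the quadratic minorant makes \<phi>
    a lower bound for min 1 X'. Its surrogate mean is at least 1/D - 1/(4D) = 3/(4D); leaving the
    window costs 1/(4D), and \<rho> \<ge> 1/4 turns the remaining 1/(2D) into 1/(8D).\<close>
  define \<phi> where "\<phi> Y = X Y / D - (X Y / D)\<^sup>2 / 4" for Y
  have "3 / (4 * D) \<le> ?E1 \<phi>"
  proof -
    have "?E1 \<phi> = ?E1 (\<lambda>Y. 1 / D * X Y - 1 / (4 * D\<^sup>2) * (X Y)\<^sup>2)"
      by (intro gibbs_mean_cong) (simp add: \<phi>_def power_divide)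
    also have "\<dots> = 1 / D * 1 - 1 / (4 * D\<^sup>2) * ?E1 (\<lambda>Y. (X Y)\<^sup>2)"
      by (simp only: gibbs_mean_diff gibbs_mean_cmult mean_X)
    also have "\<dots> \<ge> 1 / D * 1 - 1 / (4 * D\<^sup>2) * D"
      using mean_X2 by (intro diff_left_mono mult_left_mono) auto
    also have "1 / D * 1 - 1 / (4 * D\<^sup>2) * D = 3 / (4 * D)"
      using D34 by (simp add: power2_eq_square field_simps)
    finally show ?thesis .
  qed
  moreover have "?E1 \<phi> \<le> ?E1 (\<lambda>Y. ?win Y * \<phi> Y) + ?E1 (\<lambda>Y. of_bool (\<not> window n \<epsilon> Y))"
    unfolding gibbs_mean_add[symmetric] \<phi>_def using min_one_ge_quadratic by (intro gibbs_mean_mono) auto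
  ultimately have "3 / (4 * D) - 1 / (4 * D) \<le> ?E1 (\<lambda>Y. ?win Y * \<phi> Y)" using out by linarith
  then have half: "1 / (2 * D) \<le> ?E1 (\<lambda>Y. ?win Y * \<phi> Y)" using D34 by (simp add: field_simps)
  have "1 / (8 * D) = 1 / 4 * (1 / (2 * D))" by simp
  also have "\<dots> \<le> \<rho> * ?E1 (\<lambda>Y. ?win Y * \<phi> Y)"
    using \<rho>4 half D34 \<rho> by (intro mult_mono) auto
  also have "\<dots> = ?E0 (\<lambda>Y. ?win Y * \<phi> Y)" by (rule transfer[symmetric])
  also have "\<dots> \<le> ?E0 (\<lambda>Y. of_bool (T Y = 1) + X' Y * of_bool (T Y = 0))"
  proof (rule gibbs_mean_mono)
    fix Y assume Y: "Y \<in> configs n"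
    have \<phi>1: "\<phi> Y \<le> 1" unfolding \<phi>_def by (rule min_one_ge_quadratic)
    have "0 \<le> (X Y / D)\<^sup>2 / 4" by simp
    then have \<phi>X: "\<phi> Y \<le> X' Y" using XX'[of Y] unfolding \<phi>_def by linarith
    have X'0: "0 \<le> X' Y" using XX'[of Y] X0[of Y] D34 by (meson divide_nonneg_nonneg order_trans zero_le_numeral)
    have "T Y = 0 \<or> T Y = 1" using T Y by (auto simp: is_test_def)
    then show "?win Y * \<phi> Y \<le> of_bool (T Y = 1) + X' Y * of_bool (T Y = 0)"
      using \<phi>1 \<phi>X X'0 by auto
  qed
  also have "\<dots> = ?E0 (\<lambda>Y. of_bool (T Y = 1)) + (\<Sum>\<sigma>\<in>P. ?E0 (\<lambda>Y. w \<sigma> Y * of_bool (T Y = 0)) / W \<sigma>) / p"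
  proof -
    have "?E0 (\<lambda>Y. X' Y * of_bool (T Y = 0)) = ?E0 (\<lambda>Y. 1 / p * (\<Sum>\<sigma>\<in>P. 1 / W \<sigma> * (w \<sigma> Y * of_bool (T Y = 0))))"
      by (intro gibbs_mean_cong) (simp add: X'_def sum_distrib_right)
    also have "\<dots> = 1 / p * (\<Sum>\<sigma>\<in>P. 1 / W \<sigma> * ?E0 (\<lambda>Y. w \<sigma> Y * of_bool (T Y = 0)))"
      unfolding gibbs_mean_cmult gibbs_mean_sum ..
    finally show ?thesis by (simp add: gibbs_mean_add)
  qed
  also have "\<dots> = (\<Sum>\<sigma>\<in>P. ?E0 (\<lambda>Y. of_bool (T Y = 1)) + ?E0 (\<lambda>Y. w \<sigma> Y * of_bool (T Y = 0)) / W \<sigma>) / p"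
    using p by (simp add: sum.distrib p_def add_divide_distrib)
  also have "\<dots> \<le> (\<Sum>\<sigma>\<in>P. risk n \<theta> s A T) / p"
  proof (intro divide_right_mono sum_mono)
    fix \<sigma> assume \<sigma>: "\<sigma> \<in> P"
    have "gibbs_mean n (log_weight n \<theta> (planted A (S \<sigma>))) (\<lambda>Y. of_bool (T Y = 0))
        = ?E0 (\<lambda>Y. w \<sigma> Y * of_bool (T Y = 0)) / W \<sigma>"
      unfolding W_def w_def a_def by (rule gibbs_mean_tilt) (rule log_weight_planted[OF S(1)[OF \<sigma>]])
    moreover have "planted A (S \<sigma>) \<in> alternative n s A"
      using S[OF \<sigma>] A(1) s by (intro planted_alternative) auto
    from risk_ge[OF this, of \<theta> T]
    have "?E0 (\<lambda>Y. of_bool (T Y = 1)) + gibbs_mean n (log_weight n \<theta> (planted A (S \<sigma>))) (\<lambda>Y. of_bool (T Y = 0))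
        \<le> risk n \<theta> s A T"
      unfolding prob_ergm .
    ultimately show "?E0 (\<lambda>Y. of_bool (T Y = 1)) + ?E0 (\<lambda>Y. w \<sigma> Y * of_bool (T Y = 0)) / W \<sigma> \<le> risk n \<theta> s A T"
      by simp
  qed (use p in simp)
  also have "\<dots> = risk n \<theta> s A T" using p by (simp add: p_def)
  finally show ?thesis .
qed

text \<open>The condition on \<open>t\<close> gives n A^2 \<le> 1 for every n, boundary included.
  The strict b + t < 0 makes A m tend to 0, which is what brings it below the unspecified rate
  \<open>c\<close> of the two-phase estimate.\<close>

lemma not_powerful:
  assumes b: "0 < b" "b < 1" and bt: "b + t < 0" and t: "t \<le> - 1 / 2"
    and T: "\<And>n. is_test n (T n)"
  shows "asymp_not_powerful \<theta> (\<lambda>n. real n powr b) (\<lambda>n. real n powr t) T"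
proof -
  obtain \<epsilon> where \<epsilon>: "0 < \<epsilon>" "\<epsilon> < r" and l: "contraction \<epsilon> < 1" using contraction_exists by blast
  obtain c where c: "c > 0" and bad: "\<forall>\<^sub>F n in sequentially. gibbs_mean n (null_weight n \<theta>)
      (\<lambda>Y. of_bool (no_phase n \<epsilon> Y)) \<le> exp (- c * real n)"
    using null_two_phases[OF \<epsilon>(1)] by blast
  define D where "D = max 34 (overlap_const (contraction \<epsilon>))"
  define g where "g = (1 - contraction \<epsilon>) * \<epsilon>"
  have g: "g > 0" using l \<epsilon> by (simp add: g_def)
  have D: "D > 0" by (simp add: D_def)
  have D4: "1 / (4 * D) > 0" using D by simp
  have "(\<lambda>n. 2 * real n * exp (- (g * (real n - 1) / 2)\<^sup>2 / (8 * (1 + 2 * \<theta>) * real n))) \<longlonglongrightarrow> 0"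
  proof -
    have "1 + 2 * \<theta> > 0" using \<theta> by simp
    then show ?thesis using g by real_asymp
  qed
  from order_tendstoD(2)[OF this D4]
  have e1: "\<forall>\<^sub>F n in sequentially. 2 * real n * exp (- (g * (real n - 1) / 2)\<^sup>2 / (8 * (1 + 2 * \<theta>) * real n)) < 1 / (4 * D)" .
  have e2: "\<forall>\<^sub>F n in sequentially. 2 \<le> g * (real n - 1)" using g by real_asymp
  have e3: "\<forall>\<^sub>F n in sequentially. exp (- c * real n) \<le> 1 / 2" using c by real_asymp
  have e4: "\<forall>\<^sub>F n in sequentially. real n powr (b + t) \<le> min 1 c"
  proof -
    have "(\<lambda>n. real n powr (b + t)) \<longlonglongrightarrow> 0" using bt by real_asymp
    moreover have "0 < min 1 c" using c by simp
    ultimately show ?thesis by (rule eventually_mono[OF order_tendstoD(2)]) simp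
  qed
  have "\<forall>\<^sub>F n in sequentially. 1 / (8 * D) \<le> risk n \<theta> (real n powr b) (real n powr t) (T n)"
    using bad e1 e2 e3 e4 eventually_ge_at_top[of 2]
  proof eventually_elim
    case (elim n)
    then have n: "n \<ge> 2" "real n \<ge> 2" by auto
    \<comment> \<open>Rounded up, so that planted sets have at least n^b vertices; still at most 2
      n^b.\<close>
    define m where "m = nat \<lceil>real n powr b\<rceil>"
    have nb: "1 \<le> real n powr b" "real n powr b \<le> real n"
      using powr_mono[of 0 b "real n"] powr_mono[of b 1 "real n"] b n by simp_all
    have mr: "real m = of_int \<lceil>real n powr b\<rceil>" using nb by (simp add: m_def)
    have m: "real n powr b \<le> real m" "real m \<le> real n powr b + 1"
      unfolding mr by (simp_all add: of_int_ceiling_le_add_one)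
    have "m \<le> n" unfolding m_def using nb(2) by (simp add: nat_le_iff ceiling_le_iff)
    moreover have "1 \<le> m" using m(1) nb(1) by linarith
    moreover have "real n powr t * real m \<le> 2 * real n powr (b + t)"
    proof -
      have "real n powr t * real m \<le> real n powr t * (2 * real n powr b)"
        using m nb by (intro mult_left_mono) auto
      then show ?thesis by (simp add: powr_add mult_ac)
    qed
    moreover have "real n * (real n powr t)\<^sup>2 \<le> 1"
    proof -
      have "real n * (real n powr t)\<^sup>2 = real n powr (1 + t + t)"
        using n by (simp only: powr_add power2_eq_square) simp
      also have "\<dots> \<le> real n powr 0" using t n by (intro powr_mono) auto
      finally show ?thesis using n by simp
    qed
    moreover have "gibbs_mean n (degree_energy n (surrogate n \<epsilon>)) (\<lambda>Y. of_bool (\<not> window n \<epsilon> Y)) \<le> 1 / (4 * D)"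
      using surrogate_window_prob[OF n(1) \<epsilon> l] elim(2,3) unfolding g_def by linarith
    ultimately show ?case
      using elim n by (intro risk_lower_bound[OF n(1) \<epsilon> l, of m _ _ _ c]) (auto simp: T D_def m)
  qed
  then have "\<forall>\<^sub>F n in sequentially. ereal (1 / (8 * D)) \<le> ereal (risk n \<theta> (real n powr b) (real n powr t) (T n))"
    by simp
  then have "ereal (1 / (8 * D)) \<le> liminf (\<lambda>n. ereal (risk n \<theta> (real n powr b) (real n powr t) (T n)))"
    by (rule Liminf_bounded)
  moreover have "ereal (1 / (8 * D)) > 0" using D by simp
  ultimately show ?thesis unfolding asymp_not_powerful_def by (rule less_le_trans[rotated])
qed

end

theorem theorem1p7:
  fixes \<theta> b t :: real and s A :: "nat \<Rightarrow> real"
  assumes "\<theta> > 1/2"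
    and "0 < b" and "b < 1" and "t < 0"
    and "\<And>n. s n = real n powr b"
    and "\<And>n. A n = real n powr t"
  shows
    "(b \<ge> 1/2 \<and> b + t < 0 \<longrightarrow>
        (\<forall>T. (\<forall>n. is_test n (T n)) \<longrightarrow> asymp_not_powerful \<theta> s A T)) \<and>
     (b \<ge> 1/2 \<and> b + t > 0 \<longrightarrow>
        (\<forall>L. (\<forall>\<^sub>F n in sequentially. L n > 0) \<and> much_less (\<lambda>n. real n) L \<and>
             much_less L (\<lambda>n. real n * s n * A n) \<longrightarrow>
           asymp_powerful \<theta> s A (cc_sum_test \<theta> L))) \<and>
     (b < 1/2 \<and> t + 1/2 \<le> 0 \<longrightarrow>
        (\<forall>T. (\<forall>n. is_test n (T n)) \<longrightarrow> asymp_not_powerful \<theta> s A T)) \<and>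
     (b < 1/2 \<and> t + 1/2 > 0 \<longrightarrow>
        (\<exists>C>0. asymp_powerful \<theta> s A (cc_max_test \<theta> C)))"
proof -
  have sA: "s = (\<lambda>n. real n powr b)" "A = (\<lambda>n. real n powr t)" using assms(5,6) by auto
  have \<theta>: "\<theta> > 0" using assms(1) by simp
  obtain r where "low_temperature \<theta> r" using low_temperature_exists[OF assms(1)] by blast
  then interpret low_temperature \<theta> r .
  show ?thesis
    unfolding sA
  proof (intro conjI impI allI)
    \<comment> \<open>Here t < - b \<le> - 1/2.\<close>
    fix T assume "1/2 \<le> b \<and> b + t < 0" "\<forall>n. is_test n (T n)"
    then show "asymp_not_powerful \<theta> (\<lambda>n. real n powr b) (\<lambda>n. real n powr t) T"
      using assms(2,3) by (intro not_powerful) auto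
  next
    fix L assume "1/2 \<le> b \<and> 0 < b + t"
      "(\<forall>\<^sub>F n in sequentially. 0 < L n) \<and> much_less real L \<and> much_less L (\<lambda>n. real n * real n powr b * real n powr t)"
    then show "asymp_powerful \<theta> (\<lambda>n. real n powr b) (\<lambda>n. real n powr t) (cc_sum_test \<theta> L)"
      using assms(3,4) \<theta> by (intro sum_test_powerful) auto
  next
    \<comment> \<open>Here b + t < 1/2 - 1/2 = 0.\<close>
    fix T assume "b < 1/2 \<and> t + 1/2 \<le> 0" "\<forall>n. is_test n (T n)"
    then show "asymp_not_powerful \<theta> (\<lambda>n. real n powr b) (\<lambda>n. real n powr t) T"
      using assms(2,3) by (intro not_powerful) auto
  next
    assume "b < 1/2 \<and> 0 < t + 1/2"
    then show "\<exists>C>0. asymp_powerful \<theta> (\<lambda>n. real n powr b) (\<lambda>n. real n powr t) (cc_max_test \<theta> C)"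
      using assms(3,4) \<theta> by (intro max_test_powerful) auto
  qed
qed

end
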